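(* Let $S = k[x_1,\ldots,x_n]$ be a standard graded polynomial ring over a field $k$, and let $M$ be a nonzero finitely generated graded $S$-module of projective dimension $p$. Suppose $f \in \operatorname{Ann}(M)$ is a nonzero homogeneous element and set $d = \deg(f)$. Then \[T_p(M) \le T_{p-1}(M) + d = T_{p-1}(M) + T_1(S/(f)).\] In particular, for any nonzero proper homogeneous ideal $I$ of $S$, if $p = \operatorname{pd}(S/I)$, then \[T_p(S/I) \le T_{p-1}(S/I) + t_1(S/I).\]
   Context: For a nonzero finitely generated graded $S$-module $N$, $\operatorname{pd}(N)$ is the projective dimension of $N$ over $S$. For $0 \le i \le \operatorname{pd}(N)$, $T_i(N) = \max\{j \mid \operatorname{Tor}_i^S(N,k)_j \neq 0\}$ and $t_i(N) = \min\{j \mid \operatorname{Tor}_i^S(N,k)_j \neq 0\}$ are the $i$th maximal and minimal graded shifts in the minimal graded free resolution of $N$ over $S$. *)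

theory Defs
  imports
    "HOL-Library.Poly_Mapping"
    "HOL-Library.Extended_Nat"
    "HOL-Algebra.Module"
    "HOL-Algebra.Ideal"
    "HOL-Algebra.Generated_Groups"
    "HOL-Algebra.Algebraic_Closure_Type"
begin

text \<open>
  The polynomial ring $k[x_1,\ldots,x_n]$ is the type \<open>('n, 'k) mpoly\<close> with \<open>'k\<close> a field and
  \<open>'n\<close> a finite type with $n$ elements; as a ring in the sense of HOL-Algebra it is
  \<open>ring_of_type_algebra\<close>, with the whole type as carrier. Modules are HOL-Algebra modules,
  whose fields \<open>monoid.mult\<close> and \<open>one\<close> have no meaning and are left \<open>undefined\<close>.
\<close>

type_synonym ('n, 'k) mpoly = "('n \<Rightarrow>\<^sub>0 nat) \<Rightarrow>\<^sub>0 'k"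

abbreviation base_ring :: "'r::comm_ring_1 ring" where
  "base_ring \<equiv> ring_of_type_algebra"


section \<open>Modules over a commutative ring\<close>

definition regular_module :: "('r::comm_ring_1, 'r) module" where
  "regular_module =
     \<lparr>carrier = UNIV, monoid.mult = undefined, one = undefined, zero = 0, add = (+), module.smult = (*)\<rparr>"

definition free_module :: "'b set \<Rightarrow> ('r::comm_ring_1, 'b \<Rightarrow>\<^sub>0 'r) module" where
  "free_module B =
     \<lparr>carrier = {v. Poly_Mapping.keys v \<subseteq> B}, monoid.mult = undefined, one = undefined,
      zero = 0, add = (+), module.smult = (\<lambda>r v. Poly_Mapping.map ((*) r) v)\<rparr>"

definition quot_module :: "('r, 'm) module \<Rightarrow> 'm set \<Rightarrow> ('r, 'm set) module" where
  "quot_module M N =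
     \<lparr>carrier = a_rcosets\<^bsub>M\<^esub> N, monoid.mult = undefined, one = undefined, zero = N, add = set_add M,
      module.smult = (\<lambda>r C. \<Union>x\<in>C. N +>\<^bsub>M\<^esub> (r \<odot>\<^bsub>M\<^esub> x))\<rparr>"

definition submodule_span :: "('r::comm_ring_1, 'm) module \<Rightarrow> 'm set \<Rightarrow> 'm set" where
  "submodule_span M C = \<Inter>{N. submodule N base_ring M \<and> C \<subseteq> N}"

definition fin_gen :: "('r::comm_ring_1, 'm) module \<Rightarrow> bool" where
  "fin_gen M \<longleftrightarrow> (\<exists>C. finite C \<and> C \<subseteq> carrier M \<and> submodule_span M C = carrier M)"

definition annihilator :: "('r, 'm) module \<Rightarrow> 'r set" where
  "annihilator M = {r. \<forall>x\<in>carrier M. r \<odot>\<^bsub>M\<^esub> x = \<zero>\<^bsub>M\<^esub>}"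

definition mod_hom :: "('r, 'm) module \<Rightarrow> ('r, 'n) module \<Rightarrow> ('m \<Rightarrow> 'n) set" where
  "mod_hom M N =
     {h \<in> carrier M \<rightarrow> carrier N.
        (\<forall>x\<in>carrier M. \<forall>y\<in>carrier M. h (x \<oplus>\<^bsub>M\<^esub> y) = h x \<oplus>\<^bsub>N\<^esub> h y) \<and>
        (\<forall>r. \<forall>x\<in>carrier M. h (r \<odot>\<^bsub>M\<^esub> x) = r \<odot>\<^bsub>N\<^esub> h x)}"


section \<open>Projective dimension\<close>

text \<open>
  Projective means: a direct summand of a free module. It is no restriction that the basis
  is a set of elements of the type of \<open>P\<close>, since one may take the free module on \<open>carrier P\<close>.
\<close>

definition projective :: "('r::comm_ring_1, 'm) module \<Rightarrow> bool" where
  "projective P \<longleftrightarrow> module base_ring P \<and>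
     (\<exists>B :: 'm set. \<exists>\<iota>\<in>mod_hom P (free_module B). \<exists>\<pi>\<in>mod_hom (free_module B) P.
        \<forall>x\<in>carrier P. \<pi> (\<iota> x) = x)"

text \<open>
  Exactness of $\cdots \to P_2 \to P_1 \to P_0 \to M \to 0$, with \<open>\<delta> i\<close> the map
  $P_{i+1} \to P_i$ and \<open>\<epsilon>\<close> the augmentation.
\<close>

definition exact_resolution ::
  "('r, 'm) module \<Rightarrow> (nat \<Rightarrow> ('r, 'p) module) \<Rightarrow> ('p \<Rightarrow> 'm) \<Rightarrow> (nat \<Rightarrow> 'p \<Rightarrow> 'p) \<Rightarrow> bool" where
  "exact_resolution M P \<epsilon> \<delta> \<longleftrightarrow>
     \<epsilon> \<in> mod_hom (P 0) M \<and> (\<forall>i. \<delta> i \<in> mod_hom (P (Suc i)) (P i)) \<and>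
     \<epsilon> ` carrier (P 0) = carrier M \<and>
     \<delta> 0 ` carrier (P (Suc 0)) = a_kernel (P 0) M \<epsilon> \<and>
     (\<forall>i. \<delta> (Suc i) ` carrier (P (Suc (Suc i))) = a_kernel (P (Suc i)) (P i) (\<delta> i))"

text \<open>
  HOL cannot quantify over all types inside a definition, so the modules \<open>P i\<close> have carriers in
  the type \<open>nat \<Rightarrow>\<^sub>0 'r\<close>. When \<open>'r\<close> is an infinite type this contains a copy of every countably
  generated \<open>'r\<close>-module, and a finitely generated module over a Noetherian ring that has a
  projective resolution of length at most \<open>p\<close> has one by finitely generated modules.
\<close>

definition has_projective_resolution :: "('r::comm_ring_1, 'm) module \<Rightarrow> nat \<Rightarrow> bool" where
  "has_projective_resolution M p \<longleftrightarrow>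
     (\<exists>(P :: nat \<Rightarrow> ('r, nat \<Rightarrow>\<^sub>0 'r) module) \<epsilon> \<delta>.
        (\<forall>i. projective (P i)) \<and> exact_resolution M P \<epsilon> \<delta> \<and>
        (\<forall>i>p. carrier (P i) = {\<zero>\<^bsub>P i\<^esub>}))"

text \<open>The infimum of the empty set is \<open>\<infinity>\<close>.\<close>

definition proj_dim :: "('r::comm_ring_1, 'm) module \<Rightarrow> enat" where
  "proj_dim M = (INF p \<in> {p. has_projective_resolution M p}. enat p)"


section \<open>Tensor products\<close>

text \<open>
  $M \otimes N$ is the free module on \<open>carrier M \<times> carrier N\<close> modulo the submodule generated by
  the bilinearity relations.
\<close>

definition tensor_rels ::
  "('r::comm_ring_1, 'm) module \<Rightarrow> ('r, 'n) module \<Rightarrow> ('m \<times> 'n \<Rightarrow>\<^sub>0 'r) set" where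
  "tensor_rels M N = submodule_span (free_module (carrier M \<times> carrier N))
     ({Poly_Mapping.single (x \<oplus>\<^bsub>M\<^esub> x', y) 1 - Poly_Mapping.single (x, y) 1
         - Poly_Mapping.single (x', y) 1
       | x x' y. x \<in> carrier M \<and> x' \<in> carrier M \<and> y \<in> carrier N}
    \<union> {Poly_Mapping.single (x, y \<oplus>\<^bsub>N\<^esub> y') 1 - Poly_Mapping.single (x, y) 1
         - Poly_Mapping.single (x, y') 1
       | x y y'. x \<in> carrier M \<and> y \<in> carrier N \<and> y' \<in> carrier N}
    \<union> {Poly_Mapping.single (r \<odot>\<^bsub>M\<^esub> x, y) 1 - Poly_Mapping.single (x, y) r
       | r x y. x \<in> carrier M \<and> y \<in> carrier N}
    \<union> {Poly_Mapping.single (x, r \<odot>\<^bsub>N\<^esub> y) 1 - Poly_Mapping.single (x, y) r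
       | r x y. x \<in> carrier M \<and> y \<in> carrier N})"

definition tensor ::
  "('r::comm_ring_1, 'm) module \<Rightarrow> ('r, 'n) module \<Rightarrow> ('r, ('m \<times> 'n \<Rightarrow>\<^sub>0 'r) set) module" where
  "tensor M N = quot_module (free_module (carrier M \<times> carrier N)) (tensor_rels M N)"

definition pure_tensor ::
  "('r::comm_ring_1, 'm) module \<Rightarrow> ('r, 'n) module \<Rightarrow> 'm \<Rightarrow> 'n \<Rightarrow> ('m \<times> 'n \<Rightarrow>\<^sub>0 'r) set" where
  "pure_tensor M N x y =
     tensor_rels M N +>\<^bsub>free_module (carrier M \<times> carrier N)\<^esub> Poly_Mapping.single (x, y) 1"

text \<open>
  For a homomorphism $h : M \to M'$, the map $h \otimes \mathrm{id}_N$ sends the class of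
  $\sum_p c_p\,(x_p, y_p)$ to the class of $\sum_p c_p\,(h(x_p), y_p)$.
\<close>

definition tensor_map ::
  "('r::comm_ring_1, 'm) module \<Rightarrow> ('r, 'n) module \<Rightarrow> ('m0 \<Rightarrow> 'm)
     \<Rightarrow> ('m0 \<times> 'n \<Rightarrow>\<^sub>0 'r) set \<Rightarrow> ('m \<times> 'n \<Rightarrow>\<^sub>0 'r) set" where
  "tensor_map M' N h C =
     (\<Union>v\<in>C. tensor_rels M' N +>\<^bsub>free_module (carrier M' \<times> carrier N)\<^esub>
        (\<Sum>q\<in>Poly_Mapping.keys v. Poly_Mapping.single (h (fst q), snd q) (Poly_Mapping.lookup v q)))"


section \<open>Graded modules over the standard graded polynomial ring\<close>

definition homog :: "int \<Rightarrow> ('n::finite, 'k::field) mpoly set" where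
  "homog j = {f. \<forall>m\<in>Poly_Mapping.keys f. int (\<Sum>i\<in>UNIV. Poly_Mapping.lookup m i) = j}"

text \<open>\<open>G j\<close> is the component of degree \<open>j\<close>; \<open>M\<close> is the internal direct sum of the \<open>G j\<close>.\<close>

definition graded_module ::
  "(('n::finite, 'k::field) mpoly, 'm) module \<Rightarrow> (int \<Rightarrow> 'm set) \<Rightarrow> bool" where
  "graded_module M G \<longleftrightarrow> module base_ring M \<and>
     (\<forall>j. subgroup (G j) (add_monoid M)) \<and>
     (\<forall>i j. \<forall>f\<in>homog i. \<forall>x\<in>G j. f \<odot>\<^bsub>M\<^esub> x \<in> G (i + j)) \<and>
     (\<forall>x\<in>carrier M. \<exists>!c. (\<forall>j. c j \<in> G j) \<and> finite {j. c j \<noteq> \<zero>\<^bsub>M\<^esub>} \<and>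
        x = (\<Oplus>\<^bsub>M\<^esub>j\<in>{j. c j \<noteq> \<zero>\<^bsub>M\<^esub>}. c j))"

definition homogeneous_ideal :: "('n::finite, 'k::field) mpoly set \<Rightarrow> bool" where
  "homogeneous_ideal I \<longleftrightarrow> (\<exists>A \<subseteq> (\<Union>j. homog j). I = genideal base_ring A)"

definition quot_ring_module ::
  "('n::finite, 'k::field) mpoly set
     \<Rightarrow> (('n, 'k) mpoly, ('n, 'k) mpoly set) module" where
  "quot_ring_module I = quot_module regular_module I"

definition quot_ring_grading ::
  "('n::finite, 'k::field) mpoly set \<Rightarrow> int \<Rightarrow> ('n, 'k) mpoly set set" where
  "quot_ring_grading I j = (\<lambda>f. I +>\<^bsub>regular_module\<^esub> f) ` homog j"

text \<open>The ideal generated by the variables; \<open>k\<close> as a graded module is the quotient by it.\<close>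

definition irrelevant_ideal :: "('n::finite, 'k::field) mpoly set" where
  "irrelevant_ideal = genideal base_ring
     (range (\<lambda>i. Poly_Mapping.single (Poly_Mapping.single i 1) 1))"

definition tensor_grading ::
  "(('n::finite, 'k::field) mpoly, 'm) module \<Rightarrow> (int \<Rightarrow> 'm set)
     \<Rightarrow> (('n, 'k) mpoly, 'l) module \<Rightarrow> (int \<Rightarrow> 'l set)
     \<Rightarrow> int \<Rightarrow> ('m \<times> 'l \<Rightarrow>\<^sub>0 ('n, 'k) mpoly) set set" where
  "tensor_grading M G N H j = generate (add_monoid (tensor M N))
     {pure_tensor M N x y | x y a b. x \<in> G a \<and> y \<in> H b \<and> a + b = j}"


section \<open>Graded Tor\<close>

text \<open>
  The data of a graded free resolution: $F_i = \bigoplus_{l < r_i} S(-a_{i,l})$ with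
  $r_i$ = \<open>rk i\<close> and $a_{i,l}$ = \<open>shift i l\<close>, augmentation $F_0 \to M$ and boundary
  maps \<open>bd i\<close> from $F_{i+1}$ to $F_i$.
\<close>

record (overloaded) ('r, 'm) free_resolution =
  rk :: "nat \<Rightarrow> nat"
  shift :: "nat \<Rightarrow> nat \<Rightarrow> int"
  aug :: "(nat \<Rightarrow>\<^sub>0 'r) \<Rightarrow> 'm"
  bd :: "nat \<Rightarrow> (nat \<Rightarrow>\<^sub>0 'r) \<Rightarrow> (nat \<Rightarrow>\<^sub>0 'r)"

definition res_mod ::
  "('r::comm_ring_1, 'm) free_resolution \<Rightarrow> nat \<Rightarrow> ('r, nat \<Rightarrow>\<^sub>0 'r) module" where
  "res_mod F i = free_module {..<rk F i}"

definition res_grading ::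
  "(('n::finite, 'k::field) mpoly, 'm) free_resolution
     \<Rightarrow> nat \<Rightarrow> int \<Rightarrow> (nat \<Rightarrow>\<^sub>0 ('n, 'k) mpoly) set" where
  "res_grading F i j =
     {v \<in> carrier (res_mod F i). \<forall>l<rk F i. Poly_Mapping.lookup v l \<in> homog (j - shift F i l)}"

definition graded_free_resolution ::
  "(('n::finite, 'k::field) mpoly, 'm) module \<Rightarrow> (int \<Rightarrow> 'm set)
     \<Rightarrow> (('n, 'k) mpoly, 'm) free_resolution \<Rightarrow> bool" where
  "graded_free_resolution M G F \<longleftrightarrow>
     exact_resolution M (res_mod F) (aug F) (bd F) \<and>
     (\<forall>j. aug F ` res_grading F 0 j \<subseteq> G j) \<and>
     (\<forall>i j. bd F i ` res_grading F (Suc i) j \<subseteq> res_grading F i j)"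

text \<open>
  The homology of $F \otimes k$, where $k$ is the quotient by \<open>irrelevant_ideal\<close>, with its
  grading. In position \<open>0\<close> every element of $F_0 \otimes k$ is a cycle.
\<close>

type_synonym ('n, 'k) res_tensor_elt =
  "((nat \<Rightarrow>\<^sub>0 ('n, 'k) mpoly) \<times> ('n, 'k) mpoly set \<Rightarrow>\<^sub>0 ('n, 'k) mpoly) set"

definition res_tensor ::
  "(('n::finite, 'k::field) mpoly, 'm) free_resolution \<Rightarrow> nat
     \<Rightarrow> (('n, 'k) mpoly, ('n, 'k) res_tensor_elt) module"
  where
  "res_tensor F i = tensor (res_mod F i) (quot_ring_module irrelevant_ideal)"

definition res_tensor_bd ::
  "(('n::finite, 'k::field) mpoly, 'm) free_resolution \<Rightarrow> nat
     \<Rightarrow> ('n, 'k) res_tensor_elt \<Rightarrow> ('n, 'k) res_tensor_elt" where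
  "res_tensor_bd F i = tensor_map (res_mod F i) (quot_ring_module irrelevant_ideal) (bd F i)"

definition cycles ::
  "(('n::finite, 'k::field) mpoly, 'm) free_resolution \<Rightarrow> nat
     \<Rightarrow> ('n, 'k) res_tensor_elt set" where
  "cycles F i = (case i of
       0 \<Rightarrow> carrier (res_tensor F 0)
     | Suc i' \<Rightarrow> a_kernel (res_tensor F (Suc i')) (res_tensor F i') (res_tensor_bd F i'))"

definition boundaries ::
  "(('n::finite, 'k::field) mpoly, 'm) free_resolution \<Rightarrow> nat
     \<Rightarrow> ('n, 'k) res_tensor_elt set" where
  "boundaries F i = res_tensor_bd F i ` carrier (res_tensor F (Suc i))"

definition homology_module ::
  "(('n::finite, 'k::field) mpoly, 'm) free_resolution \<Rightarrow> nat
     \<Rightarrow> (('n, 'k) mpoly, ('n, 'k) res_tensor_elt set) module"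
  where
  "homology_module F i =
     quot_module ((res_tensor F i)\<lparr>carrier := cycles F i\<rparr>) (boundaries F i)"

definition homology_grading ::
  "(('n::finite, 'k::field) mpoly, 'm) free_resolution \<Rightarrow> nat \<Rightarrow> int
     \<Rightarrow> ('n, 'k) res_tensor_elt set set" where
  "homology_grading F i j =
     (\<lambda>z. boundaries F i +>\<^bsub>(res_tensor F i)\<lparr>carrier := cycles F i\<rparr>\<^esub> z) `
       (cycles F i \<inter>
        tensor_grading (res_mod F i) (res_grading F i)
          (quot_ring_module irrelevant_ideal) (quot_ring_grading irrelevant_ideal) j)"

text \<open>
  Tor is computed from an arbitrary but fixed graded free resolution with finite ranks; it does
  not depend on the choice up to isomorphism of graded modules.
\<close>

definition chosen_resolution ::
  "(('n::finite, 'k::field) mpoly, 'm) module \<Rightarrow> (int \<Rightarrow> 'm set)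
     \<Rightarrow> (('n, 'k) mpoly, 'm) free_resolution" where
  "chosen_resolution M G = (SOME F. graded_free_resolution M G F)"

definition Tor_module ::
  "nat \<Rightarrow> (('n::finite, 'k::field) mpoly, 'm) module \<Rightarrow> (int \<Rightarrow> 'm set)
     \<Rightarrow> (('n, 'k) mpoly, ('n, 'k) res_tensor_elt set) module"
  where
  "Tor_module i M G = homology_module (chosen_resolution M G) i"

definition Tor_component ::
  "nat \<Rightarrow> (('n::finite, 'k::field) mpoly, 'm) module \<Rightarrow> (int \<Rightarrow> 'm set) \<Rightarrow> int
     \<Rightarrow> ('n, 'k) res_tensor_elt set set" where
  "Tor_component i M G j = homology_grading (chosen_resolution M G) i j"

text \<open>
  For nonzero finitely generated \<open>M\<close> and \<open>i\<close> at most the projective dimension of \<open>M\<close>, the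
  set of degrees below is finite and nonempty; otherwise \<open>Max\<close> and \<open>Min\<close> may be unspecified.
\<close>

definition max_shift ::
  "nat \<Rightarrow> (('n::finite, 'k::field) mpoly, 'm) module \<Rightarrow> (int \<Rightarrow> 'm set) \<Rightarrow> int" where
  "max_shift i M G = Max {j. Tor_component i M G j \<noteq> {\<zero>\<^bsub>Tor_module i M G\<^esub>}}"

definition min_shift ::
  "nat \<Rightarrow> (('n::finite, 'k::field) mpoly, 'm) module \<Rightarrow> (int \<Rightarrow> 'm set) \<Rightarrow> int" where
  "min_shift i M G = Min {j. Tor_component i M G j \<noteq> {\<zero>\<^bsub>Tor_module i M G\<^esub>}}"

end

theory Submission
  imports Defs "HOL-Computational_Algebra.Primes" "HOL-Library.Infinite_Set"
begin

text \<open>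
  Let $F$ be the minimal graded free resolution of $M$. The bound on the last shift is read off
  from the last two steps of $F$. As \<open>f\<close> annihilates $M$, multiplication by \<open>f\<close> on $F$ lifts the zero
  map of $M$, so it is null-homotopic: $f = \partial h + h \partial$. Since $F_{p+1} = 0$, a basis
  element $e$ of $F_p$ satisfies $f e = h(\partial e)$. Write $\partial e = \sum_l a_l e_l$; comparing
  coefficients at $e$ gives $f = \sum_l a_l c_l$ for certain polynomials $c_l$, where $a_l$ is
  homogeneous of degree $\deg e - \deg e_l$. If all these degrees were larger than \<open>d\<close>, the
  right-hand side would have no term of degree \<open>d\<close>. Hence $\deg e \le \deg e_l + d$ for some basis
  element $e_l$ of $F_{p-1}$, and one takes $e$ of maximal degree. This is \<open>annihilator_last_step\<close>;
  the homotopy may be inhomogeneous.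

  The rest connects this argument with the definitions, in which Tor comes from an arbitrary
  resolution and the projective dimension from arbitrary ungraded projective modules.

  \<^item> Minimal resolutions exist (\<open>ex_minimal_resolution\<close>), by Hilbert's basis theorem and
    because a smallest system of homogeneous generators has no relation with a unit coefficient.

  \<^item> Tensoring a free module with $k$ amounts to taking constant terms of coordinates. So
    the nonvanishing of a graded component of Tor is a statement about the resolution modulo the
    irrelevant ideal (\<open>homology_grading_nonzero_iff\<close>). Comparison maps between two resolutions, inverse
    to each other up to homotopy, then show that $\mathrm{Tor}_i(M,k)_j \neq 0$ exactly if $F_i$ has a
    basis element of degree $j$ (\<open>tor_nonzero_iff_shift\<close>).

  \<^item> If $M$ has a projective resolution of length $p$, the identity of $F$ factors through it up
    to homotopy. In degrees above $p$ it is thus homotopic to zero, which minimality allows only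
    if $F_i = 0$ (\<open>rank_zero_beyond_projective_length\<close>). Conversely $F$ is a projective resolution,
    so $F_p \neq 0$.

  For $S/(f)$ the minimal resolution is $0 \to S(-d) \to S$. For $S/I$ a minimal resolution can be
  started with $S \to S/I$, and then a basis element of $F_1$ of degree $t_1$ is sent to a nonzero
  element of $I$ of that degree, to which the first part applies.
\<close>

section \<open>Free modules\<close>

abbreviation lookup :: "('a \<Rightarrow>\<^sub>0 'b::zero) \<Rightarrow> 'a \<Rightarrow> 'b" where "lookup \<equiv> Poly_Mapping.lookup"
abbreviation keys :: "('a \<Rightarrow>\<^sub>0 'b::zero) \<Rightarrow> 'a set" where "keys \<equiv> Poly_Mapping.keys"
abbreviation single :: "'a \<Rightarrow> 'b \<Rightarrow> ('a \<Rightarrow>\<^sub>0 'b::zero)" where "single \<equiv> Poly_Mapping.single"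

abbreviation scale :: "'r::comm_ring_1 \<Rightarrow> ('b \<Rightarrow>\<^sub>0 'r) \<Rightarrow> ('b \<Rightarrow>\<^sub>0 'r)" (infixr "\<star>" 75)
  where "r \<star> v \<equiv> Poly_Mapping.map ((*) r) v"

lemma lookup_scale [simp]: "lookup (r \<star> v) b = r * lookup v b"
  by (simp add: Poly_Mapping.map.rep_eq when_def)

lemma scale_distribs:
  "r \<star> (v + w) = r \<star> v + r \<star> w" "(r + s) \<star> v = r \<star> v + s \<star> v" "(r * s) \<star> v = r \<star> s \<star> v"
  "r \<star> (v - w) = r \<star> v - r \<star> w" "r \<star> (- v) = - (r \<star> v)"
  by (rule poly_mapping_eqI; simp add: lookup_add lookup_minus algebra_simps)+

lemma scale_simps [simp]:
  "1 \<star> v = v" "0 \<star> v = 0" "r \<star> 0 = 0" "r \<star> single b c = single b (r * c)" "(-1) \<star> v = - v"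
  by (rule poly_mapping_eqI; simp add: lookup_single when_def)+

lemma scale_sum: "r \<star> (\<Sum>i\<in>A. f i) = (\<Sum>i\<in>A. r \<star> f i)"
  by (rule poly_mapping_eqI) (simp add: lookup_sum sum_distrib_left)

lemma keys_subsetI: "(\<And>b. lookup v b \<noteq> 0 \<Longrightarrow> b \<in> B) \<Longrightarrow> keys v \<subseteq> B"
  by (auto simp: in_keys_iff)

lemma lookup_outside: "keys v \<subseteq> B \<Longrightarrow> b \<notin> B \<Longrightarrow> lookup v b = 0"
  by (auto simp: in_keys_iff)

lemma keys_scale_subset: "keys v \<subseteq> B \<Longrightarrow> keys (r \<star> v) \<subseteq> B"
  by (rule keys_subsetI) (metis lookup_scale lookup_outside mult_zero_right)

lemma keys_add_subset: "keys v \<subseteq> B \<Longrightarrow> keys w \<subseteq> B \<Longrightarrow> keys (v + w) \<subseteq> B"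
  using Poly_Mapping.keys_add[of v w] by blast

lemma keys_uminus_subset: "keys v \<subseteq> B \<Longrightarrow> keys (- v) \<subseteq> B" for v :: "'b \<Rightarrow>\<^sub>0 'r::ab_group_add"
  by (auto simp: in_keys_iff)

lemma keys_minus_subset: "keys v \<subseteq> B \<Longrightarrow> keys w \<subseteq> B \<Longrightarrow> keys (v - w) \<subseteq> B"
  for v :: "'b \<Rightarrow>\<^sub>0 'r::ab_group_add"
  by (rule keys_subsetI) (metis lookup_minus lookup_outside diff_zero)

lemma keys_sum_subset: "(\<And>i. i \<in> A \<Longrightarrow> keys (f i) \<subseteq> B) \<Longrightarrow> keys (\<Sum>i\<in>A. f i) \<subseteq> B"
  by (induction A rule: infinite_finite_induct) (simp_all add: keys_add_subset)

lemmas keys_subset_intros =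
  keys_scale_subset keys_add_subset keys_uminus_subset keys_minus_subset keys_sum_subset

lemma free_expand:
  assumes "finite A" "keys v \<subseteq> A"
  shows "v = (\<Sum>b\<in>A. lookup v b \<star> single b 1)"
proof (rule poly_mapping_eqI)
  fix k
  have "lookup (\<Sum>b\<in>A. lookup v b \<star> single b 1) k = (\<Sum>b\<in>A. if k = b then lookup v b else 0)"
    by (auto simp: lookup_sum lookup_single when_def intro!: sum.cong)
  also have "\<dots> = lookup v k"
    using assms by (auto simp: lookup_outside)
  finally show "lookup v k = lookup (\<Sum>b\<in>A. lookup v b \<star> single b 1) k" ..
qed

lemma base_ring_simps [simp]:
  "carrier (base_ring :: 'r::comm_ring_1 ring) = UNIV" "one (base_ring :: 'r ring) = 1"
  "zero (base_ring :: 'r ring) = 0" "add (base_ring :: 'r ring) = (+)"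
  "monoid.mult (base_ring :: 'r ring) = (*)"
  by (auto simp: ring_of_type_algebra_def)

lemma free_module_simps [simp]:
  "carrier (free_module B) = {v. keys v \<subseteq> B}" "zero (free_module B) = 0"
  "add (free_module B) = (+)" "module.smult (free_module B) = scale"
  by (auto simp: free_module_def)

lemma abelian_group_of_class:
  fixes C :: "'a::ab_group_add set"
  assumes "carrier R = C" "zero R = 0" "add R = (+)"
    and "0 \<in> C" "\<And>x y. x \<in> C \<Longrightarrow> y \<in> C \<Longrightarrow> x + y \<in> C" "\<And>x. x \<in> C \<Longrightarrow> - x \<in> C"
  shows "abelian_group R"
  by (rule abelian_groupI) (use assms in \<open>auto simp: algebra_simps intro!: bexI[of _ "- x" for x]\<close>)

lemma module_free_submodule:
  fixes Z :: "('b \<Rightarrow>\<^sub>0 'r::comm_ring_1) set"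
  assumes "0 \<in> Z" "\<And>x y. x \<in> Z \<Longrightarrow> y \<in> Z \<Longrightarrow> x + y \<in> Z" "\<And>r x. x \<in> Z \<Longrightarrow> r \<star> x \<in> Z"
  shows "module base_ring (free_module B\<lparr>carrier := Z\<rparr>)"
proof (rule moduleI)
  have neg: "- x \<in> Z" if "x \<in> Z" for x
    using assms(3)[OF that, of "-1"] by simp
  show "abelian_group (free_module B\<lparr>carrier := Z\<rparr>)"
    by (rule abelian_group_of_class[where C = Z]) (use assms neg in auto)
qed (use assms in \<open>auto simp: scale_distribs\<close>)

lemma module_free: "module base_ring (free_module B :: ('r::comm_ring_1, 'b \<Rightarrow>\<^sub>0 'r) module)"
proof -
  have "free_module B\<lparr>carrier := {v. keys v \<subseteq> B}\<rparr> = (free_module B :: ('r, 'b \<Rightarrow>\<^sub>0 'r) module)"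
    by (simp add: free_module_def)
  then show ?thesis
    using module_free_submodule[of "{v :: 'b \<Rightarrow>\<^sub>0 'r. keys v \<subseteq> B}" B]
    by (auto simp: keys_subset_intros simp del: free_module_simps)
qed

lemma finsum_class:
  fixes f :: "'i \<Rightarrow> 'a::ab_group_add"
  assumes "abelian_group R" "zero R = 0" "add R = (+)" "finite A" "\<And>i. i \<in> A \<Longrightarrow> f i \<in> carrier R"
  shows "finsum R f A = sum f A"
proof -
  interpret abelian_group R by fact
  show ?thesis
    using assms(4,5)
    by (induction A) (simp_all add: assms(2,3) Pi_iff finsum_insert)
qed

section \<open>Homomorphisms\<close>

lemma mod_homI:
  assumes "\<And>x. x \<in> carrier M \<Longrightarrow> h x \<in> carrier N"
    "\<And>x y. x \<in> carrier M \<Longrightarrow> y \<in> carrier M \<Longrightarrow> h (x \<oplus>\<^bsub>M\<^esub> y) = h x \<oplus>\<^bsub>N\<^esub> h y"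
    "\<And>r x. x \<in> carrier M \<Longrightarrow> h (r \<odot>\<^bsub>M\<^esub> x) = r \<odot>\<^bsub>N\<^esub> h x"
  shows "h \<in> mod_hom M N"
  using assms by (auto simp: mod_hom_def)

lemma mod_homD:
  assumes "h \<in> mod_hom M N"
  shows "x \<in> carrier M \<Longrightarrow> h x \<in> carrier N"
    "x \<in> carrier M \<Longrightarrow> y \<in> carrier M \<Longrightarrow> h (x \<oplus>\<^bsub>M\<^esub> y) = h x \<oplus>\<^bsub>N\<^esub> h y"
    "x \<in> carrier M \<Longrightarrow> h (r \<odot>\<^bsub>M\<^esub> x) = r \<odot>\<^bsub>N\<^esub> h x"
  using assms by (auto simp: mod_hom_def)

lemma mod_hom_comp: "h \<in> mod_hom M N \<Longrightarrow> g \<in> mod_hom N L \<Longrightarrow> (\<lambda>x. g (h x)) \<in> mod_hom M L"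
  by (rule mod_homI) (simp_all add: mod_homD)

lemma mod_hom_zero:
  fixes M :: "('r::comm_ring_1, 'm) module" and N :: "('r, 'n) module"
  assumes "h \<in> mod_hom M N" "module base_ring M" "module base_ring N"
  shows "h \<zero>\<^bsub>M\<^esub> = \<zero>\<^bsub>N\<^esub>"
proof -
  interpret M: module base_ring M by fact
  interpret N: module base_ring N by fact
  have "h \<zero>\<^bsub>M\<^esub> = h (0 \<odot>\<^bsub>M\<^esub> \<zero>\<^bsub>M\<^esub>)"
    using M.smult_l_null[of "\<zero>\<^bsub>M\<^esub>"] by simp
  also have "\<dots> = 0 \<odot>\<^bsub>N\<^esub> h \<zero>\<^bsub>M\<^esub>"
    by (rule mod_homD(3)[OF assms(1)]) simp
  also have "\<dots> = \<zero>\<^bsub>N\<^esub>"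
    using N.smult_l_null[of "h \<zero>\<^bsub>M\<^esub>"] mod_homD(1)[OF assms(1)] by simp
  finally show ?thesis .
qed

lemma mod_hom_finsum:
  fixes M :: "('r::comm_ring_1, 'm) module" and N :: "('r, 'n) module"
  assumes "h \<in> mod_hom M N" "module base_ring M" "module base_ring N"
    and "finite A" "\<And>i. i \<in> A \<Longrightarrow> f i \<in> carrier M"
  shows "h (finsum M f A) = finsum N (\<lambda>i. h (f i)) A"
proof -
  interpret M: module base_ring M by fact
  interpret N: module base_ring N by fact
  show ?thesis
    using assms(4,5)
  proof (induction A)
    case empty
    then show ?case by (simp add: mod_hom_zero[OF assms(1-3)])
  next
    case (insert x F)
    then have "f \<in> F \<rightarrow> carrier M" "(\<lambda>i. h (f i)) \<in> F \<rightarrow> carrier N"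
      by (auto intro: mod_homD(1)[OF assms(1)])
    then show ?case
      using insert by (simp add: mod_homD[OF assms(1)])
  qed
qed

lemma free_hom_simps:
  assumes "h \<in> mod_hom (free_module A) (free_module B)"
  shows "keys x \<subseteq> A \<Longrightarrow> keys (h x) \<subseteq> B"
    "keys x \<subseteq> A \<Longrightarrow> keys y \<subseteq> A \<Longrightarrow> h (x + y) = h x + h y"
    "keys x \<subseteq> A \<Longrightarrow> h (r \<star> x) = r \<star> h x"
    "keys x \<subseteq> A \<Longrightarrow> keys y \<subseteq> A \<Longrightarrow> h (x - y) = h x - h y"
    "h 0 = 0"
proof -
  show add: "keys x \<subseteq> A \<Longrightarrow> keys y \<subseteq> A \<Longrightarrow> h (x + y) = h x + h y" for x y
    using mod_homD(2)[OF assms, of x y] by simp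
  show "keys x \<subseteq> A \<Longrightarrow> keys y \<subseteq> A \<Longrightarrow> h (x - y) = h x - h y"
    using add[of "x - y" y] by (simp add: keys_subset_intros)
  show "h 0 = 0" using add[of 0 0] by simp
qed (use mod_homD[OF assms] in auto)

definition lin_ext :: "('r::comm_ring_1, 'm) module \<Rightarrow> ('b \<Rightarrow> 'm) \<Rightarrow> ('b \<Rightarrow>\<^sub>0 'r) \<Rightarrow> 'm" where
  "lin_ext N g v = (\<Oplus>\<^bsub>N\<^esub>b\<in>keys v. lookup v b \<odot>\<^bsub>N\<^esub> g b)"

lemma lin_ext_superset:
  fixes N :: "('r::comm_ring_1, 'm) module"
  assumes "module base_ring N" "finite A" "keys v \<subseteq> A" "\<And>b. b \<in> A \<Longrightarrow> g b \<in> carrier N"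
  shows "lin_ext N g v = (\<Oplus>\<^bsub>N\<^esub>b\<in>A. lookup v b \<odot>\<^bsub>N\<^esub> g b)"
proof -
  interpret N: module base_ring N by fact
  show ?thesis
    unfolding lin_ext_def
  proof (rule N.add.finprod_mono_neutral_cong_left)
    fix i assume "i \<in> A - keys v"
    then show "lookup v i \<odot>\<^bsub>N\<^esub> g i = \<zero>\<^bsub>N\<^esub>"
      using assms(4) N.smult_l_null by (simp add: in_keys_iff)
  qed (use assms in auto)
qed

lemma lin_ext_single:
  fixes N :: "('r::comm_ring_1, 'm) module"
  assumes "module base_ring N" "g b \<in> carrier N"
  shows "lin_ext N g (single b r) = r \<odot>\<^bsub>N\<^esub> g b"
proof -
  interpret N: module base_ring N by fact
  show ?thesis
    using lin_ext_superset[OF assms(1), of "{b}" "single b r" g] assms(2)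
    using N.finsum_insert[of "{}" b "\<lambda>x. lookup (single b r) x \<odot>\<^bsub>N\<^esub> g x"] by simp
qed

lemma lin_ext_hom:
  fixes N :: "('r::comm_ring_1, 'm) module" and B :: "'b set"
  assumes "module base_ring N" "\<And>b. b \<in> B \<Longrightarrow> g b \<in> carrier N"
  shows "lin_ext N g \<in> mod_hom (free_module B) N"
proof (rule mod_homI)
  interpret N: module base_ring N by fact
  fix x :: "'b \<Rightarrow>\<^sub>0 'r" assume x: "x \<in> carrier (free_module B)"
  then have gx: "\<And>b. b \<in> keys x \<Longrightarrow> g b \<in> carrier N" using assms(2) by auto
  show "lin_ext N g x \<in> carrier N"
    unfolding lin_ext_def by (rule N.finsum_closed) (use gx in auto)
  show "lin_ext N g (r \<odot>\<^bsub>free_module B\<^esub> x) = r \<odot>\<^bsub>N\<^esub> lin_ext N g x" for r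
  proof -
    have "lin_ext N g (r \<star> x) = (\<Oplus>\<^bsub>N\<^esub>b\<in>keys x. (r * lookup x b) \<odot>\<^bsub>N\<^esub> g b)"
      using lin_ext_superset[OF assms(1), of "keys x" "r \<star> x" g] gx
      by (simp add: keys_scale_subset)
    also have "\<dots> = (\<Oplus>\<^bsub>N\<^esub>b\<in>keys x. r \<odot>\<^bsub>N\<^esub> (lookup x b \<odot>\<^bsub>N\<^esub> g b))"
      by (rule N.finsum_cong') (use gx N.smult_assoc1 in auto)
    also have "\<dots> = r \<odot>\<^bsub>N\<^esub> lin_ext N g x"
      unfolding lin_ext_def by (rule N.finsum_smult_ldistr[symmetric]) (use gx in auto)
    finally show ?thesis by simp
  qed
  fix y :: "'b \<Rightarrow>\<^sub>0 'r" assume y: "y \<in> carrier (free_module B)"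
  define A where "A = keys x \<union> keys y"
  have A: "finite A" "keys x \<subseteq> A" "keys y \<subseteq> A" "keys (x + y) \<subseteq> A"
    using Poly_Mapping.keys_add[of x y] by (auto simp: A_def)
  have gA: "\<And>b. b \<in> A \<Longrightarrow> g b \<in> carrier N" using x y assms(2) by (auto simp: A_def)
  have ext: "lin_ext N g w = (\<Oplus>\<^bsub>N\<^esub>b\<in>A. lookup w b \<odot>\<^bsub>N\<^esub> g b)" if "keys w \<subseteq> A" for w
    by (rule lin_ext_superset[OF assms(1) A(1) that gA])
  have "lin_ext N g (x + y) = (\<Oplus>\<^bsub>N\<^esub>b\<in>A. lookup x b \<odot>\<^bsub>N\<^esub> g b \<oplus>\<^bsub>N\<^esub> lookup y b \<odot>\<^bsub>N\<^esub> g b)"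
    unfolding ext[OF A(4)]
    by (rule N.finsum_cong') (use gA N.smult_l_distr in \<open>auto simp: lookup_add\<close>)
  also have "\<dots> = lin_ext N g x \<oplus>\<^bsub>N\<^esub> lin_ext N g y"
    unfolding ext[OF A(2)] ext[OF A(3)]
    by (rule N.finsum_addf) (use gA in auto)
  finally show "lin_ext N g (x \<oplus>\<^bsub>free_module B\<^esub> y) = lin_ext N g x \<oplus>\<^bsub>N\<^esub> lin_ext N g y" by simp
qed

lemma hom_eq_lin_ext:
  fixes N :: "('r::comm_ring_1, 'm) module" and B :: "'b set"
  assumes "module base_ring N" "h \<in> mod_hom (free_module B) N" "keys v \<subseteq> B"
  shows "h v = lin_ext N (\<lambda>b. h (single b 1)) v"
proof -
  interpret N: module base_ring N by fact
  have fin: "v = finsum (free_module B) (\<lambda>b. lookup v b \<star> single b 1) (keys v)"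
  proof -
    have "abelian_group (free_module B :: ('r, 'b \<Rightarrow>\<^sub>0 'r) module)"
      using module_free[of B] by (auto simp: module_def)
    then have "finsum (free_module B) (\<lambda>b. lookup v b \<star> single b 1) (keys v)
        = (\<Sum>b\<in>keys v. lookup v b \<star> single b 1)"
      by (rule finsum_class) (use assms(3) in \<open>auto split: if_splits\<close>)
    then show ?thesis using free_expand[of "keys v" v] by simp
  qed
  have "h v = finsum N (\<lambda>b. h (lookup v b \<star> single b 1)) (keys v)"
    by (subst fin, rule mod_hom_finsum[OF assms(2) module_free assms(1)])
      (use assms(3) in \<open>auto split: if_splits\<close>)
  also have "\<dots> = lin_ext N (\<lambda>b. h (single b 1)) v"
    unfolding lin_ext_def
  proof (rule N.finsum_cong')
    fix b assume b: "b \<in> keys v"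
    then have s: "single b 1 \<in> carrier (free_module B)" using assms(3) by auto
    show "h (lookup v b \<star> single b 1) = lookup v b \<odot>\<^bsub>N\<^esub> h (single b 1)"
      using mod_homD(3)[OF assms(2) s, of "lookup v b"] by simp
  next
    show "(\<lambda>b. lookup v b \<odot>\<^bsub>N\<^esub> h (single b 1)) \<in> keys v \<rightarrow> carrier N"
      using assms(3) by (auto intro!: N.smult_closed mod_homD(1)[OF assms(2)])
  qed simp
  finally show ?thesis .
qed

lemma hom_eq_on_basis:
  fixes N :: "('r::comm_ring_1, 'm) module"
  assumes "module base_ring N" "h \<in> mod_hom (free_module B) N" "h' \<in> mod_hom (free_module B) N"
    and eq: "\<And>b. b \<in> B \<Longrightarrow> h (single b 1) = h' (single b 1)" and v: "keys v \<subseteq> B"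
  shows "h v = h' v"
proof -
  interpret N: module base_ring N by fact
  show ?thesis
    unfolding hom_eq_lin_ext[OF assms(1,2) v] hom_eq_lin_ext[OF assms(1,3) v] lin_ext_def
    by (rule N.finsum_cong') (use eq v in \<open>auto intro!: N.smult_closed mod_homD(1)[OF assms(3)]\<close>)
qed

lemma free_hom_expand:
  fixes h :: "('b \<Rightarrow>\<^sub>0 'r::comm_ring_1) \<Rightarrow> ('c \<Rightarrow>\<^sub>0 'r)"
  assumes "h \<in> mod_hom (free_module A) (free_module B)" "finite A" "keys v \<subseteq> A"
  shows "h v = (\<Sum>b\<in>A. lookup v b \<star> h (single b 1))"
proof -
  have ab: "abelian_group (free_module B :: ('r, 'c \<Rightarrow>\<^sub>0 'r) module)"
    using module_free[of B] by (auto simp: module_def)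
  have hb: "\<And>b. b \<in> A \<Longrightarrow> h (single b 1) \<in> carrier (free_module B)"
    by (rule mod_homD(1)[OF assms(1)]) auto
  have "h v = (\<Oplus>\<^bsub>free_module B\<^esub>b\<in>A. lookup v b \<star> h (single b 1))"
    using hom_eq_lin_ext[OF module_free assms(1,3)]
      lin_ext_superset[OF module_free assms(2,3), of "\<lambda>b. h (single b 1)" B] hb by simp
  also have "\<dots> = (\<Sum>b\<in>A. lookup v b \<star> h (single b 1))"
    by (rule finsum_class[OF ab]) (use hb in \<open>auto intro!: assms keys_scale_subset simp: keys_scale_subset\<close>)
  finally show ?thesis .
qed

section \<open>Polynomials\<close>

definition mdeg :: "('n::finite \<Rightarrow>\<^sub>0 nat) \<Rightarrow> int" where
  "mdeg m = int (\<Sum>i\<in>UNIV. lookup m i)"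

lemma mdeg_add: "mdeg (m + m') = mdeg m + mdeg m'"
  by (simp add: mdeg_def lookup_add sum.distrib)

lemma mdeg_nonneg: "0 \<le> mdeg m"
  unfolding mdeg_def by (rule of_nat_0_le_iff)

lemma mdeg_eq_0_iff: "mdeg m = 0 \<longleftrightarrow> m = 0"
proof
  assume "mdeg m = 0"
  then have "lookup m i = 0" for i by (simp add: mdeg_def del: of_nat_sum)
  then show "m = 0" by (intro poly_mapping_eqI) simp
qed (simp add: mdeg_def)

lemma homog_iff: "f \<in> homog j \<longleftrightarrow> (\<forall>m. lookup f m \<noteq> 0 \<longrightarrow> mdeg m = j)"
  by (auto simp: homog_def mdeg_def in_keys_iff)

lemma homog_zero [simp]: "0 \<in> homog j"
  by (simp add: homog_iff)

lemma homog_one [simp]: "1 \<in> homog 0"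
  by (simp add: homog_def)

lemma homog_single_zero [simp]: "single 0 c \<in> homog 0"
  by (simp add: homog_def)

lemma homog_add: "f \<in> homog j \<Longrightarrow> g \<in> homog j \<Longrightarrow> f + g \<in> homog j"
  by (auto simp: homog_iff lookup_add) (metis add.right_neutral)

lemma homog_uminus: "f \<in> homog j \<Longrightarrow> - f \<in> homog j"
  by (simp add: homog_iff)

lemma homog_mult:
  assumes "f \<in> homog i" "g \<in> homog j"
  shows "f * g \<in> homog (i + j)"
  unfolding homog_iff
proof (intro allI impI)
  fix m assume "lookup (f * g) m \<noteq> 0"
  then obtain a b where "m = a + b" "a \<in> keys f" "b \<in> keys g"
    using Poly_Mapping.keys_mult[of f g] by (auto simp: in_keys_iff)
  then show "mdeg m = i + j"
    using assms by (simp add: homog_iff mdeg_add in_keys_iff)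
qed

lemma homog_neg_eq_0: "f \<in> homog j \<Longrightarrow> j < 0 \<Longrightarrow> f = 0"
  by (rule poly_mapping_eqI) (metis homog_iff linorder_not_less lookup_zero mdeg_nonneg)

lift_definition hcomp :: "int \<Rightarrow> (('n::finite \<Rightarrow>\<^sub>0 nat) \<Rightarrow>\<^sub>0 'k::zero) \<Rightarrow> (('n \<Rightarrow>\<^sub>0 nat) \<Rightarrow>\<^sub>0 'k)"
  is "\<lambda>j f m. if mdeg m = j then f m else 0"
  by (rule finite_subset) auto

lemma hcomp_homog [simp]: "hcomp j f \<in> homog j"
  by (simp add: homog_iff hcomp.rep_eq)

lemma hcomp_of_homog: "f \<in> homog i \<Longrightarrow> hcomp j f = (if j = i then f else 0)"
  by (rule poly_mapping_eqI) (auto simp: homog_iff hcomp.rep_eq)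

lemma hcomp_zero [simp]: "hcomp j 0 = 0"
  by (rule poly_mapping_eqI) (simp add: hcomp.rep_eq)

lemma hcomp_add: "hcomp j (f + g) = hcomp j f + hcomp j g"
  by (rule poly_mapping_eqI) (simp add: hcomp.rep_eq lookup_add)

lemma hcomp_neq_0: "hcomp j f \<noteq> 0 \<Longrightarrow> j \<in> mdeg ` keys f"
  by (metis (no_types, lifting) hcomp.rep_eq image_eqI in_keys_iff lookup_zero poly_mapping_eqI)

lemma sum_hcomp:
  assumes "finite J" "mdeg ` keys f \<subseteq> J"
  shows "(\<Sum>j\<in>J. hcomp j f) = f"
proof (rule poly_mapping_eqI)
  fix m
  have "lookup (\<Sum>j\<in>J. hcomp j f) m = (\<Sum>j\<in>J. if mdeg m = j then lookup f m else 0)"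
    by (simp add: lookup_sum hcomp.rep_eq)
  also have "\<dots> = lookup f m"
    using assms by (auto simp: image_subset_iff lookup_not_eq_zero_eq_in_keys[symmetric])
  finally show "lookup (\<Sum>j\<in>J. hcomp j f) m = lookup f m" .
qed

abbreviation const_coeff :: "('n, 'k::zero) mpoly \<Rightarrow> 'k" where
  "const_coeff f \<equiv> lookup f 0"

lemma lookup_single_zero_mult: "lookup (single 0 c * f) m = c * lookup f m"
  for f :: "('n, 'k::comm_ring_1) mpoly"
  by (metis lookup_scale mult_map_scale_conv_mult)

text \<open>
  Exponents are nonnegative, so $1$ arises as a product of monomials only as $1 \cdot 1$.
\<close>

lemma const_coeff_mult: "const_coeff (f * g) = const_coeff f * const_coeff g"
  for f :: "('n::finite, 'k::comm_ring_1) mpoly"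
proof -
  define f' where "f' = f - single 0 (const_coeff f)"
  have "0 \<notin> keys (f' * g)"
  proof
    assume "0 \<in> keys (f' * g)"
    then obtain a b where ab: "0 = a + b" "a \<in> keys f'"
      using Poly_Mapping.keys_mult[of f' g] by blast
    then have "mdeg a + mdeg b = 0" by (metis mdeg_add mdeg_eq_0_iff)
    then have "a = 0" using mdeg_nonneg[of a] mdeg_nonneg[of b] mdeg_eq_0_iff[of a] by simp
    then show False using ab(2) by (simp add: f'_def in_keys_iff lookup_minus)
  qed
  moreover have "f * g = single 0 (const_coeff f) * g + f' * g"
    by (simp add: f'_def algebra_simps)
  ultimately show ?thesis
    by (simp add: lookup_add lookup_single_zero_mult in_keys_iff)
qed

lemma const_coeff_homog: "f \<in> homog j \<Longrightarrow> j \<noteq> 0 \<Longrightarrow> const_coeff f = 0"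
  by (metis homog_iff mdeg_eq_0_iff)

lemma homog_zero_eq_const: "f \<in> homog 0 \<Longrightarrow> f = single 0 (const_coeff f)"
  by (rule poly_mapping_eqI) (auto simp: homog_iff lookup_single when_def mdeg_eq_0_iff)

lemma const_coeff_hcomp: "const_coeff (hcomp j f) = (if j = 0 then const_coeff f else 0)"
  by (auto simp: hcomp.rep_eq mdeg_eq_0_iff[THEN iffD2])

lemma lookup_single_mult: "lookup (single a c * f) (a + b) = c * lookup f b"
  for f :: "('n, 'k::comm_ring_1) mpoly"
  by (simp add: lookup_mult lookup_single when_mult)

lemma lookup_single_mult_neq_0:
  fixes f :: "('n, 'k::comm_ring_1) mpoly"
  assumes "lookup (single a c * f) m \<noteq> 0"
  obtains b where "m = a + b" "lookup f b \<noteq> 0"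
  using Poly_Mapping.keys_mult[of "single a c" f] assms
  by (auto simp: in_keys_iff split: if_splits)

section \<open>A term order\<close>

lemma prime_enumeration:
  obtains P :: "'i::finite \<Rightarrow> nat" where "inj P" "\<And>i. prime (P i)"
proof -
  obtain e :: "'i \<Rightarrow> nat" where e: "inj e"
    using finite_imp_inj_to_nat_seg[of "UNIV :: 'i set"] by auto
  have inf: "infinite {p::nat. prime p}" by (rule primes_infinite)
  show ?thesis
  proof
    show "inj (\<lambda>i. enumerate {p::nat. prime p} (e i))"
      using strict_mono_enumerate[OF inf] e
      by (auto simp: inj_def strict_mono_eq)
    show "prime (enumerate {p::nat. prime p} (e i))" for i
      using enumerate_in_set[OF inf, of "e i"] by simp
  qed
qed

text \<open>
  A term order without any order on the variables: the monomial $x^m$ at position \<open>l\<close> of a free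
  module gets the key $q^l \prod_i p_i^{m_i}$ with distinct primes $q$ and $p_i$. By unique
  factorisation the key determines \<open>l\<close> and \<open>m\<close>. Multiplication by a monomial multiplies all keys by
  the same positive factor, so it preserves their order, and natural numbers are well-ordered.
\<close>

lemma term_order:
  obtains K :: "nat \<Rightarrow> ('n::finite \<Rightarrow>\<^sub>0 nat) \<Rightarrow> nat" and N :: "('n \<Rightarrow>\<^sub>0 nat) \<Rightarrow> nat"
  where "\<And>l m l' m'. K l m = K l' m' \<Longrightarrow> l = l' \<and> m = m'"
    and "\<And>l a m. K l (a + m) = N a * K l m" "\<And>a. 0 < N a"
proof -
  obtain P :: "'n option \<Rightarrow> nat" where P: "inj P" "\<And>i. prime (P i)"
    using prime_enumeration by blast
  define ex where "ex = (\<lambda>l (m :: 'n \<Rightarrow>\<^sub>0 nat) i. case i of None \<Rightarrow> l | Some x \<Rightarrow> lookup m x)"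
  define K where "K = (\<lambda>l m. \<Prod>i\<in>UNIV. P i ^ ex l m i)"
  have mult: "multiplicity (P i) (K l m) = ex l m i" for i l m
  proof -
    have "K l m = (\<Prod>p\<in>range P. p ^ ex l m (inv_into UNIV P p))"
      using P(1) by (simp add: K_def prod.reindex)
    also have "multiplicity (P i) \<dots> = ex l m i"
      using P by (subst multiplicity_prod_prime_powers) auto
    finally show ?thesis .
  qed
  show ?thesis
  proof
    fix l l' :: nat and m m' a :: "'n \<Rightarrow>\<^sub>0 nat"
    show "l = l' \<and> m = m'" if "K l m = K l' m'"
    proof -
      have eq: "ex l m i = ex l' m' i" for i using mult that by metis
      have "l = l'" using eq[of None] by (simp add: ex_def)
      moreover have "m = m'"
        by (rule poly_mapping_eqI) (use eq[of "Some _"] in \<open>simp add: ex_def\<close>)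
      ultimately show ?thesis by simp
    qed
    have "ex l (a + m) i = ex 0 a i + ex l m i" for i
      by (cases i) (simp_all add: ex_def lookup_add)
    then show "K l (a + m) = K 0 a * K l m"
      by (simp add: K_def power_add prod.distrib)
    show "0 < K 0 a"
      using P(2) by (simp add: K_def prime_gt_0_nat prod_pos)
  qed
qed

text \<open>
  The product of the two leading terms does not cancel against any other product of terms.
\<close>

lemma mpoly_no_zero_divisors:
  fixes f g :: "('n::finite, 'k::field) mpoly"
  assumes "f \<noteq> 0" "g \<noteq> 0"
  shows "f * g \<noteq> 0"
proof -
  obtain K :: "nat \<Rightarrow> ('n::finite \<Rightarrow>\<^sub>0 nat) \<Rightarrow> nat" and N
    where K: "\<And>l m l' m'. K l m = K l' m' \<Longrightarrow> l = l' \<and> m = m'"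
      "\<And>l a m. K l (a + m) = N a * K l m" "\<And>a. 0 < N a"
    using term_order by metis
  have N: "N m = N m' \<longleftrightarrow> m = m'" for m m'
    using K(2)[of 0 m 0] K(2)[of 0 m' 0] K(1)[of 0 m 0 m'] by auto
  have Nadd: "N (a + b) = N a * N b" for a b
  proof -
    have "N (a + b) * K 0 0 = N a * N b * K 0 0"
      by (metis K(2) add.right_neutral mult.assoc)
    moreover have "K 0 0 \<noteq> 0"
    proof
      assume "K 0 0 = 0"
      then have "K 0 (single undefined 1) = 0" using K(2)[of 0 "single undefined 1" 0] by simp
      then have "(0 :: 'n \<Rightarrow>\<^sub>0 nat) = single undefined 1" using K(1) \<open>K 0 0 = 0\<close> by metis
      then show False by (metis lookup_single_eq lookup_zero zero_neq_one)
    qed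
    ultimately show ?thesis by simp
  qed
  have lead: "\<exists>a. lookup h a \<noteq> 0 \<and> (\<forall>b. lookup h b \<noteq> 0 \<longrightarrow> N b \<le> N a)"
    if "h \<noteq> 0" for h :: "('n, 'k) mpoly"
  proof -
    have ne: "keys h \<noteq> {}" using that by (metis in_keys_iff lookup_zero poly_mapping_eqI empty_iff)
    then have "Max (N ` keys h) \<in> N ` keys h" by (intro Max_in) auto
    then obtain a where "a \<in> keys h" "Max (N ` keys h) = N a" by auto
    then show ?thesis by (metis Max_ge finite_imageI finite_keys image_eqI in_keys_iff)
  qed
  obtain a where a: "lookup f a \<noteq> 0" "\<And>b. lookup f b \<noteq> 0 \<Longrightarrow> N b \<le> N a"
    using lead[OF assms(1)] by blast
  obtain b where b: "lookup g b \<noteq> 0" "\<And>c. lookup g c \<noteq> 0 \<Longrightarrow> N c \<le> N b"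
    using lead[OF assms(2)] by blast
  define f' where "f' = f - single a (lookup f a)"
  have "lookup (f' * g) (a + b) = 0"
  proof (rule ccontr)
    assume "lookup (f' * g) (a + b) \<noteq> 0"
    then obtain a' b' where ab: "a + b = a' + b'" "lookup f' a' \<noteq> 0" "lookup g b' \<noteq> 0"
      using Poly_Mapping.keys_mult[of f' g] by (auto simp: in_keys_iff)
    then have "a' \<noteq> a" "lookup f a' \<noteq> 0"
      by (auto simp: f'_def lookup_minus lookup_single when_def split: if_splits)
    then have "N a' < N a" using a(2)[of a'] N[of a' a] by simp
    moreover have "N b' \<le> N b" "0 < N b" using b(2) ab(3) K(3) by auto
    ultimately have "N (a' + b') < N (a + b)"
      unfolding Nadd by (metis le_less_trans mult_le_mono2 mult_less_mono1 K(3) mult.commute)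
    then show False using ab(1) by simp
  qed
  moreover have "f * g = single a (lookup f a) * g + f' * g"
    by (simp add: f'_def algebra_simps)
  ultimately have "lookup (f * g) (a + b) = lookup f a * lookup g b"
    by (simp add: lookup_add lookup_single_mult)
  then show ?thesis using a(1) b(1) by (metis lookup_zero mult_eq_0_iff)
qed

type_synonym ('n, 'k) fvec = "nat \<Rightarrow>\<^sub>0 ('n, 'k) mpoly"

section \<open>Graded modules\<close>

lemma graded_moduleD:
  assumes "graded_module M G"
  shows "module base_ring M" "x \<in> G j \<Longrightarrow> x \<in> carrier M" "\<zero>\<^bsub>M\<^esub> \<in> G j"
    "x \<in> G j \<Longrightarrow> y \<in> G j \<Longrightarrow> x \<oplus>\<^bsub>M\<^esub> y \<in> G j"
    "f \<in> homog i \<Longrightarrow> x \<in> G j \<Longrightarrow> f \<odot>\<^bsub>M\<^esub> x \<in> G (i + j)"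
proof -
  have sub: "subgroup (G j) (add_monoid M)" for j using assms by (simp add: graded_module_def)
  show "module base_ring M" using assms by (simp add: graded_module_def)
  show "x \<in> G j \<Longrightarrow> x \<in> carrier M" using subgroup.mem_carrier[OF sub] by force
  show "\<zero>\<^bsub>M\<^esub> \<in> G j" using subgroup.one_closed[OF sub] by simp
  show "x \<in> G j \<Longrightarrow> y \<in> G j \<Longrightarrow> x \<oplus>\<^bsub>M\<^esub> y \<in> G j" using subgroup.m_closed[OF sub] by simp
  show "f \<in> homog i \<Longrightarrow> x \<in> G j \<Longrightarrow> f \<odot>\<^bsub>M\<^esub> x \<in> G (i + j)" using assms by (simp add: graded_module_def)
qed

text \<open>
  The condition that singles out the family of homogeneous components in \<open>graded_module\<close>.
\<close>

definition is_decomp where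
  "is_decomp M G x c \<longleftrightarrow> (\<forall>j. c j \<in> G j) \<and> finite {j. c j \<noteq> \<zero>\<^bsub>M\<^esub>} \<and>
     x = (\<Oplus>\<^bsub>M\<^esub>j\<in>{j. c j \<noteq> \<zero>\<^bsub>M\<^esub>}. c j)"

definition gcomp where
  "gcomp M G x = (THE c. is_decomp M G x c)"

lemma is_decomp_gcomp:
  assumes "graded_module M G" "x \<in> carrier M"
  shows "is_decomp M G x (gcomp M G x)"
proof -
  have "\<exists>!c. is_decomp M G x c"
    using assms by (simp add: graded_module_def is_decomp_def)
  then show ?thesis unfolding gcomp_def by (rule theI')
qed

lemma gcomp_in: "graded_module M G \<Longrightarrow> x \<in> carrier M \<Longrightarrow> gcomp M G x j \<in> G j"
  using is_decomp_gcomp[of M G x] by (simp add: is_decomp_def)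

text \<open>
  Components can be read off from any finite decomposition, even one with zero summands.
\<close>

lemma gcomp_eqI:
  assumes M: "graded_module M G" and "finite A" "\<And>i. i \<in> A \<Longrightarrow> c i \<in> G i"
    and x: "x = (\<Oplus>\<^bsub>M\<^esub>i\<in>A. c i)"
  shows "gcomp M G x j = (if j \<in> A then c j else \<zero>\<^bsub>M\<^esub>)"
proof -
  interpret module base_ring M by (rule graded_moduleD(1)[OF M])
  define c' where "c' = (\<lambda>j. if j \<in> A then c j else \<zero>\<^bsub>M\<^esub>)"
  have sub: "{j. c' j \<noteq> \<zero>\<^bsub>M\<^esub>} \<subseteq> A" by (auto simp: c'_def)
  have cG: "c' j \<in> G j" for j using assms(3) graded_moduleD(3)[OF M] by (simp add: c'_def)
  have "(\<Oplus>\<^bsub>M\<^esub>j\<in>{j. c' j \<noteq> \<zero>\<^bsub>M\<^esub>}. c' j) = x"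
    unfolding x
  proof (rule M.add.finprod_mono_neutral_cong_left)
    show "c i = \<zero>\<^bsub>M\<^esub>" if "i \<in> A - {j. c' j \<noteq> \<zero>\<^bsub>M\<^esub>}" for i
      using that by (auto simp: c'_def)
    show "c' i = c i" if "i \<in> {j. c' j \<noteq> \<zero>\<^bsub>M\<^esub>}" for i
      using that by (auto simp: c'_def split: if_splits)
    show "c \<in> A \<rightarrow> carrier M" using assms(3) graded_moduleD(2)[OF M] by blast
  qed (use assms sub in auto)
  then have c': "is_decomp M G x c'"
    using cG finite_subset[OF sub assms(2)] by (auto simp: is_decomp_def)
  have "x \<in> carrier M"
    unfolding x using assms(3) graded_moduleD(2)[OF M] by (intro M.finsum_closed) blast
  then have "\<exists>!c. is_decomp M G x c"
    using M by (simp add: graded_module_def is_decomp_def)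
  then have "gcomp M G x = c'"
    unfolding gcomp_def using c' by (metis the_equality)
  then show ?thesis by (simp add: c'_def)
qed

lemma gcomp_of_homog:
  assumes M: "graded_module M G" and "x \<in> G i"
  shows "gcomp M G x j = (if j = i then x else \<zero>\<^bsub>M\<^esub>)"
proof -
  interpret module base_ring M by (rule graded_moduleD(1)[OF M])
  have "(\<Oplus>\<^bsub>M\<^esub>k\<in>{i}. x) = x"
    using graded_moduleD(2)[OF M assms(2)] M.finsum_insert[of "{}" i "\<lambda>_. x"] by simp
  then show ?thesis using gcomp_eqI[OF M, of "{i}" "\<lambda>_. x" x j] assms(2) by auto
qed

section \<open>Graded free modules\<close>

text \<open>
  The component of degree \<open>j\<close> of $\bigoplus_{b \in B} S(-a_b)$, that is, of the free module in which
  the basis element \<open>b\<close> has degree \<open>a b\<close>.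
\<close>

definition gfree :: "'b set \<Rightarrow> ('b \<Rightarrow> int) \<Rightarrow> int \<Rightarrow> ('b \<Rightarrow>\<^sub>0 ('n::finite, 'k::field) mpoly) set" where
  "gfree B a j = {v. keys v \<subseteq> B \<and> (\<forall>b\<in>B. lookup v b \<in> homog (j - a b))}"

lift_definition vcomp ::
  "('b \<Rightarrow> int) \<Rightarrow> int \<Rightarrow> ('b \<Rightarrow>\<^sub>0 ('n::finite, 'k::field) mpoly) \<Rightarrow> ('b \<Rightarrow>\<^sub>0 ('n, 'k) mpoly)"
  is "\<lambda>a j v b. hcomp (j - a b) (v b)"
  by (erule finite_subset[rotated]) auto

lemma gfreeD: "v \<in> gfree B a j \<Longrightarrow> keys v \<subseteq> B" "v \<in> gfree B a j \<Longrightarrow> lookup v b \<in> homog (j - a b)"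
  by (auto simp: gfree_def) (cases "b \<in> B"; simp add: lookup_outside)

lemma gfree_zero [simp]: "0 \<in> gfree B a j"
  by (simp add: gfree_def)

lemma gfree_add: "v \<in> gfree B a j \<Longrightarrow> w \<in> gfree B a j \<Longrightarrow> v + w \<in> gfree B a j"
  by (simp add: gfree_def keys_add_subset lookup_add homog_add)

lemma gfree_scale: "f \<in> homog i \<Longrightarrow> v \<in> gfree B a j \<Longrightarrow> f \<star> v \<in> gfree B a (i + j)"
  using homog_mult by (fastforce simp: gfree_def keys_scale_subset algebra_simps)

lemma gfree_uminus: "v \<in> gfree B a j \<Longrightarrow> - v \<in> gfree B a j"
  by (simp add: gfree_def keys_uminus_subset homog_uminus)

lemma gfree_single: "b \<in> B \<Longrightarrow> f \<in> homog i \<Longrightarrow> single b f \<in> gfree B a (i + a b)"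
  by (auto simp: gfree_def lookup_single when_def)

lemma gfree_basis: "b \<in> B \<Longrightarrow> single b 1 \<in> gfree B a (a b)"
  using gfree_single[of b B 1 0 a] by simp

lemma keys_vcomp: "keys v \<subseteq> B \<Longrightarrow> keys (vcomp a j v) \<subseteq> B"
  by (rule keys_subsetI) (metis vcomp.rep_eq hcomp_zero lookup_outside)

lemma vcomp_gfree: "keys v \<subseteq> B \<Longrightarrow> vcomp a j v \<in> gfree B a j"
  by (simp add: gfree_def keys_vcomp vcomp.rep_eq)

lemma vcomp_zero [simp]: "vcomp a j 0 = 0"
  by (rule poly_mapping_eqI) (simp add: vcomp.rep_eq)

lemma vcomp_add: "vcomp a j (v + w) = vcomp a j v + vcomp a j w"
  by (rule poly_mapping_eqI) (simp add: vcomp.rep_eq lookup_add hcomp_add)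

lemma vcomp_sum: "vcomp a j (\<Sum>i\<in>I. f i) = (\<Sum>i\<in>I. vcomp a j (f i))"
  by (induction I rule: infinite_finite_induct) (simp_all add: vcomp_add)

lemma vcomp_of_gfree:
  assumes "v \<in> gfree B a i"
  shows "vcomp a j v = (if j = i then v else 0)"
  by (rule poly_mapping_eqI) (simp add: vcomp.rep_eq hcomp_of_homog[OF gfreeD(2)[OF assms]])

lemma vcomp_decomp:
  fixes v :: "'b \<Rightarrow>\<^sub>0 ('n::finite, 'k::field) mpoly"
  obtains J where "finite J" "v = (\<Sum>j\<in>J. vcomp a j v)" "\<And>j. j \<notin> J \<Longrightarrow> vcomp a j v = 0"
proof -
  define J where "J = (\<Union>b\<in>keys v. (\<lambda>m. a b + mdeg m) ` keys (lookup v b))"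
  have fin: "finite J" by (simp add: J_def)
  have zero: "vcomp a j v = 0" if "j \<notin> J" for j
  proof (rule poly_mapping_eqI)
    fix b
    show "lookup (vcomp a j v) b = lookup 0 b"
    proof (rule ccontr)
      assume "lookup (vcomp a j v) b \<noteq> lookup 0 b"
      then have h: "hcomp (j - a b) (lookup v b) \<noteq> 0" by (simp add: vcomp.rep_eq)
      then have "b \<in> keys v" by (metis hcomp_zero in_keys_iff)
      moreover obtain m where "m \<in> keys (lookup v b)" "j - a b = mdeg m"
        using hcomp_neq_0[OF h] by auto
      ultimately have "j \<in> J" unfolding J_def by (force simp: algebra_simps)
      then show False using that by simp
    qed
  qed
  have "v = (\<Sum>j\<in>J. vcomp a j v)"
  proof (rule poly_mapping_eqI)
    fix b
    have "lookup (\<Sum>j\<in>J. vcomp a j v) b = (\<Sum>j\<in>J. hcomp (j - a b) (lookup v b))"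
      by (simp add: lookup_sum vcomp.rep_eq)
    also have "\<dots> = (\<Sum>i\<in>(\<lambda>j. j - a b) ` J. hcomp i (lookup v b))"
      by (subst sum.reindex) (auto simp: inj_on_def)
    also have "\<dots> = lookup v b"
    proof (rule sum_hcomp)
      show "mdeg ` keys (lookup v b) \<subseteq> (\<lambda>j. j - a b) ` J"
      proof
        fix d assume "d \<in> mdeg ` keys (lookup v b)"
        then obtain m where m: "m \<in> keys (lookup v b)" "d = mdeg m" by auto
        then have "b \<in> keys v" by (metis in_keys_iff lookup_zero)
        then have "a b + mdeg m \<in> J" using m by (auto simp: J_def)
        then show "d \<in> (\<lambda>j. j - a b) ` J" using m(2) by (force intro: image_eqI[of _ _ "a b + mdeg m"])
      qed
    qed (use fin in simp)
    finally show "lookup v b = lookup (\<Sum>j\<in>J. vcomp a j v) b" ..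
  qed
  then show ?thesis using that[of J] fin zero by simp
qed

text \<open>
  A homomorphism that preserves degrees commutes with taking components. Therefore its kernel is
  graded, and a homogeneous element of its image has a preimage of the same degree.
\<close>

lemma gcomp_hom:
  fixes M :: "(('n::finite, 'k::field) mpoly, 'm) module" and B :: "'b set"
  assumes M: "graded_module M G" and h: "h \<in> mod_hom (free_module B) M"
    and gr: "\<And>j. h ` gfree B a j \<subseteq> G j" and v: "keys v \<subseteq> B"
  shows "gcomp M G (h v) j = h (vcomp a j v)"
proof -
  interpret module base_ring M by (rule graded_moduleD(1)[OF M])
  obtain J where J: "finite J" "v = (\<Sum>j\<in>J. vcomp a j v)" "\<And>j. j \<notin> J \<Longrightarrow> vcomp a j v = 0"
    using vcomp_decomp[of v a] by blast
  have ab: "abelian_group (free_module B :: (('n, 'k) mpoly, 'b \<Rightarrow>\<^sub>0 ('n, 'k) mpoly) module)"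
    using module_free[of B] by (auto simp: module_def)
  have "h v = h (\<Sum>j\<in>J. vcomp a j v)" using J(2) by simp
  also have "(\<Sum>j\<in>J. vcomp a j v) = (\<Oplus>\<^bsub>free_module B\<^esub>j\<in>J. vcomp a j v)"
    by (rule finsum_class[symmetric, OF ab]) (use J(1) keys_vcomp[OF v] in auto)
  also have "h \<dots> = (\<Oplus>\<^bsub>M\<^esub>j\<in>J. h (vcomp a j v))"
    by (rule mod_hom_finsum[OF h module_free graded_moduleD(1)[OF M]]) (use J(1) keys_vcomp[OF v] in auto)
  finally have hv: "h v = (\<Oplus>\<^bsub>M\<^esub>j\<in>J. h (vcomp a j v))" .
  have "gcomp M G (h v) j = (if j \<in> J then h (vcomp a j v) else \<zero>\<^bsub>M\<^esub>)"
    by (rule gcomp_eqI[OF M J(1) _ hv]) (use gr vcomp_gfree[OF v] in blast)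
  moreover have "h 0 = \<zero>\<^bsub>M\<^esub>"
    using mod_hom_zero[OF h module_free graded_moduleD(1)[OF M]] by simp
  ultimately show ?thesis using J(3) by auto
qed

lemma graded_kernel:
  fixes M :: "(('n::finite, 'k::field) mpoly, 'm) module" and B :: "'b set"
  assumes "graded_module M G" "h \<in> mod_hom (free_module B) M"
    and "\<And>j. h ` gfree B a j \<subseteq> G j" "keys v \<subseteq> B" "h v = \<zero>\<^bsub>M\<^esub>"
  shows "h (vcomp a j v) = \<zero>\<^bsub>M\<^esub>"
  using gcomp_hom[OF assms(1-4), of j] gcomp_of_homog[OF assms(1) graded_moduleD(3)[OF assms(1)], of j j]
    assms(5) by simp

lemma graded_image:
  fixes M :: "(('n::finite, 'k::field) mpoly, 'm) module" and B :: "'b set"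
  assumes "graded_module M G" "h \<in> mod_hom (free_module B) M"
    and "\<And>j. h ` gfree B a j \<subseteq> G j" "keys v \<subseteq> B" "h v \<in> G j"
  shows "h (vcomp a j v) = h v"
  using gcomp_hom[OF assms(1-4), of j] gcomp_of_homog[OF assms(1,5), of j] by simp

definition submod :: "'b set \<Rightarrow> ('b \<Rightarrow>\<^sub>0 'r::comm_ring_1) set \<Rightarrow> bool" where
  "submod B Z \<longleftrightarrow> (\<forall>v\<in>Z. keys v \<subseteq> B) \<and> 0 \<in> Z \<and> (\<forall>v\<in>Z. \<forall>w\<in>Z. v + w \<in> Z) \<and> (\<forall>r. \<forall>v\<in>Z. r \<star> v \<in> Z)"

definition graded_submod ::
  "'b set \<Rightarrow> ('b \<Rightarrow> int) \<Rightarrow> ('b \<Rightarrow>\<^sub>0 ('n::finite, 'k::field) mpoly) set \<Rightarrow> bool" where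
  "graded_submod B a Z \<longleftrightarrow> submod B Z \<and> (\<forall>v\<in>Z. \<forall>j. vcomp a j v \<in> Z)"

lemma submod_uminus: "submod B Z \<Longrightarrow> v \<in> Z \<Longrightarrow> - v \<in> Z"
  by (metis submod_def scale_simps(5))

text \<open>
  Syzygies become graded modules in their own right, so that the construction of covers below
  can be iterated.
\<close>

lemma graded_module_submod:
  fixes B :: "'b set" and Z :: "('b \<Rightarrow>\<^sub>0 ('n::finite, 'k::field) mpoly) set"
  assumes "graded_submod B a Z"
  shows "graded_module (free_module B\<lparr>carrier := Z\<rparr>) (\<lambda>j. Z \<inter> gfree B a j)"
proof -
  let ?M = "free_module B\<lparr>carrier := Z\<rparr>"
  have Z: "submod B Z" "\<And>v j. v \<in> Z \<Longrightarrow> vcomp a j v \<in> Z"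
    using assms by (auto simp: graded_submod_def)
  have mod: "module base_ring ?M"
    by (rule module_free_submodule) (use Z in \<open>auto simp: submod_def\<close>)
  then have ab: "abelian_group ?M" by (simp add: module_def)
  interpret M: abelian_group ?M by (rule ab)
  have inv: "\<ominus>\<^bsub>?M\<^esub> x = - x" if "x \<in> Z" for x
    using M.minus_equality[of "- x" x] that submod_uminus[OF Z(1) that] by simp
  have sub: "subgroup (Z \<inter> gfree B a j) (add_monoid ?M)" for j
  proof
    fix x assume "x \<in> Z \<inter> gfree B a j"
    then show "inv\<^bsub>add_monoid ?M\<^esub> x \<in> Z \<inter> gfree B a j"
      using inv[of x] submod_uminus[OF Z(1)] by (auto simp: a_inv_def intro: gfree_uminus)
  qed (use Z in \<open>auto simp: submod_def intro: gfree_add\<close>)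
  have uniq: "\<exists>!c. (\<forall>j. c j \<in> Z \<inter> gfree B a j) \<and> finite {j. c j \<noteq> \<zero>\<^bsub>?M\<^esub>} \<and>
      x = (\<Oplus>\<^bsub>?M\<^esub>j\<in>{j. c j \<noteq> \<zero>\<^bsub>?M\<^esub>}. c j)" if x: "x \<in> Z" for x
  proof (rule ex1I[of _ "\<lambda>j. vcomp a j x"], intro conjI)
    have kx: "keys x \<subseteq> B" using x Z(1) by (simp add: submod_def)
    obtain J where J: "finite J" "x = (\<Sum>j\<in>J. vcomp a j x)" "\<And>j. j \<notin> J \<Longrightarrow> vcomp a j x = 0"
      using vcomp_decomp[of x a] by blast
    show "\<forall>j. vcomp a j x \<in> Z \<inter> gfree B a j" using x Z vcomp_gfree[OF kx] by simp
    have sub: "{j. vcomp a j x \<noteq> \<zero>\<^bsub>?M\<^esub>} \<subseteq> J" using J(3) by auto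
    then show fin: "finite {j. vcomp a j x \<noteq> \<zero>\<^bsub>?M\<^esub>}" using J(1) by (rule finite_subset)
    have "(\<Oplus>\<^bsub>?M\<^esub>j\<in>{j. vcomp a j x \<noteq> \<zero>\<^bsub>?M\<^esub>}. vcomp a j x) = (\<Sum>j\<in>{j. vcomp a j x \<noteq> \<zero>\<^bsub>?M\<^esub>}. vcomp a j x)"
      by (rule finsum_class[OF ab]) (use fin x Z in auto)
    also have "\<dots> = (\<Sum>j\<in>J. vcomp a j x)"
      by (rule sum.mono_neutral_left) (use J sub in auto)
    finally show "x = (\<Oplus>\<^bsub>?M\<^esub>j\<in>{j. vcomp a j x \<noteq> \<zero>\<^bsub>?M\<^esub>}. vcomp a j x)" using J(2) by simp
    fix c assume c: "(\<forall>j. c j \<in> Z \<inter> gfree B a j) \<and> finite {j. c j \<noteq> \<zero>\<^bsub>?M\<^esub>} \<and>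
      x = (\<Oplus>\<^bsub>?M\<^esub>j\<in>{j. c j \<noteq> \<zero>\<^bsub>?M\<^esub>}. c j)"
    have "(\<Oplus>\<^bsub>?M\<^esub>j\<in>{j. c j \<noteq> \<zero>\<^bsub>?M\<^esub>}. c j) = (\<Sum>j\<in>{j. c j \<noteq> \<zero>\<^bsub>?M\<^esub>}. c j)"
      by (rule finsum_class[OF ab]) (use c in auto)
    then have xc: "x = (\<Sum>j\<in>{j. c j \<noteq> 0}. c j)" using c by simp
    show "c = (\<lambda>j. vcomp a j x)"
    proof
      fix j
      have "vcomp a j x = (\<Sum>i\<in>{j. c j \<noteq> 0}. if j = i then c i else 0)"
        by (subst xc, subst vcomp_sum, rule sum.cong[OF refl], rule vcomp_of_gfree[where B = B])
          (use c in auto)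
      also have "\<dots> = c j" using c by simp
      finally show "c j = vcomp a j x" ..
    qed
  qed
  show ?thesis
    unfolding graded_module_def
    using mod sub uniq Z by (auto simp: submod_def intro: gfree_scale)
qed

lemma graded_module_free:
  fixes B :: "'b set"
  shows "graded_module (free_module B) (gfree B a :: int \<Rightarrow> ('b \<Rightarrow>\<^sub>0 ('n::finite, 'k::field) mpoly) set)"
proof -
  let ?Z = "{v :: 'b \<Rightarrow>\<^sub>0 ('n, 'k) mpoly. keys v \<subseteq> B}"
  have "graded_submod B a ?Z"
    by (simp add: graded_submod_def submod_def keys_subset_intros keys_vcomp)
  moreover have "?Z \<inter> gfree B a j = gfree B a j" for j
    by (auto simp: gfree_def)
  ultimately show ?thesis
    using graded_module_submod[of B a ?Z] by (simp add: free_module_def)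
qed

section \<open>Finite generation\<close>

text \<open>
  Induction on the coordinates. Given a finite basis $A_0$ for the coordinates in \<open>I\<close>, let \<open>n\<close> bound the
  new coordinate on $A_0$. Vectors whose new coordinate is at least \<open>n\<close> lie above an element of $A_0$;
  for each of the finitely many smaller values one adds a basis for the vectors with that value.
\<close>

lemma dickson:
  fixes A :: "('i \<Rightarrow> nat) set"
  assumes "finite I"
  shows "\<exists>A0. finite A0 \<and> A0 \<subseteq> A \<and> (\<forall>a\<in>A. \<exists>b\<in>A0. \<forall>i\<in>I. b i \<le> a i)"
  using assms
proof (induction I arbitrary: A)
  case empty
  show ?case
  proof (cases "A = {}")
    case False
    then obtain a where "a \<in> A" by blast
    then show ?thesis by (intro exI[of _ "{a}"]) auto
  qed (intro exI[of _ "{}"], auto)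
next
  case (insert x I)
  obtain A0 where A0: "finite A0" "A0 \<subseteq> A" "\<And>a. a \<in> A \<Longrightarrow> \<exists>b\<in>A0. \<forall>i\<in>I. b i \<le> a i"
    using insert.IH[of A] by blast
  define n where "n = Max (insert 0 ((\<lambda>a. a x) ` A0))"
  have n: "b x \<le> n" if "b \<in> A0" for b
    unfolding n_def by (rule Max_ge) (use A0(1) that in auto)
  have "\<forall>c. \<exists>S. finite S \<and> S \<subseteq> {a \<in> A. a x = c} \<and> (\<forall>a\<in>{a \<in> A. a x = c}. \<exists>b\<in>S. \<forall>i\<in>I. b i \<le> a i)"
    using insert.IH by blast
  from choice[OF this] obtain S where "\<forall>c. finite (S c) \<and> S c \<subseteq> {a \<in> A. a x = c} \<and>
      (\<forall>a\<in>{a \<in> A. a x = c}. \<exists>b\<in>S c. \<forall>i\<in>I. b i \<le> a i)" by blast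
  then have S: "\<And>c. finite (S c)" "\<And>c. S c \<subseteq> {a \<in> A. a x = c}"
    "\<And>c a. a \<in> A \<Longrightarrow> a x = c \<Longrightarrow> \<exists>b\<in>S c. \<forall>i\<in>I. b i \<le> a i"
    by simp_all
  show ?case
  proof (intro exI[of _ "A0 \<union> (\<Union>c\<in>{..<n}. S c)"] conjI ballI)
    fix a assume a: "a \<in> A"
    show "\<exists>b\<in>A0 \<union> (\<Union>c\<in>{..<n}. S c). \<forall>i\<in>insert x I. b i \<le> a i"
    proof (cases "a x < n")
      case True
      obtain b where b: "b \<in> S (a x)" "\<forall>i\<in>I. b i \<le> a i" using S(3)[OF a refl] by blast
      then have "b x = a x" using S(2) by blast
      then show ?thesis using b True by (intro bexI[of _ b]) auto
    next
      case False
      obtain b where b: "b \<in> A0" "\<forall>i\<in>I. b i \<le> a i" using A0(3)[OF a] by blast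
      then show ?thesis using n[OF b(1)] False by (intro bexI[of _ b]) auto
    qed
  next
    show "A0 \<union> (\<Union>c\<in>{..<n}. S c) \<subseteq> A" using A0(2) S(2) by blast
  qed (use A0(1) S(1) in simp)
qed

lemma dickson_poly_mapping:
  fixes A :: "('n::finite \<Rightarrow>\<^sub>0 nat) set"
  shows "\<exists>A0. finite A0 \<and> A0 \<subseteq> A \<and> (\<forall>m\<in>A. \<exists>b\<in>A0. \<exists>a. m = a + b)"
proof -
  obtain L where L: "finite L" "L \<subseteq> lookup ` A" "\<And>m. m \<in> lookup ` A \<Longrightarrow> \<exists>b\<in>L. \<forall>i. b i \<le> m i"
    using dickson[of UNIV "lookup ` A"] by auto
  obtain A0 where A0: "A0 \<subseteq> A" "finite A0" "L = lookup ` A0"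
    using finite_subset_image[OF L(1,2)] by blast
  have "\<exists>b\<in>A0. \<exists>a. m = a + b" if m: "m \<in> A" for m
  proof -
    obtain u where u: "u \<in> L" "\<forall>i. u i \<le> lookup m i"
      using L(3)[of "lookup m"] m by blast
    then obtain b where b: "b \<in> A0" "\<And>i. lookup b i \<le> lookup m i"
      using A0(3) by blast
    have "m = (m - b) + b"
      by (rule poly_mapping_eqI) (use b in \<open>simp add: lookup_add lookup_minus\<close>)
    then show ?thesis using b(1) by blast
  qed
  then show ?thesis using A0 by blast
qed

text \<open>
  Hilbert's basis theorem in its Groebner form. By Dickson's lemma the leading monomials of elements
  of \<open>Z\<close> are multiples of finitely many ones; \<open>C\<close> consists of elements of \<open>Z\<close> having these leading
  monomials. Subtracting a multiple of an element of \<open>C\<close> cancels the leading term of any element of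
  \<open>Z\<close>, so induction on the leading key shows that \<open>C\<close> generates \<open>Z\<close>.
\<close>

lemma submod_finite_generators:
  fixes Z :: "('n::finite, 'k::field) fvec set"
  assumes Z: "submod {..<r} Z"
  obtains C where "finite C" "C \<subseteq> Z" "\<And>N. submod UNIV N \<Longrightarrow> C \<subseteq> N \<Longrightarrow> Z \<subseteq> N"
proof -
  obtain K :: "nat \<Rightarrow> ('n::finite \<Rightarrow>\<^sub>0 nat) \<Rightarrow> nat" and N
    where K: "\<And>l m l' m'. K l m = K l' m' \<Longrightarrow> l = l' \<and> m = m'"
      "\<And>l a m. K l (a + m) = N a * K l m" "\<And>a. 0 < N a"
    using term_order by metis
  define cf where "cf = (\<lambda>(v :: ('n, 'k) fvec) l m. lookup (lookup v l) m)"
  define lead where "lead = (\<lambda>v l m. cf v l m \<noteq> 0 \<and> (\<forall>l' m'. cf v l' m' \<noteq> 0 \<longrightarrow> K l' m' \<le> K l m))"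
  have ex_lead: "\<exists>l m. lead v l m" if "v \<noteq> 0" for v
  proof -
    define T where "T = (\<lambda>(l, m). K l m) ` (SIGMA l:keys v. keys (lookup v l))"
    obtain l where "lookup v l \<noteq> 0" using \<open>v \<noteq> 0\<close> by (metis lookup_zero poly_mapping_eqI)
    moreover from this obtain m where "lookup (lookup v l) m \<noteq> 0" by (metis lookup_zero poly_mapping_eqI)
    ultimately have "(l, m) \<in> (SIGMA l:keys v. keys (lookup v l))" by (simp add: in_keys_iff)
    then have "T \<noteq> {}" unfolding T_def by blast
    moreover have fin: "finite T" by (simp add: T_def)
    ultimately have "Max T \<in> T" by simp
    then obtain l m where lm: "cf v l m \<noteq> 0" "Max T = K l m" by (auto simp: T_def cf_def in_keys_iff)
    have "K l' m' \<le> K l m" if "cf v l' m' \<noteq> 0" for l' m'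
    proof -
      have "lookup v l' \<noteq> 0" using that by (auto simp: cf_def)
      then have "K l' m' \<in> T" using that by (force simp: T_def cf_def in_keys_iff)
      then show ?thesis using Max_ge[OF fin] lm(2) by simp
    qed
    then show ?thesis using lm by (auto simp: lead_def)
  qed
  define A where "A = (\<lambda>l. {m. \<exists>v\<in>Z. lead v l m})"
  have "\<forall>l. \<exists>A0. finite A0 \<and> A0 \<subseteq> A l \<and> (\<forall>m\<in>A l. \<exists>b\<in>A0. \<exists>a. m = a + b)"
    using dickson_poly_mapping by blast
  then obtain A0 where A0: "\<And>l. finite (A0 l)" "\<And>l. A0 l \<subseteq> A l"
      "\<And>l m. m \<in> A l \<Longrightarrow> \<exists>b\<in>A0 l. \<exists>a. m = a + b"
    by metis
  have "\<forall>l m. \<exists>v. m \<in> A l \<longrightarrow> v \<in> Z \<and> lead v l m" by (auto simp: A_def)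
  then obtain z where z: "\<And>l m. m \<in> A l \<Longrightarrow> z l m \<in> Z \<and> lead (z l m) l m" by metis
  define C where "C = (\<Union>l<r. z l ` A0 l)"
  show ?thesis
  proof
    show "finite C" using A0 by (simp add: C_def)
    show "C \<subseteq> Z" using A0(2) z by (auto simp: C_def)
    fix Q :: "('n, 'k) fvec set" assume Q: "submod UNIV Q" "C \<subseteq> Q"
    have main: "v \<in> Z \<Longrightarrow> lead v l m \<Longrightarrow> v \<in> Q" for v l m
    proof (induction "K l m" arbitrary: v l m rule: less_induct)
      case less
      then have mA: "m \<in> A l" by (auto simp: A_def)
      then obtain b a where b: "b \<in> A0 l" "m = a + b" using A0(3) by blast
      define w where "w = z l b"
      have w: "w \<in> Z" "lead w l b" using z A0(2) b(1) by (auto simp: w_def)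
      have "l < r"
      proof (rule ccontr)
        assume "\<not> l < r"
        then have "lookup v l = 0" using less(2) Z by (auto simp: submod_def in_keys_iff subset_iff)
        then show False using less(3) by (simp add: lead_def cf_def)
      qed
      then have "w \<in> Q" using Q(2) b(1) by (auto simp: C_def w_def)
      \<comment> \<open>the multiple of \<open>w\<close> that cancels the leading term of \<open>v\<close>\<close>
      define q where "q = single a (cf v l m / cf w l b)"
      define v' where "v' = v - q \<star> w"
      have qZ: "q \<star> w \<in> Z" "q \<star> w \<in> Q" using w(1) Z \<open>w \<in> Q\<close> Q(1) by (auto simp: submod_def)
      have v'Z: "v' \<in> Z"
      proof -
        have "v + - (q \<star> w) \<in> Z"
          using Z less(2) submod_uminus[OF Z qZ(1)] unfolding submod_def by blast
        then show ?thesis by (simp add: v'_def)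
      qed
      have cf': "cf v' l' m' = cf v l' m' - lookup (q * lookup w l') m'" for l' m'
        by (simp add: v'_def cf_def lookup_minus)
      have zero: "cf v' l m = 0"
        using w(2) by (simp add: cf' q_def b(2) lookup_single_mult lead_def) (simp add: cf_def)
      have small: "K l' m' \<le> K l m" if nz: "cf v' l' m' \<noteq> 0" for l' m'
      proof (cases "cf v l' m' = 0")
        case True
        then have "lookup (q * lookup w l') m' \<noteq> 0" using nz cf' by simp
        then obtain b' where b': "m' = a + b'" "lookup (lookup w l') b' \<noteq> 0"
          unfolding q_def by (rule lookup_single_mult_neq_0)
        then have "K l' b' \<le> K l b" using w(2) by (auto simp: lead_def cf_def)
        then show ?thesis by (simp add: b(2) b'(1) K(2))
      qed (use less(3) in \<open>auto simp: lead_def\<close>)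
      have "v' \<in> Q"
      proof (cases "v' = 0")
        case True
        then show ?thesis using Q(1) by (simp add: submod_def)
      next
        case False
        then obtain l' m' where lm: "lead v' l' m'" using ex_lead by blast
        then have nz: "cf v' l' m' \<noteq> 0" by (simp add: lead_def)
        then have "\<not> (l' = l \<and> m' = m)" using zero by auto
        then have "K l' m' \<noteq> K l m" using K(1) by blast
        then have "K l' m' < K l m" using small[OF nz] by simp
        then show ?thesis using less(1) v'Z lm by blast
      qed
      moreover have "v = v' + q \<star> w" by (simp add: v'_def)
      ultimately show "v \<in> Q" using Q(1) qZ(2) by (simp add: submod_def)
    qed
    show "Z \<subseteq> Q"
    proof
      fix v assume "v \<in> Z"
      then show "v \<in> Q"
      proof (cases "v = 0")
        case True
        then show ?thesis using Q(1) by (simp add: submod_def)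
      next
        case False
        then obtain l m where "lead v l m" using ex_lead by blast
        with \<open>v \<in> Z\<close> show ?thesis by (rule main)
      qed
    qed
  qed
qed

lemma fin_gen_submod:
  fixes Z :: "('n::finite, 'k::field) fvec set"
  assumes Z: "submod {..<r} Z"
  shows "fin_gen (free_module {..<r}\<lparr>carrier := Z\<rparr>)"
proof -
  let ?M = "free_module {..<r}\<lparr>carrier := Z\<rparr> :: (('n, 'k) mpoly, ('n, 'k) fvec) module"
  interpret M: module base_ring ?M
    by (rule module_free_submodule) (use Z in \<open>auto simp: submod_def\<close>)
  obtain C where C: "finite C" "C \<subseteq> Z" "\<And>N. submod UNIV N \<Longrightarrow> C \<subseteq> N \<Longrightarrow> Z \<subseteq> N"
    using submod_finite_generators[OF Z] by blast
  have "submodule_span ?M C = carrier ?M"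
  proof
    show "submodule_span ?M C \<subseteq> carrier ?M"
      using M.carrier_is_submodule C(2) by (auto simp: submodule_span_def)
    show "carrier ?M \<subseteq> submodule_span ?M C"
      unfolding submodule_span_def
    proof (rule Inter_greatest, safe)
      fix N x assume N: "submodule N base_ring ?M" "C \<subseteq> N" and x: "x \<in> carrier ?M"
      have "0 \<in> N"
        using M.submoduleE(2)[OF N(1)] M.submoduleE(4)[OF N(1), of 0] by auto
      then have "submod UNIV N"
        using M.submoduleE(4,5)[OF N(1)] by (auto simp: submod_def)
      then show "x \<in> N" using C(3)[OF _ N(2)] x by auto
    qed
  qed
  then show ?thesis using C by (auto simp: fin_gen_def)
qed

section \<open>Minimal graded free resolutions\<close>

lemma (in module) submodule_finsum:
  assumes "submodule N R M" "\<And>i. i \<in> A \<Longrightarrow> f i \<in> N"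
  shows "finsum M f A \<in> N"
  using assms(2)
proof (induction A rule: infinite_finite_induct)
  case (infinite A)
  have "\<zero>\<^bsub>M\<^esub> \<in> N" using subgroup.one_closed[OF submodule.axioms(1)[OF assms(1)]] by simp
  then show ?case using infinite(1) by (simp add: M.add.finprod_infinite)
next
  case empty
  show ?case using subgroup.one_closed[OF submodule.axioms(1)[OF assms(1)]] by simp
next
  case (insert x F)
  then have "f \<in> F \<rightarrow> carrier M" "f x \<in> carrier M" using submoduleE(1)[OF assms(1)] by auto
  then show ?case using insert submoduleE(5)[OF assms(1)] by simp
qed

lemma submodule_base_ringI:
  fixes M :: "('r::comm_ring_1, 'm) module"
  assumes "module base_ring M" "N \<subseteq> carrier M" "\<zero>\<^bsub>M\<^esub> \<in> N"
    and "\<And>x y. x \<in> N \<Longrightarrow> y \<in> N \<Longrightarrow> x \<oplus>\<^bsub>M\<^esub> y \<in> N" "\<And>r x. x \<in> N \<Longrightarrow> r \<odot>\<^bsub>M\<^esub> x \<in> N"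
  shows "submodule N base_ring M"
proof -
  interpret M: module base_ring M by fact
  show ?thesis
  proof (rule M.submoduleI)
    fix x assume x: "x \<in> N"
    have "\<ominus>\<^bsub>M\<^esub> x = (\<ominus>\<^bsub>base_ring\<^esub> 1) \<odot>\<^bsub>M\<^esub> x"
      using M.smult_l_minus[of 1 x] M.smult_one[of x] x assms(2) by auto
    then show "\<ominus>\<^bsub>M\<^esub> x \<in> N" using assms(5)[OF x] by simp
  qed (use assms in auto)
qed

lemma image_submodule:
  fixes M :: "('r::comm_ring_1, 'm) module"
  assumes M: "module base_ring M" and h: "h \<in> mod_hom (free_module B) M"
  shows "submodule (h ` carrier (free_module B)) base_ring M"
proof (rule submodule_base_ringI[OF M])
  show "\<zero>\<^bsub>M\<^esub> \<in> h ` carrier (free_module B)"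
    using mod_hom_zero[OF h module_free M] by (metis (no_types) imageI free_module_simps(1,2) keys_zero empty_subsetI mem_Collect_eq)
next
  fix x y assume "x \<in> h ` carrier (free_module B)" "y \<in> h ` carrier (free_module B)"
  then obtain v w where vw: "v \<in> carrier (free_module B)" "w \<in> carrier (free_module B)" "x = h v" "y = h w" by blast
  then have "x \<oplus>\<^bsub>M\<^esub> y = h (v + w)" using mod_homD(2)[OF h vw(1,2)] by simp
  then show "x \<oplus>\<^bsub>M\<^esub> y \<in> h ` carrier (free_module B)" using vw by (simp add: keys_add_subset)
next
  fix r x assume "x \<in> h ` carrier (free_module B)"
  then obtain v where v: "v \<in> carrier (free_module B)" "x = h v" by blast
  then have "r \<odot>\<^bsub>M\<^esub> x = h (r \<star> v)" using mod_homD(3)[OF h v(1), of r] by simp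
  then show "r \<odot>\<^bsub>M\<^esub> x \<in> h ` carrier (free_module B)" using v by (simp add: keys_scale_subset)
qed (use mod_homD(1)[OF h] in auto)

lemma graded_finsum:
  assumes M: "graded_module M G" and "finite A" "\<And>i. i \<in> A \<Longrightarrow> f i \<in> G j"
  shows "finsum M f A \<in> G j"
proof -
  interpret module base_ring M by (rule graded_moduleD(1)[OF M])
  show ?thesis
    using assms(2,3)
  proof (induction A)
    case (insert x F)
    then have "f \<in> F \<rightarrow> carrier M" "f x \<in> carrier M" using graded_moduleD(2)[OF M] by blast+
    then show ?case using insert graded_moduleD(4)[OF M] by simp
  qed (simp add: graded_moduleD(3)[OF M])
qed

lemma lin_ext_graded:
  fixes M :: "(('n::finite, 'k::field) mpoly, 'm) module" and B :: "'b set"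
  assumes M: "graded_module M G" and g: "\<And>b. b \<in> B \<Longrightarrow> g b \<in> G (a b)"
  shows "lin_ext M g ` gfree B a j \<subseteq> G j"
proof safe
  fix v :: "'b \<Rightarrow>\<^sub>0 ('n, 'k) mpoly" assume v: "v \<in> gfree B a j"
  show "lin_ext M g v \<in> G j"
    unfolding lin_ext_def
  proof (rule graded_finsum[OF M])
    fix b assume "b \<in> keys v"
    then have "b \<in> B" using gfreeD(1)[OF v] by auto
    then show "lookup v b \<odot>\<^bsub>M\<^esub> g b \<in> G j"
      using graded_moduleD(5)[OF M gfreeD(2)[OF v, of b] g[of b]] by simp
  qed simp
qed

definition homog_gens ::
  "(('n::finite, 'k::field) mpoly, 'm) module \<Rightarrow> (int \<Rightarrow> 'm set) \<Rightarrow> nat \<Rightarrow> (nat \<Rightarrow> int) \<Rightarrow> (nat \<Rightarrow> 'm) \<Rightarrow> bool" where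
  "homog_gens M G r a g \<longleftrightarrow> (\<forall>l<r. g l \<in> G (a l)) \<and>
     (\<forall>N. submodule N base_ring M \<and> (\<forall>l<r. g l \<in> N) \<longrightarrow> carrier M \<subseteq> N)"

lemma ex_homog_gens:
  assumes M: "graded_module M G" and "fin_gen M"
  shows "\<exists>r a g. homog_gens M G r a g"
proof -
  interpret M: module base_ring M by (rule graded_moduleD(1)[OF M])
  obtain C where C: "finite C" "C \<subseteq> carrier M" "submodule_span M C = carrier M"
    using assms(2) by (auto simp: fin_gen_def)
  define S where "S = (\<lambda>c. {j. gcomp M G c j \<noteq> \<zero>\<^bsub>M\<^esub>})"
  have dec: "finite (S c)" "c = finsum M (gcomp M G c) (S c)" if "c \<in> C" for c
    using is_decomp_gcomp[OF M, of c] that C(2) by (auto simp: is_decomp_def S_def)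
  define T where "T = (\<Union>c\<in>C. (\<lambda>j. (gcomp M G c j, j)) ` S c)"
  have "finite T" using C(1) dec by (simp add: T_def)
  then obtain \<phi> where \<phi>: "bij_betw \<phi> {0..<card T} T" using ex_bij_betw_nat_finite by blast
  have "homog_gens M G (card T) (\<lambda>l. snd (\<phi> l)) (\<lambda>l. fst (\<phi> l))"
    unfolding homog_gens_def
  proof (intro conjI allI impI)
    fix l assume "l < card T"
    then have "\<phi> l \<in> T" using \<phi> by (auto simp: bij_betw_def)
    then show "fst (\<phi> l) \<in> G (snd (\<phi> l))" using gcomp_in[OF M] C(2) by (auto simp: T_def)
  next
    fix N assume N: "submodule N base_ring M \<and> (\<forall>l<card T. fst (\<phi> l) \<in> N)"
    have T: "fst t \<in> N" if "t \<in> T" for t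
    proof -
      have "t \<in> \<phi> ` {0..<card T}" using \<phi> that by (simp add: bij_betw_def)
      then obtain l where "l < card T" "t = \<phi> l" by auto
      then show ?thesis using N by simp
    qed
    have "C \<subseteq> N"
    proof
      fix c assume c: "c \<in> C"
      have "finsum M (gcomp M G c) (S c) \<in> N"
      proof (rule M.submodule_finsum)
        fix j assume "j \<in> S c"
        then have "(gcomp M G c j, j) \<in> T" using c by (auto simp: T_def)
        then show "gcomp M G c j \<in> N" using T by force
      qed (use N in simp)
      then show "c \<in> N" using dec(2)[OF c] by simp
    qed
    then have "submodule_span M C \<subseteq> N" using N by (auto simp: submodule_span_def)
    then show "carrier M \<subseteq> N" using C(3) by simp
  qed
  then show ?thesis by blast
qed

text \<open>
  The submodule $\mathfrak{m} F$ of a free module $F$, where $\mathfrak{m}$ is the irrelevant ideal: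
  by \<open>irrelevant_ideal_eq\<close> below, $\mathfrak{m}$ consists of the polynomials without constant term.
\<close>

definition max_free :: "'b set \<Rightarrow> ('b \<Rightarrow>\<^sub>0 ('n::finite, 'k::field) mpoly) set" where
  "max_free B = {v. keys v \<subseteq> B \<and> (\<forall>b. const_coeff (lookup v b) = 0)}"

text \<open>
  If a relation among homogeneous generators has a coefficient with nonzero constant term at \<open>l0\<close>,
  then its component of degree \<open>a l0\<close> is a relation whose coefficient at \<open>l0\<close> is a nonzero constant.
  So this generator is a combination of the others and can be discarded.
\<close>

lemma homog_gens_remove:
  fixes M :: "(('n::finite, 'k::field) mpoly, 'm) module"
  assumes M: "graded_module M G" and gens: "homog_gens M G r a g"
    and v: "keys v \<subseteq> {..<r}" "lin_ext M g v = \<zero>\<^bsub>M\<^esub>" "const_coeff (lookup v l0) \<noteq> 0"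
  shows "\<exists>a' g'. homog_gens M G (r - 1) a' g'"
proof -
  interpret M: module base_ring M by (rule graded_moduleD(1)[OF M])
  have g: "\<And>l. l < r \<Longrightarrow> g l \<in> G (a l)" and
    span: "\<And>N. submodule N base_ring M \<Longrightarrow> (\<forall>l<r. g l \<in> N) \<Longrightarrow> carrier M \<subseteq> N"
    using gens by (auto simp: homog_gens_def)
  have gM: "\<And>l. l < r \<Longrightarrow> g l \<in> carrier M" using g graded_moduleD(2)[OF M] by blast
  have l0: "l0 < r" using v(1,3) lookup_outside by force
  have hom: "lin_ext M g \<in> mod_hom (free_module {..<r}) M"
    by (rule lin_ext_hom[OF graded_moduleD(1)[OF M]]) (use gM in auto)
  define w where "w = vcomp a (a l0) v"
  have kw: "keys w \<subseteq> {..<r}" using v(1) by (simp add: w_def keys_vcomp)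
  have w0: "lin_ext M g w = \<zero>\<^bsub>M\<^esub>"
    unfolding w_def
    by (rule graded_kernel[OF M hom lin_ext_graded[OF M] v(1,2)]) (use g in auto)
  define c where "c = const_coeff (lookup v l0)"
  have wl0: "lookup w l0 = single 0 c"
    using homog_zero_eq_const[of "hcomp 0 (lookup v l0)"]
    by (simp add: w_def vcomp.rep_eq c_def const_coeff_hcomp)
  define R where "R = (\<Oplus>\<^bsub>M\<^esub>l\<in>{..<r} - {l0}. lookup w l \<odot>\<^bsub>M\<^esub> g l)"
  have RM: "R \<in> carrier M" unfolding R_def by (rule M.finsum_closed) (use gM in auto)
  have "\<zero>\<^bsub>M\<^esub> = (\<Oplus>\<^bsub>M\<^esub>l\<in>insert l0 ({..<r} - {l0}). lookup w l \<odot>\<^bsub>M\<^esub> g l)"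
    using lin_ext_superset[OF graded_moduleD(1)[OF M] _ kw, of g] gM w0 l0
    by (simp add: insert_absorb)
  also have "\<dots> = single 0 c \<odot>\<^bsub>M\<^esub> g l0 \<oplus>\<^bsub>M\<^esub> R"
    unfolding R_def wl0[symmetric] by (rule M.finsum_insert) (use gM l0 in auto)
  finally have eq: "single 0 c \<odot>\<^bsub>M\<^esub> g l0 = \<ominus>\<^bsub>M\<^esub> R"
    using RM gM[OF l0] M.minus_equality[of "single 0 c \<odot>\<^bsub>M\<^esub> g l0" R] M.smult_closed[of "single 0 c" "g l0"] by simp
  \<comment> \<open>the last generator moves into the place that becomes free\<close>
  define g' where "g' = g(l0 := g (r - 1))"
  define a' where "a' = a(l0 := a (r - 1))"
  have "homog_gens M G (r - 1) a' g'"
    unfolding homog_gens_def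
  proof (intro conjI allI impI)
    fix l assume "l < r - 1" then show "g' l \<in> G (a' l)" using g by (auto simp: g'_def a'_def)
  next
    fix N assume N: "submodule N base_ring M \<and> (\<forall>l<r-1. g' l \<in> N)"
    have other: "g l \<in> N" if l: "l < r" "l \<noteq> l0" for l
    proof (cases "l = r - 1")
      case True
      then have "l0 < r - 1" using l l0 by simp
      then have "g' l0 \<in> N" using N by blast
      then show ?thesis using True by (simp add: g'_def)
    next
      case False
      then have "g' l \<in> N" using l N by simp
      then show ?thesis using l by (simp add: g'_def)
    qed
    have "R \<in> N"
      unfolding R_def
      by (rule M.submodule_finsum) (use N other M.submoduleE(4) in auto)
    then have "single 0 (1 / c) \<odot>\<^bsub>M\<^esub> (single 0 c \<odot>\<^bsub>M\<^esub> g l0) \<in> N"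
      unfolding eq using N M.submoduleE(3,4) by simp
    moreover have "single 0 (1 / c) \<odot>\<^bsub>M\<^esub> (single 0 c \<odot>\<^bsub>M\<^esub> g l0) = g l0"
    proof -
      have one: "single 0 (1 / c) * single 0 c = (1 :: ('n, 'k) mpoly)"
        using v(3) by (simp add: mult_single c_def)
      show ?thesis
        using M.smult_assoc1[of "single 0 (1 / c)" "single 0 c" "g l0"] gM[OF l0] M.smult_one[of "g l0"] one by simp
    qed
    ultimately have "g l0 \<in> N" by simp
    then have "\<forall>l<r. g l \<in> N" using other by blast
    then show "carrier M \<subseteq> N" using span N by blast
  qed
  then show ?thesis by blast
qed

text \<open>
  A degree-preserving surjection $\bigoplus_{l < r} S(-a_l) \to M$ whose kernel lies in $\mathfrak{m} F$.
\<close>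

definition minimal_cover ::
  "(('n::finite, 'k::field) mpoly, 'm) module \<Rightarrow> (int \<Rightarrow> 'm set) \<Rightarrow>
     nat \<Rightarrow> (nat \<Rightarrow> int) \<Rightarrow> (('n, 'k) fvec \<Rightarrow> 'm) \<Rightarrow> bool" where
  "minimal_cover M G r a h \<longleftrightarrow> h \<in> mod_hom (free_module {..<r}) M \<and>
     h ` {v. keys v \<subseteq> {..<r}} = carrier M \<and> (\<forall>j. h ` gfree {..<r} a j \<subseteq> G j) \<and>
     {v. keys v \<subseteq> {..<r} \<and> h v = \<zero>\<^bsub>M\<^esub>} \<subseteq> max_free {..<r}"

text \<open>
  A system of homogeneous generators with the least possible number of elements does it, by
  \<open>homog_gens_remove\<close>.
\<close>

lemma ex_minimal_cover:
  fixes M :: "(('n::finite, 'k::field) mpoly, 'm) module"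
  assumes M: "graded_module M G" and fg: "fin_gen M"
  shows "\<exists>r a h. minimal_cover M G r a h"
proof -
  define r where "r = (LEAST r. \<exists>a g. homog_gens M G r a g)"
  have "\<exists>a g. homog_gens M G r a g"
    unfolding r_def using ex_homog_gens[OF M fg] by (rule LeastI_ex)
  then obtain a g where gens: "homog_gens M G r a g" by blast
  have least: "r \<le> r'" if "homog_gens M G r' a' g'" for r' a' g'
    unfolding r_def by (rule Least_le) (use that in blast)
  have g: "\<And>l. l < r \<Longrightarrow> g l \<in> G (a l)" and
    span: "\<And>N. submodule N base_ring M \<Longrightarrow> (\<forall>l<r. g l \<in> N) \<Longrightarrow> carrier M \<subseteq> N"
    using gens by (auto simp: homog_gens_def)
  have gM: "\<And>l. l < r \<Longrightarrow> g l \<in> carrier M" using g graded_moduleD(2)[OF M] by blast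
  have hom: "lin_ext M g \<in> mod_hom (free_module {..<r}) M"
    by (rule lin_ext_hom[OF graded_moduleD(1)[OF M]]) (use gM in auto)
  interpret M: module base_ring M by (rule graded_moduleD(1)[OF M])
  have "minimal_cover M G r a (lin_ext M g)"
    unfolding minimal_cover_def
  proof (intro conjI allI)
    show "lin_ext M g \<in> mod_hom (free_module {..<r}) M" by (rule hom)
    have "lin_ext M g ` carrier (free_module {..<r}) = carrier M"
    proof
      show "lin_ext M g ` carrier (free_module {..<r}) \<subseteq> carrier M" using mod_homD(1)[OF hom] by auto
      have "g l \<in> lin_ext M g ` carrier (free_module {..<r})" if "l < r" for l
        using lin_ext_single[OF graded_moduleD(1)[OF M], of g l 1] gM[OF that] M.smult_one[of "g l"] that
        by (intro image_eqI[of _ _ "single l 1"]) auto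
      then show "carrier M \<subseteq> lin_ext M g ` carrier (free_module {..<r})"
        using span[OF image_submodule[OF graded_moduleD(1)[OF M] hom]] by blast
    qed
    then show "lin_ext M g ` {v. keys v \<subseteq> {..<r}} = carrier M" by simp
    show "lin_ext M g ` gfree {..<r} a j \<subseteq> G j" for j
      by (rule lin_ext_graded[OF M]) (use g in auto)
    show "{v. keys v \<subseteq> {..<r} \<and> lin_ext M g v = \<zero>\<^bsub>M\<^esub>} \<subseteq> max_free {..<r}"
    proof (rule subsetI, rule ccontr)
      fix v assume "v \<in> {v. keys v \<subseteq> {..<r} \<and> lin_ext M g v = \<zero>\<^bsub>M\<^esub>}"
      then have v: "keys v \<subseteq> {..<r}" "lin_ext M g v = \<zero>\<^bsub>M\<^esub>" by auto
      assume "v \<notin> max_free {..<r}"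
      then obtain l0 where l0: "const_coeff (lookup v l0) \<noteq> 0" using v(1) by (auto simp: max_free_def)
      then have "l0 < r" using v(1) lookup_outside by force
      moreover obtain a' g' where "homog_gens M G (r - 1) a' g'"
        using homog_gens_remove[OF M gens v l0] by blast
      ultimately show False using least[of "r - 1"] by fastforce
    qed
  qed
  then show ?thesis by blast
qed

lemma graded_submod_kernel:
  fixes M :: "(('n::finite, 'k::field) mpoly, 'm) module" and B :: "'b set"
  assumes M: "graded_module M G" and h: "h \<in> mod_hom (free_module B) M"
    and gr: "\<And>j. h ` gfree B a j \<subseteq> G j"
  shows "graded_submod B a {v. keys v \<subseteq> B \<and> h v = \<zero>\<^bsub>M\<^esub>}"
proof -
  interpret M: module base_ring M by (rule graded_moduleD(1)[OF M])
  have h0: "h 0 = \<zero>\<^bsub>M\<^esub>" using mod_hom_zero[OF h module_free graded_moduleD(1)[OF M]] by simp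
  have add: "h (v + w) = h v \<oplus>\<^bsub>M\<^esub> h w" if "keys v \<subseteq> B" "keys w \<subseteq> B" for v w
    using mod_homD(2)[OF h, of v w] that by simp
  have smult: "h (r \<star> v) = r \<odot>\<^bsub>M\<^esub> h v" if "keys v \<subseteq> B" for r v
    using mod_homD(3)[OF h, of v r] that by simp
  show ?thesis
    using M.smult_r_null graded_kernel[OF M h gr]
    by (simp add: graded_submod_def submod_def keys_subset_intros keys_vcomp h0 add smult)
qed

text \<open>
  One step in the construction of a resolution: a state \<open>(r, a, Z)\<close> is a graded free module together
  with a submodule still to be covered; the next state is a cover of \<open>Z\<close> with its kernel.
\<close>

definition syzygy_step where
  "syzygy_step = (\<lambda>(r, a, Z) (r', a', Z') h.
     h \<in> mod_hom (free_module {..<r'}) (free_module {..<r}) \<and>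
     h ` {v. keys v \<subseteq> {..<r'}} = Z \<and> (\<forall>j. h ` gfree {..<r'} a' j \<subseteq> gfree {..<r} a j) \<and>
     Z' = {v :: ('n::finite, 'k::field) fvec. keys v \<subseteq> {..<r' :: nat} \<and>
           h v = (0 :: ('n, 'k) fvec)} \<and> Z' \<subseteq> max_free {..<r'})"

lemma ex_syzygy_step:
  fixes Z :: "('n::finite, 'k::field) fvec set"
  assumes Z: "graded_submod {..<r} a Z"
  shows "\<exists>r' a' Z' h. graded_submod {..<r'} a' Z' \<and> syzygy_step (r, a, Z) (r', a', Z') h"
proof -
  let ?M = "free_module {..<r}\<lparr>carrier := Z\<rparr> :: (('n, 'k) mpoly, ('n, 'k) fvec) module"
  have M: "graded_module ?M (\<lambda>j. Z \<inter> gfree {..<r} a j)" by (rule graded_module_submod[OF Z])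
  have sub: "submod {..<r} Z" using Z by (simp add: graded_submod_def)
  obtain r' a' h where "minimal_cover ?M (\<lambda>j. Z \<inter> gfree {..<r} a j) r' a' h"
    using ex_minimal_cover[OF M fin_gen_submod[OF sub]] by blast
  then have h: "h \<in> mod_hom (free_module {..<r'}) ?M" "h ` {v. keys v \<subseteq> {..<r'}} = Z"
    "\<And>j. h ` gfree {..<r'} a' j \<subseteq> Z \<inter> gfree {..<r} a j"
    "{v. keys v \<subseteq> {..<r'} \<and> h v = 0} \<subseteq> max_free {..<r'}"
    by (auto simp: minimal_cover_def)
  have "h \<in> mod_hom (free_module {..<r'}) (free_module {..<r})"
    using h(1) sub by (auto simp: mod_hom_def submod_def)
  moreover have "graded_submod {..<r'} a' {v. keys v \<subseteq> {..<r'} \<and> h v = 0}"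
    using graded_submod_kernel[OF M h(1,3)] by simp
  moreover have "\<forall>j. h ` gfree {..<r'} a' j \<subseteq> gfree {..<r} a j" using h(3) by blast
  ultimately have "graded_submod {..<r'} a' {v. keys v \<subseteq> {..<r'} \<and> h v = 0} \<and>
      syzygy_step (r, a, Z) (r', a', {v. keys v \<subseteq> {..<r'} \<and> h v = 0}) h"
    using h(2,4) by (simp add: syzygy_step_def)
  then show ?thesis by blast
qed

lemma ex_syzygy_chain:
  fixes Z0 :: "('n::finite, 'k::field) fvec set"
  assumes Z0: "graded_submod {..<r0} a0 Z0"
  shows "\<exists>rk sh Z bd. rk 0 = r0 \<and> sh 0 = a0 \<and> Z 0 = Z0 \<and>
    (\<forall>i. syzygy_step (rk i, sh i, Z i) (rk (Suc i), sh (Suc i), Z (Suc i)) (bd i))"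
proof -
  define St where "St = (\<lambda>(r, a, Z :: ('n, 'k) fvec set). graded_submod {..<r} a Z)"
  have "\<exists>f. \<forall>n. (St (f n) \<and> (n = 0 \<longrightarrow> f n = (r0, a0, Z0))) \<and> (\<exists>h. syzygy_step (f n) (f (Suc n)) h)"
  proof (rule dependent_nat_choice)
    show "\<exists>x. St x \<and> (0 = (0::nat) \<longrightarrow> x = (r0, a0, Z0))" using Z0 by (auto simp: St_def)
    fix x and n :: nat assume x: "St x \<and> (n = 0 \<longrightarrow> x = (r0, a0, Z0))"
    obtain r a Z where xe: "x = (r, a, Z)" by (cases x)
    then have "graded_submod {..<r} a Z" using x by (simp add: St_def)
    from ex_syzygy_step[OF this] obtain r' a' Z' h where
      "graded_submod {..<r'} a' Z' \<and> syzygy_step (r, a, Z) (r', a', Z') h" by (elim exE)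
    then have "(St (r', a', Z') \<and> (Suc n = 0 \<longrightarrow> (r', a', Z') = (r0, a0, Z0))) \<and> (\<exists>h. syzygy_step x (r', a', Z') h)"
      by (auto simp: St_def xe)
    then show "\<exists>y. (St y \<and> (Suc n = 0 \<longrightarrow> y = (r0, a0, Z0))) \<and> (\<exists>h. syzygy_step x y h)"
      by (rule exI)
  qed
  then obtain f where f': "\<forall>n. (St (f n) \<and> (n = 0 \<longrightarrow> f n = (r0, a0, Z0))) \<and> (\<exists>h. syzygy_step (f n) (f (Suc n)) h)"
    by (rule exE)
  then have f: "f 0 = (r0, a0, Z0)" "\<forall>n. \<exists>h. syzygy_step (f n) (f (Suc n)) h" by blast+
  from choice[OF f(2)] obtain bd where bd: "\<forall>n. syzygy_step (f n) (f (Suc n)) (bd n)" by (rule exE)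
  show ?thesis
    by (rule exI[of _ "\<lambda>n. fst (f n)"], rule exI[of _ "\<lambda>n. fst (snd (f n))"],
        rule exI[of _ "\<lambda>n. snd (snd (f n))"], rule exI[of _ bd]) (use f(1) bd in simp)
qed

text \<open>
  By exactness the condition for \<open>i = 0\<close> also puts the kernel of the augmentation into $\mathfrak{m} F_0$.
\<close>

definition minimal_resolution :: "(('n::finite, 'k::field) mpoly, 'm) free_resolution \<Rightarrow> bool" where
  "minimal_resolution F \<longleftrightarrow>
     (\<forall>i v. keys v \<subseteq> {..<rk F (Suc i)} \<longrightarrow> bd F i v \<in> max_free {..<rk F i})"

lemma res_grading_eq: "res_grading F i j = gfree {..<rk F i} (shift F i) j"
  by (auto simp: res_grading_def res_mod_def gfree_def)

lemma a_kernel_eq: "a_kernel M N h = {x \<in> carrier M. h x = \<zero>\<^bsub>N\<^esub>}"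
  by (simp add: a_kernel_def kernel_def)

text \<open>
  The first step may be prescribed. This is used for $S/I$, where it is the projection of $S$.
\<close>

lemma minimal_resolution_from_cover:
  fixes M :: "(('n::finite, 'k::field) mpoly, 'm) module"
  assumes M: "graded_module M G" and cover: "minimal_cover M G r a \<epsilon>"
  shows "\<exists>F. graded_free_resolution M G F \<and> minimal_resolution F \<and> rk F 0 = r \<and> shift F 0 = a \<and> aug F = \<epsilon>"
proof -
  let ?Z = "{v. keys v \<subseteq> {..<r} \<and> \<epsilon> v = \<zero>\<^bsub>M\<^esub>}"
  have \<epsilon>: "\<epsilon> \<in> mod_hom (free_module {..<r}) M" "\<epsilon> ` {v. keys v \<subseteq> {..<r}} = carrier M"
      "\<And>j. \<epsilon> ` gfree {..<r} a j \<subseteq> G j" "?Z \<subseteq> max_free {..<r}"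
    using cover by (simp_all add: minimal_cover_def)
  from ex_syzygy_chain[OF graded_submod_kernel[OF M \<epsilon>(1,3)]]
  obtain rk sh Z bd where chain: "rk 0 = r \<and> sh 0 = a \<and> Z 0 = ?Z \<and>
      (\<forall>i. syzygy_step (rk i, sh i, Z i) (rk (Suc i), sh (Suc i), Z (Suc i)) (bd i))" by (elim exE)
  then have init: "rk 0 = r" "sh 0 = a" "Z 0 = ?Z" by auto
  have step: "syzygy_step (rk i, sh i, Z i) (rk (Suc i), sh (Suc i), Z (Suc i)) (bd i)" for i
    using chain by blast
  have F: "bd i \<in> mod_hom (free_module {..<rk (Suc i)}) (free_module {..<rk i})"
    "bd i ` {v. keys v \<subseteq> {..<rk (Suc i)}} = Z i"
    "\<And>j. bd i ` gfree {..<rk (Suc i)} (sh (Suc i)) j \<subseteq> gfree {..<rk i} (sh i) j"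
    "Z (Suc i) = {v. keys v \<subseteq> {..<rk (Suc i)} \<and> bd i v = 0}"
    "Z (Suc i) \<subseteq> max_free {..<rk (Suc i)}" for i
    using step[of i] unfolding syzygy_step_def prod.case by blast+
  have Zmax: "Z i \<subseteq> max_free {..<rk i}" for i
    using F(5) \<epsilon>(4) init by (cases i) simp_all
  define F where "F = \<lparr>rk = rk, shift = sh, aug = \<epsilon>, bd = bd\<rparr>"
  have "graded_free_resolution M G F"
    unfolding graded_free_resolution_def exact_resolution_def res_grading_eq
  proof (intro conjI allI)
    show "aug F \<in> mod_hom (res_mod F 0) M" "aug F ` carrier (res_mod F 0) = carrier M"
      using \<epsilon>(1,2) init by (simp_all add: F_def res_mod_def)
    show "free_resolution.bd F i \<in> mod_hom (res_mod F (Suc i)) (res_mod F i)" for i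
      using F(1) by (simp add: F_def res_mod_def)
    show "free_resolution.bd F 0 ` carrier (res_mod F (Suc 0)) = a_kernel (res_mod F 0) M (aug F)"
      using F(2)[of 0] init by (simp add: F_def res_mod_def a_kernel_eq)
    show "free_resolution.bd F (Suc i) ` carrier (res_mod F (Suc (Suc i))) =
      a_kernel (res_mod F (Suc i)) (res_mod F i) (free_resolution.bd F i)" for i
      using F(2)[of "Suc i"] F(4)[of i] by (simp add: F_def res_mod_def a_kernel_eq)
    show "aug F ` gfree {..<free_resolution.rk F 0} (shift F 0) j \<subseteq> G j" for j
      using \<epsilon>(3) init by (simp add: F_def)
    show "free_resolution.bd F i ` gfree {..<free_resolution.rk F (Suc i)} (shift F (Suc i)) j
      \<subseteq> gfree {..<free_resolution.rk F i} (shift F i) j" for i j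
      using F(3) by (simp add: F_def)
  qed
  moreover have "minimal_resolution F"
  proof -
    have "bd i ` {v. keys v \<subseteq> {..<rk (Suc i)}} \<subseteq> max_free {..<rk i}" for i
      using F(2)[of i] Zmax[of i] by simp
    then show ?thesis by (simp add: minimal_resolution_def F_def image_subset_iff)
  qed
  ultimately show ?thesis using init by (intro exI[of _ F]) (simp add: F_def)
qed

lemma ex_minimal_resolution:
  fixes M :: "(('n::finite, 'k::field) mpoly, 'm) module"
  assumes "graded_module M G" "fin_gen M"
  shows "\<exists>F. graded_free_resolution M G F \<and> minimal_resolution F"
  using ex_minimal_cover[OF assms] minimal_resolution_from_cover[OF assms(1)] by blast

section \<open>Comparison of resolutions\<close>

text \<open>
  A direct summand, by \<open>\<iota>\<close> and \<open>\<pi>\<close>, of the free module with basis \<open>B\<close>, where \<open>b\<close> has degree \<open>dg b\<close> and \<open>H\<close>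
  is the grading of the ring. If \<open>H\<close> and \<open>GP\<close> are constantly the whole ring and the whole module, this
  is ordinary projectivity. So one comparison theorem serves both for graded free resolutions and
  for ungraded projective ones.
\<close>

definition graded_proj ::
  "(int \<Rightarrow> 'r::comm_ring_1 set) \<Rightarrow> ('r, 'p) module \<Rightarrow> (int \<Rightarrow> 'p set) \<Rightarrow> 'b set \<Rightarrow> ('b \<Rightarrow> int) \<Rightarrow>
     ('p \<Rightarrow> ('b \<Rightarrow>\<^sub>0 'r)) \<Rightarrow> (('b \<Rightarrow>\<^sub>0 'r) \<Rightarrow> 'p) \<Rightarrow> bool" where
  "graded_proj H P GP B dg \<iota> \<pi> \<longleftrightarrow>
     \<iota> \<in> mod_hom P (free_module B) \<and> \<pi> \<in> mod_hom (free_module B) P \<and>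
     (\<forall>x\<in>carrier P. \<pi> (\<iota> x) = x) \<and> (\<forall>j. GP j \<subseteq> carrier P) \<and>
     (\<forall>b\<in>B. \<pi> (single b 1) \<in> GP (dg b)) \<and>
     (\<forall>j. \<forall>x\<in>GP j. \<forall>b\<in>B. lookup (\<iota> x) b \<in> H (j - dg b))"

text \<open>
  The closure properties of the sets \<open>GQ j\<close> under which a linear map takes homogeneous elements to
  homogeneous elements as soon as it does so on a homogeneous basis.
\<close>

definition graded_target ::
  "(int \<Rightarrow> 'r::comm_ring_1 set) \<Rightarrow> ('r, 'q) module \<Rightarrow> (int \<Rightarrow> 'q set) \<Rightarrow> bool" where
  "graded_target H Q GQ \<longleftrightarrow> module base_ring Q \<and>
     (\<forall>j. GQ j \<subseteq> carrier Q \<and> \<zero>\<^bsub>Q\<^esub> \<in> GQ j \<and> (\<forall>x\<in>GQ j. \<forall>y\<in>GQ j. x \<oplus>\<^bsub>Q\<^esub> y \<in> GQ j)) \<and>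
     (\<forall>i j. \<forall>r\<in>H i. \<forall>x\<in>GQ j. r \<odot>\<^bsub>Q\<^esub> x \<in> GQ (i + j))"

lemma graded_target_finsum:
  assumes "graded_target H Q GQ" "finite A" "\<And>i. i \<in> A \<Longrightarrow> f i \<in> GQ j"
  shows "finsum Q f A \<in> GQ j"
proof -
  interpret module base_ring Q using assms(1) by (simp add: graded_target_def)
  have sub: "GQ j \<subseteq> carrier Q" using assms(1) by (simp add: graded_target_def)
  show ?thesis
    using assms(2,3)
  proof (induction A)
    case (insert x F)
    then have "f \<in> F \<rightarrow> carrier Q" "f x \<in> carrier Q" using sub by blast+
    then show ?case using insert assms(1) by (simp add: graded_target_def)
  qed (use assms(1) in \<open>simp add: graded_target_def\<close>)
qed

text \<open>
  Choose homogeneous lifts of the images of the basis elements, extend linearly, and restrict along \<open>\<iota>\<close>.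
\<close>

lemma graded_proj_lift:
  fixes P :: "('r::comm_ring_1, 'p) module" and Q :: "('r, 'q) module" and N :: "('r, 'm) module"
    and B :: "'b set"
  assumes P: "graded_proj H P GP B dg \<iota> \<pi>" and Q: "graded_target H Q GQ" and N: "module base_ring N"
    and q: "q \<in> mod_hom Q N" and g: "g \<in> mod_hom P N"
    and im: "\<And>j x. x \<in> GP j \<Longrightarrow> \<exists>y\<in>GQ j. q y = g x"
  shows "\<exists>h\<in>mod_hom P Q. (\<forall>x\<in>carrier P. q (h x) = g x) \<and> (\<forall>j. h ` GP j \<subseteq> GQ j)"
proof -
  have P': "\<iota> \<in> mod_hom P (free_module B)" "\<pi> \<in> mod_hom (free_module B) P"
     "\<And>x. x \<in> carrier P \<Longrightarrow> \<pi> (\<iota> x) = x" "\<And>j. GP j \<subseteq> carrier P"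
     "\<And>b. b \<in> B \<Longrightarrow> \<pi> (single b 1) \<in> GP (dg b)"
     "\<And>j x b. x \<in> GP j \<Longrightarrow> b \<in> B \<Longrightarrow> lookup (\<iota> x) b \<in> H (j - dg b)"
    using P by (auto simp: graded_proj_def)
  have modQ: "module base_ring Q" using Q by (simp add: graded_target_def)
  have "\<forall>b. \<exists>y. b \<in> B \<longrightarrow> y \<in> GQ (dg b) \<and> q y = g (\<pi> (single b 1))"
    using im P'(5) by blast
  then obtain y where y: "\<And>b. b \<in> B \<Longrightarrow> y b \<in> GQ (dg b)" "\<And>b. b \<in> B \<Longrightarrow> q (y b) = g (\<pi> (single b 1))"
    by metis
  have yQ: "\<And>b. b \<in> B \<Longrightarrow> y b \<in> carrier Q" using y(1) Q unfolding graded_target_def by blast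
  interpret Q: module base_ring Q by (rule modQ)
  have hom: "lin_ext Q y \<in> mod_hom (free_module B) Q" by (rule lin_ext_hom[OF modQ yQ])
  have eq: "q (lin_ext Q y v) = g (\<pi> v)" if "keys v \<subseteq> B" for v
  proof (rule hom_eq_on_basis[OF N mod_hom_comp[OF hom q] mod_hom_comp[OF P'(2) g] _ that])
    fix b assume b: "b \<in> B"
    then show "q (lin_ext Q y (single b 1)) = g (\<pi> (single b 1))"
      using lin_ext_single[OF modQ, of y b 1] yQ[OF b] Q.smult_one[OF yQ[OF b]] y(2) by simp
  qed
  show ?thesis
  proof (intro bexI[of _ "\<lambda>x. lin_ext Q y (\<iota> x)"] conjI ballI allI)
    fix x assume x: "x \<in> carrier P"
    then show "q (lin_ext Q y (\<iota> x)) = g x"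
      using eq[of "\<iota> x"] mod_homD(1)[OF P'(1) x] P'(3) by simp
  next
    fix j
    show "(\<lambda>x. lin_ext Q y (\<iota> x)) ` GP j \<subseteq> GQ j"
    proof safe
      fix x assume x: "x \<in> GP j"
      then have sub: "keys (\<iota> x) \<subseteq> B" using mod_homD(1)[OF P'(1), of x] P'(4) by auto
      show "lin_ext Q y (\<iota> x) \<in> GQ j"
        unfolding lin_ext_def
      proof (rule graded_target_finsum[OF Q])
        fix b assume "b \<in> keys (\<iota> x)"
        then have b: "b \<in> B" using sub by blast
        have "lookup (\<iota> x) b \<odot>\<^bsub>Q\<^esub> y b \<in> GQ ((j - dg b) + dg b)"
          using P'(6)[OF x b] y(1)[OF b] Q unfolding graded_target_def by blast
        then show "lookup (\<iota> x) b \<odot>\<^bsub>Q\<^esub> y b \<in> GQ j" by simp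
      qed simp
    qed
  qed (rule mod_hom_comp[OF P'(1) hom])
qed

lemma exact_resolutionD:
  assumes "exact_resolution M P \<epsilon> \<delta>"
  shows "\<epsilon> \<in> mod_hom (P 0) M" "\<delta> i \<in> mod_hom (P (Suc i)) (P i)" "\<epsilon> ` carrier (P 0) = carrier M"
    "\<delta> 0 ` carrier (P (Suc 0)) = {x \<in> carrier (P 0). \<epsilon> x = \<zero>\<^bsub>M\<^esub>}"
    "\<delta> (Suc i) ` carrier (P (Suc (Suc i))) = {x \<in> carrier (P (Suc i)). \<delta> i x = \<zero>\<^bsub>P i\<^esub>}"
  using assms by (auto simp: exact_resolution_def a_kernel_eq)

text \<open>
  The map is lifted one step at a time. The last clause of \<open>good\<close> says that the current map sends
  boundaries to cycles, which is what exactness of the target needs for the next lift.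
\<close>

lemma comparison:
  fixes P :: "nat \<Rightarrow> ('r::comm_ring_1, 'p) module" and Q :: "nat \<Rightarrow> ('r, 'q) module" and M :: "('r, 'm) module"
    and B :: "nat \<Rightarrow> 'b set"
  assumes M: "module base_ring M" and P: "exact_resolution M P \<epsilon> \<delta>" and Q: "exact_resolution M Q \<epsilon>' \<delta>'"
    and proj: "\<And>i. graded_proj H (P i) (GP i) (B i) (dg i) (\<iota> i) (\<pi> i)" and modP: "\<And>i. module base_ring (P i)"
    and targ: "\<And>i. graded_target H (Q i) (GQ i)"
    and grP: "\<And>i j. \<delta> i ` GP (Suc i) j \<subseteq> GP i j"
    and ex\<epsilon>: "\<And>j x. x \<in> GP 0 j \<Longrightarrow> \<exists>y\<in>GQ 0 j. \<epsilon>' y = \<epsilon> x"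
    and ex0: "\<And>j y. y \<in> GQ 0 j \<Longrightarrow> \<epsilon>' y = \<zero>\<^bsub>M\<^esub> \<Longrightarrow> \<exists>z\<in>GQ 1 j. \<delta>' 0 z = y"
    and exS: "\<And>i j y. y \<in> GQ (Suc i) j \<Longrightarrow> \<delta>' i y = \<zero>\<^bsub>Q i\<^esub> \<Longrightarrow> \<exists>z\<in>GQ (Suc (Suc i)) j. \<delta>' (Suc i) z = y"
  obtains \<alpha> where "\<And>i. \<alpha> i \<in> mod_hom (P i) (Q i)" "\<And>i j. \<alpha> i ` GP i j \<subseteq> GQ i j"
    "\<And>x. x \<in> carrier (P 0) \<Longrightarrow> \<epsilon>' (\<alpha> 0 x) = \<epsilon> x"
    "\<And>i x. x \<in> carrier (P (Suc i)) \<Longrightarrow> \<delta>' i (\<alpha> (Suc i) x) = \<alpha> i (\<delta> i x)"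
proof -
  note P' = exact_resolutionD[OF P] and Q' = exact_resolutionD[OF Q]
  have modQ: "module base_ring (Q i)" for i using targ by (simp add: graded_target_def)
  have GPc: "GP i j \<subseteq> carrier (P i)" for i j using proj by (simp add: graded_proj_def)
  define good where "good = (\<lambda>n \<alpha>. \<alpha> \<in> mod_hom (P n) (Q n) \<and> (\<forall>j. \<alpha> ` GP n j \<subseteq> GQ n j) \<and>
     (n = 0 \<longrightarrow> (\<forall>x\<in>carrier (P 0). \<epsilon>' (\<alpha> x) = \<epsilon> x)) \<and>
     (\<forall>x\<in>carrier (P (Suc n)). case n of 0 \<Rightarrow> \<epsilon>' (\<alpha> (\<delta> n x)) = \<zero>\<^bsub>M\<^esub> | Suc m \<Rightarrow> \<delta>' m (\<alpha> (\<delta> n x)) = \<zero>\<^bsub>Q m\<^esub>))"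
  have "\<exists>\<alpha>. \<forall>n. good n (\<alpha> n) \<and> (\<forall>x\<in>carrier (P (Suc n)). \<delta>' n (\<alpha> (Suc n) x) = \<alpha> n (\<delta> n x))"
  proof (rule dependent_nat_choice)
    obtain h where h: "h \<in> mod_hom (P 0) (Q 0)" "\<forall>x\<in>carrier (P 0). \<epsilon>' (h x) = \<epsilon> x" "\<forall>j. h ` GP 0 j \<subseteq> GQ 0 j"
      using graded_proj_lift[OF proj targ M Q'(1) P'(1) ex\<epsilon>] by blast
    have "\<epsilon>' (h (\<delta> 0 x)) = \<zero>\<^bsub>M\<^esub>" if "x \<in> carrier (P (Suc 0))" for x
    proof -
      have "\<delta> 0 x \<in> {x \<in> carrier (P 0). \<epsilon> x = \<zero>\<^bsub>M\<^esub>}" using P'(4) that by blast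
      then show ?thesis using h(2) by simp
    qed
    then show "\<exists>x. good 0 x" using h by (auto simp: good_def)
  next
    fix \<alpha> n assume good: "good n \<alpha>"
    have hom: "(\<lambda>x. \<alpha> (\<delta> n x)) \<in> mod_hom (P (Suc n)) (Q n)"
      by (rule mod_hom_comp[OF P'(2)]) (use good in \<open>simp add: good_def\<close>)
    have ex: "\<exists>y\<in>GQ (Suc n) j. \<delta>' n y = \<alpha> (\<delta> n x)" if x: "x \<in> GP (Suc n) j" for x j
    proof -
      have xc: "x \<in> carrier (P (Suc n))" using x GPc by blast
      have "\<delta> n x \<in> GP n j" using grP x by blast
      then have G: "\<alpha> (\<delta> n x) \<in> GQ n j" using good unfolding good_def by blast
      show ?thesis
      proof (cases n)
        case 0
        then show ?thesis using good xc ex0[of "\<alpha> (\<delta> n x)" j] G by (simp add: good_def)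
      next
        case (Suc m)
        then show ?thesis using good xc exS[of "\<alpha> (\<delta> n x)" m j] G by (simp add: good_def)
      qed
    qed
    obtain h where h: "h \<in> mod_hom (P (Suc n)) (Q (Suc n))"
      "\<forall>x\<in>carrier (P (Suc n)). \<delta>' n (h x) = \<alpha> (\<delta> n x)" "\<forall>j. h ` GP (Suc n) j \<subseteq> GQ (Suc n) j"
      using graded_proj_lift[OF proj targ modQ Q'(2) hom ex] by blast
    have "\<delta>' n (h (\<delta> (Suc n) x)) = \<zero>\<^bsub>Q n\<^esub>" if "x \<in> carrier (P (Suc (Suc n)))" for x
    proof -
      have "\<delta> (Suc n) x \<in> {x \<in> carrier (P (Suc n)). \<delta> n x = \<zero>\<^bsub>P n\<^esub>}" using P'(5) that by blast
      moreover have "\<alpha> \<zero>\<^bsub>P n\<^esub> = \<zero>\<^bsub>Q n\<^esub>"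
        by (rule mod_hom_zero[OF _ modP modQ]) (use good in \<open>simp add: good_def\<close>)
      ultimately show ?thesis using h(2) by simp
    qed
    then show "\<exists>\<alpha>'. good (Suc n) \<alpha>' \<and> (\<forall>x\<in>carrier (P (Suc n)). \<delta>' n (\<alpha>' x) = \<alpha> (\<delta> n x))"
      using h by (auto simp: good_def)
  qed
  then obtain \<alpha> where \<alpha>: "\<And>n. good n (\<alpha> n)"
     "\<And>n x. x \<in> carrier (P (Suc n)) \<Longrightarrow> \<delta>' n (\<alpha> (Suc n) x) = \<alpha> n (\<delta> n x)" by blast
  show ?thesis
    by (rule that[of \<alpha>]) (use \<alpha> in \<open>auto simp: good_def\<close>)
qed

subsection \<open>Free resolutions\<close>

locale graded_resolution =
  fixes M :: "(('n::finite, 'k::field) mpoly, 'm) module" and G :: "int \<Rightarrow> 'm set"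
    and F :: "(('n, 'k) mpoly, 'm) free_resolution"
  assumes M: "graded_module M G" and F: "graded_free_resolution M G F"
begin

lemma modM: "module base_ring M" by (rule graded_moduleD(1)[OF M])

lemma exact: "exact_resolution M (res_mod F) (aug F) (bd F)"
  using F by (simp add: graded_free_resolution_def)

lemma bd_hom: "bd F i \<in> mod_hom (free_module {..<rk F (Suc i)}) (free_module {..<rk F i})"
  using exact_resolutionD(2)[OF exact] by (simp add: res_mod_def)

lemma aug_hom: "aug F \<in> mod_hom (free_module {..<rk F 0}) M"
  using exact_resolutionD(1)[OF exact] by (simp add: res_mod_def)

lemma bd_graded: "bd F i ` gfree {..<rk F (Suc i)} (shift F (Suc i)) j \<subseteq> gfree {..<rk F i} (shift F i) j"
  using F unfolding graded_free_resolution_def res_grading_eq by blast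

lemma aug_graded: "aug F ` gfree {..<rk F 0} (shift F 0) j \<subseteq> G j"
  using F unfolding graded_free_resolution_def res_grading_eq by blast

lemma exact_bd0: "keys x \<subseteq> {..<rk F 0} \<Longrightarrow> aug F x = \<zero>\<^bsub>M\<^esub> \<longleftrightarrow> (\<exists>y. keys y \<subseteq> {..<rk F (Suc 0)} \<and> bd F 0 y = x)"
proof -
  assume x: "keys x \<subseteq> {..<rk F 0}"
  have "x \<in> bd F 0 ` {y. keys y \<subseteq> {..<rk F (Suc 0)}} \<longleftrightarrow> keys x \<subseteq> {..<rk F 0} \<and> aug F x = \<zero>\<^bsub>M\<^esub>"
    using exact_resolutionD(4)[OF exact] by (simp add: res_mod_def)
  then show ?thesis using x by blast
qed

lemma exact_bd:
  "keys x \<subseteq> {..<rk F (Suc i)} \<Longrightarrow> bd F i x = 0 \<longleftrightarrow> (\<exists>y. keys y \<subseteq> {..<rk F (Suc (Suc i))} \<and> bd F (Suc i) y = x)"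
proof -
  assume x: "keys x \<subseteq> {..<rk F (Suc i)}"
  have "x \<in> bd F (Suc i) ` {y. keys y \<subseteq> {..<rk F (Suc (Suc i))}} \<longleftrightarrow> keys x \<subseteq> {..<rk F (Suc i)} \<and> bd F i x = 0"
    using exact_resolutionD(5)[OF exact, of i] by (simp add: res_mod_def)
  then show ?thesis using x by blast
qed

lemma aug_surj_graded:
  assumes "x \<in> G j"
  shows "\<exists>y\<in>gfree {..<rk F 0} (shift F 0) j. aug F y = x"
proof -
  have "x \<in> aug F ` {y. keys y \<subseteq> {..<rk F 0}}"
    using exact_resolutionD(3)[OF exact] graded_moduleD(2)[OF M assms] by (simp add: res_mod_def)
  then obtain y where y: "keys y \<subseteq> {..<rk F 0}" "aug F y = x" by blast
  then show ?thesis
    using graded_image[OF M aug_hom aug_graded y(1), of j] vcomp_gfree[OF y(1)] assms by blast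
qed

lemma exact_bd0_graded:
  assumes "x \<in> gfree {..<rk F 0} (shift F 0) j" "aug F x = \<zero>\<^bsub>M\<^esub>"
  shows "\<exists>y\<in>gfree {..<rk F 1} (shift F 1) j. bd F 0 y = x"
proof -
  obtain y where y: "keys y \<subseteq> {..<rk F (Suc 0)}" "bd F 0 y = x"
    using exact_bd0[OF gfreeD(1)[OF assms(1)]] assms(2) by blast
  then have "bd F 0 (vcomp (shift F 1) j y) = x"
    using graded_image[OF graded_module_free bd_hom bd_graded y(1)] assms(1) by simp
  then show ?thesis using vcomp_gfree[OF y(1)] by auto
qed

lemma exact_bd_graded:
  assumes "x \<in> gfree {..<rk F (Suc i)} (shift F (Suc i)) j" "bd F i x = 0"
  shows "\<exists>y\<in>gfree {..<rk F (Suc (Suc i))} (shift F (Suc (Suc i))) j. bd F (Suc i) y = x"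
proof -
  obtain y where y: "keys y \<subseteq> {..<rk F (Suc (Suc i))}" "bd F (Suc i) y = x"
    using exact_bd[OF gfreeD(1)[OF assms(1)]] assms(2) by blast
  then have "bd F (Suc i) (vcomp (shift F (Suc (Suc i))) j y) = x"
    using graded_image[OF graded_module_free bd_hom bd_graded y(1)] assms(1) by simp
  then show ?thesis using vcomp_gfree[OF y(1)] by auto
qed

lemma proj_homog:
  "graded_proj homog (res_mod F i) (gfree {..<rk F i} (shift F i)) {..<rk F i} (shift F i) (\<lambda>x. x) (\<lambda>x. x)"
  unfolding graded_proj_def res_mod_def
  by (auto simp: mod_hom_def gfree_basis dest: gfreeD)

lemma proj_ungraded:
  "graded_proj (\<lambda>_. UNIV) (res_mod F i) (\<lambda>_. carrier (res_mod F i)) {..<rk F i} (\<lambda>_. 0) (\<lambda>x. x) (\<lambda>x. x)"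
  unfolding graded_proj_def res_mod_def by (auto simp: mod_hom_def)

lemma mod_res: "module base_ring (res_mod F i)"
  unfolding res_mod_def by (rule module_free)

lemma target_homog: "graded_target homog (res_mod F i) (gfree {..<rk F i} (shift F i))"
  using mod_res unfolding graded_target_def res_mod_def
  by (auto simp: gfree_add gfree_scale dest: gfreeD)

lemma ungraded_target: "module base_ring Q \<Longrightarrow> graded_target (\<lambda>_. UNIV) Q (\<lambda>_. carrier Q)"
  for Q :: "(('n, 'k) mpoly, 'q) module"
  by (auto simp: graded_target_def module_def abelian_group_def abelian_monoid.zero_closed
      abelian_monoid.a_closed module_axioms_def)

text \<open>
  A chain endomorphism \<open>\<gamma>\<close> over the zero map of \<open>M\<close> is null-homotopic: at each step $\gamma - h\partial$
  takes values in the cycles, hence in the boundaries, and lifts to the next component of \<open>h\<close>.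
\<close>

lemma homotopy:
  assumes \<gamma>: "\<And>i. \<gamma> i \<in> mod_hom (free_module {..<rk F i}) (free_module {..<rk F i})"
    and chain: "\<And>i x. keys x \<subseteq> {..<rk F (Suc i)} \<Longrightarrow> bd F i (\<gamma> (Suc i) x) = \<gamma> i (bd F i x)"
    and aug: "\<And>x. keys x \<subseteq> {..<rk F 0} \<Longrightarrow> aug F (\<gamma> 0 x) = \<zero>\<^bsub>M\<^esub>"
  obtains h where "\<And>i. h i \<in> mod_hom (free_module {..<rk F i}) (free_module {..<rk F (Suc i)})"
    "\<And>x. keys x \<subseteq> {..<rk F 0} \<Longrightarrow> \<gamma> 0 x = bd F 0 (h 0 x)"
    "\<And>i x. keys x \<subseteq> {..<rk F (Suc i)} \<Longrightarrow> \<gamma> (Suc i) x = bd F (Suc i) (h (Suc i) x) + h i (bd F i x)"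
proof -
  let ?c = "\<lambda>i. {x :: ('n, 'k) fvec. keys x \<subseteq> {..<rk F i}}"
  note bds = free_hom_simps[OF bd_hom] and gs = free_hom_simps[OF \<gamma>]
  have lift: "\<exists>h\<in>mod_hom (free_module {..<rk F i}) (free_module {..<rk F (Suc i)}).
      \<forall>x\<in>?c i. bd F i (h x) = g x"
    if g: "g \<in> mod_hom (free_module {..<rk F i}) (free_module {..<rk F i})"
      and im: "\<And>x. keys x \<subseteq> {..<rk F i} \<Longrightarrow> \<exists>y. keys y \<subseteq> {..<rk F (Suc i)} \<and> bd F i y = g x" for i g
  proof -
    have "bd F i \<in> mod_hom (res_mod F (Suc i)) (res_mod F i)" "g \<in> mod_hom (res_mod F i) (res_mod F i)"
      using bd_hom g by (simp_all add: res_mod_def)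
    from graded_proj_lift[OF proj_ungraded ungraded_target[OF mod_res] mod_res this]
    show ?thesis using im by (auto simp: res_mod_def)
  qed
  define good where "good = (\<lambda>n h. h \<in> mod_hom (free_module {..<rk F n}) (free_module {..<rk F (Suc n)}) \<and>
     (n = 0 \<longrightarrow> (\<forall>x\<in>?c 0. \<gamma> 0 x = bd F 0 (h x))) \<and>
     (\<forall>x\<in>?c (Suc n). bd F n (h (bd F n x)) = \<gamma> n (bd F n x)))"
  have "\<exists>h. \<forall>n. good n (h n) \<and> (\<forall>x\<in>?c (Suc n). \<gamma> (Suc n) x = bd F (Suc n) (h (Suc n) x) + h n (bd F n x))"
  proof (rule dependent_nat_choice)
    have "\<exists>y. keys y \<subseteq> {..<rk F (Suc 0)} \<and> bd F 0 y = \<gamma> 0 x" if "keys x \<subseteq> {..<rk F 0}" for x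
      using exact_bd0[of "\<gamma> 0 x"] aug[OF that] gs(1)[OF that] by simp
    then obtain h where h: "h \<in> mod_hom (free_module {..<rk F 0}) (free_module {..<rk F (Suc 0)})"
        "\<forall>x\<in>?c 0. bd F 0 (h x) = \<gamma> 0 x"
      using lift[OF \<gamma>] by blast
    then show "\<exists>h. good 0 h" using bds(1) by (intro exI[of _ h]) (simp add: good_def)
  next
    fix h n assume good: "good n h"
    then have h: "h \<in> mod_hom (free_module {..<rk F n}) (free_module {..<rk F (Suc n)})" by (simp add: good_def)
    note hs = free_hom_simps[OF h]
    let ?g = "\<lambda>x. \<gamma> (Suc n) x - h (bd F n x)"
    have ghom: "?g \<in> mod_hom (free_module {..<rk F (Suc n)}) (free_module {..<rk F (Suc n)})"
      by (rule mod_homI) (simp_all add: bds gs hs keys_subset_intros scale_distribs)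
    have im: "\<exists>y. keys y \<subseteq> {..<rk F (Suc (Suc n))} \<and> bd F (Suc n) y = ?g x" if x: "keys x \<subseteq> {..<rk F (Suc n)}" for x
    proof -
      have "bd F n (?g x) = 0"
        using good x chain[OF x] by (simp add: good_def bds gs hs)
      then show ?thesis
        using exact_bd[of "?g x" n] x by (simp add: bds gs hs keys_minus_subset)
    qed
    obtain h' where h': "h' \<in> mod_hom (free_module {..<rk F (Suc n)}) (free_module {..<rk F (Suc (Suc n))})"
      "\<forall>x\<in>?c (Suc n). bd F (Suc n) (h' x) = ?g x"
      using lift[OF ghom im] by blast
    have bb: "bd F n (bd F (Suc n) x) = 0" if "keys x \<subseteq> {..<rk F (Suc (Suc n))}" for x
      using exact_bd[of "bd F (Suc n) x" n] that bds(1) by blast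
    have "good (Suc n) h'"
      using h' by (simp add: good_def bds bb hs)
    then show "\<exists>h'. good (Suc n) h' \<and> (\<forall>x\<in>?c (Suc n). \<gamma> (Suc n) x = bd F (Suc n) (h' x) + h (bd F n x))"
      using h' by (intro exI[of _ h']) simp
  qed
  then obtain h where "\<And>n. good n (h n)"
    "\<And>n x. x \<in> ?c (Suc n) \<Longrightarrow> \<gamma> (Suc n) x = bd F (Suc n) (h (Suc n) x) + h n (bd F n x)" by blast
  then show ?thesis by (intro that[of h]) (auto simp: good_def)
qed

end

section \<open>Tor and minimal resolutions\<close>

lemma max_free_add: "v \<in> max_free B \<Longrightarrow> w \<in> max_free B \<Longrightarrow> v + w \<in> max_free B"
  by (simp add: max_free_def keys_add_subset lookup_add)

lemma max_free_scale: "const_coeff r = 0 \<Longrightarrow> keys v \<subseteq> B \<Longrightarrow> r \<star> v \<in> max_free B"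
  by (simp add: max_free_def keys_scale_subset const_coeff_mult)

lemma max_free_sum: "(\<And>i. i \<in> A \<Longrightarrow> f i \<in> max_free B) \<Longrightarrow> (\<Sum>i\<in>A. f i) \<in> max_free B"
  by (induction A rule: infinite_finite_induct) (simp_all add: max_free_add, simp_all add: max_free_def)

lemma max_freeD: "v \<in> max_free B \<Longrightarrow> keys v \<subseteq> B" "v \<in> max_free B \<Longrightarrow> const_coeff (lookup v b) = 0"
  by (simp_all add: max_free_def)

lemma hom_max_free:
  assumes h: "h \<in> mod_hom (free_module A) (free_module B)" and "finite A" and v: "v \<in> max_free A"
  shows "h v \<in> max_free B"
proof -
  have "h v = (\<Sum>b\<in>A. lookup v b \<star> h (single b 1))"
    by (rule free_hom_expand[OF h assms(2) max_freeD(1)[OF v]])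
  also have "\<dots> \<in> max_free B"
    by (rule max_free_sum, rule max_free_scale[OF max_freeD(2)[OF v]]) (simp add: free_hom_simps(1)[OF h])
  finally show ?thesis .
qed

lemma basis_not_max_free: "(single b 1 :: 'b \<Rightarrow>\<^sub>0 ('n::finite, 'k::field) mpoly) \<notin> max_free B"
  using max_freeD(2)[of "single b 1 :: 'b \<Rightarrow>\<^sub>0 ('n, 'k) mpoly" B b] by auto

text \<open>
  The homology of $F \otimes k$ in degree \<open>j\<close>, expressed in \<open>F\<close>: some homogeneous element is a cycle but
  not a boundary modulo $\mathfrak{m} F$.
\<close>

definition tor_nonzero :: "(('n::finite, 'k::field) mpoly, 'm) free_resolution \<Rightarrow> nat \<Rightarrow> int \<Rightarrow> bool" where
  "tor_nonzero F i j \<longleftrightarrow> (\<exists>w\<in>gfree {..<rk F i} (shift F i) j.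
     (\<forall>i'. i = Suc i' \<longrightarrow> bd F i' w \<in> max_free {..<rk F i'}) \<and>
     \<not> (\<exists>u. keys u \<subseteq> {..<rk F (Suc i)} \<and> w - bd F i u \<in> max_free {..<rk F i}))"

context graded_resolution
begin

text \<open>
  For a cycle \<open>x\<close> modulo $\mathfrak{m} F$, the term $h(\partial x)$ of the homotopy vanishes modulo
  $\mathfrak{m} F$.
\<close>

lemma homotopy_mod_max:
  assumes \<gamma>: "\<And>i. \<gamma> i \<in> mod_hom (free_module {..<rk F i}) (free_module {..<rk F i})"
    and chain: "\<And>i x. keys x \<subseteq> {..<rk F (Suc i)} \<Longrightarrow> bd F i (\<gamma> (Suc i) x) = \<gamma> i (bd F i x)"
    and aug: "\<And>x. keys x \<subseteq> {..<rk F 0} \<Longrightarrow> aug F (\<gamma> 0 x) = \<zero>\<^bsub>M\<^esub>"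
    and x: "keys x \<subseteq> {..<rk F i}" "\<And>i'. i = Suc i' \<Longrightarrow> bd F i' x \<in> max_free {..<rk F i'}"
  shows "\<exists>u. keys u \<subseteq> {..<rk F (Suc i)} \<and> \<gamma> i x - bd F i u \<in> max_free {..<rk F i}"
proof -
  obtain h where h: "\<And>i. h i \<in> mod_hom (free_module {..<rk F i}) (free_module {..<rk F (Suc i)})"
    "\<And>x. keys x \<subseteq> {..<rk F 0} \<Longrightarrow> \<gamma> 0 x = bd F 0 (h 0 x)"
    "\<And>i x. keys x \<subseteq> {..<rk F (Suc i)} \<Longrightarrow> \<gamma> (Suc i) x = bd F (Suc i) (h (Suc i) x) + h i (bd F i x)"
    using homotopy[OF \<gamma> chain aug] by blast
  have k: "keys (h i x) \<subseteq> {..<rk F (Suc i)}" by (rule free_hom_simps(1)[OF h(1) x(1)])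
  show ?thesis
  proof (cases i)
    case 0
    then show ?thesis using h(2)[of x] x(1) k by (intro exI[of _ "h i x"]) (simp add: max_free_def)
  next
    case (Suc i')
    then have "h i' (bd F i' x) \<in> max_free {..<rk F i}"
      using hom_max_free[OF h(1) _ x(2)[OF Suc]] by simp
    then show ?thesis using h(3)[of x i'] x(1) k Suc by (intro exI[of _ "h i x"]) simp
  qed
qed

text \<open>
  A chain map over the identity of \<open>M\<close> differs from the identity by a map to which
  \<open>homotopy_mod_max\<close> applies.
\<close>

lemma roundtrip_mod_max:
  assumes \<gamma>: "\<And>i. \<beta> i \<in> mod_hom (free_module {..<rk F i}) (free_module {..<rk F i})"
    and chain: "\<And>i x. keys x \<subseteq> {..<rk F (Suc i)} \<Longrightarrow> bd F i (\<beta> (Suc i) x) = \<beta> i (bd F i x)"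
    and aug: "\<And>x. keys x \<subseteq> {..<rk F 0} \<Longrightarrow> aug F (\<beta> 0 x) = aug F x"
    and x: "keys x \<subseteq> {..<rk F i}" "\<And>i'. i = Suc i' \<Longrightarrow> bd F i' x \<in> max_free {..<rk F i'}"
  shows "\<exists>u. keys u \<subseteq> {..<rk F (Suc i)} \<and> x - \<beta> i x - bd F i u \<in> max_free {..<rk F i}"
proof -
  note bs = free_hom_simps[OF assms(1)] and bds = free_hom_simps[OF bd_hom]
  interpret mod: module base_ring M by (rule modM)
  show ?thesis
  proof (rule homotopy_mod_max[where \<gamma> = "\<lambda>i x. x - \<beta> i x", OF _ _ _ x])
    show "(\<lambda>x. x - \<beta> i x) \<in> mod_hom (free_module {..<rk F i}) (free_module {..<rk F i})" for i
      by (rule mod_homI) (simp_all add: bs keys_subset_intros scale_distribs)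
    show "bd F i (y - \<beta> (Suc i) y) = bd F i y - \<beta> i (bd F i y)" if "keys y \<subseteq> {..<rk F (Suc i)}" for i y
      using that chain[OF that] by (simp add: bds bs)
    fix y :: "('n, 'k) fvec" assume y: "keys y \<subseteq> {..<rk F 0}"
    have \<beta>y: "keys (\<beta> 0 y) \<subseteq> {..<rk F 0}" "keys (y - \<beta> 0 y) \<subseteq> {..<rk F 0}"
      using y by (simp_all add: bs keys_minus_subset)
    have c: "aug F (y - \<beta> 0 y) \<in> carrier M" "aug F y \<in> carrier M"
      using mod_homD(1)[OF aug_hom] y \<beta>y by simp_all
    have "aug F y = aug F ((y - \<beta> 0 y) + \<beta> 0 y)" by simp
    also have "\<dots> = aug F (y - \<beta> 0 y) \<oplus>\<^bsub>M\<^esub> aug F y"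
      using mod_homD(2)[OF aug_hom, of "y - \<beta> 0 y" "\<beta> 0 y"] y \<beta>y aug[OF y] by simp
    finally show "aug F (y - \<beta> 0 y) = \<zero>\<^bsub>M\<^esub>"
      using c by (metis mod.M.add.r_cancel_one')
  qed
qed

end

locale two_resolutions =
  A: graded_resolution M G F + B: graded_resolution M G F'
  for M :: "(('n::finite, 'k::field) mpoly, 'm) module" and G and F and F'
begin

lemma comparison_map:
  obtains \<alpha> where "\<And>i. \<alpha> i \<in> mod_hom (free_module {..<rk F i}) (free_module {..<rk F' i})"
    "\<And>i j. \<alpha> i ` gfree {..<rk F i} (shift F i) j \<subseteq> gfree {..<rk F' i} (shift F' i) j"
    "\<And>x. keys x \<subseteq> {..<rk F 0} \<Longrightarrow> aug F' (\<alpha> 0 x) = aug F x"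
    "\<And>i x. keys x \<subseteq> {..<rk F (Suc i)} \<Longrightarrow> bd F' i (\<alpha> (Suc i) x) = \<alpha> i (bd F i x)"
proof (rule comparison[OF A.modM A.exact B.exact A.proj_homog A.mod_res B.target_homog A.bd_graded])
  show "\<exists>y\<in>gfree {..<rk F' 0} (shift F' 0) j. aug F' y = aug F x"
    if "x \<in> gfree {..<rk F 0} (shift F 0) j" for j x
    using A.aug_graded B.aug_surj_graded that by blast
  show "\<exists>z\<in>gfree {..<rk F' 1} (shift F' 1) j. bd F' 0 z = y"
    if "y \<in> gfree {..<rk F' 0} (shift F' 0) j" "aug F' y = \<zero>\<^bsub>M\<^esub>" for j y
    using B.exact_bd0_graded that by blast
  show "\<exists>z\<in>gfree {..<rk F' (Suc (Suc i))} (shift F' (Suc (Suc i))) j. bd F' (Suc i) z = y"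
    if "y \<in> gfree {..<rk F' (Suc i)} (shift F' (Suc i)) j" "bd F' i y = \<zero>\<^bsub>res_mod F' i\<^esub>" for i j y
    using B.exact_bd_graded that by (simp add: res_mod_def)
  fix \<alpha>
  assume \<alpha>: "\<And>i. \<alpha> i \<in> mod_hom (res_mod F i) (res_mod F' i)"
    "\<And>i j. \<alpha> i ` gfree {..<rk F i} (shift F i) j \<subseteq> gfree {..<rk F' i} (shift F' i) j"
    "\<And>x. x \<in> carrier (res_mod F 0) \<Longrightarrow> aug F' (\<alpha> 0 x) = aug F x"
    "\<And>i x. x \<in> carrier (res_mod F (Suc i)) \<Longrightarrow> bd F' i (\<alpha> (Suc i) x) = \<alpha> i (bd F i x)"
  show ?thesis
    by (rule that[of \<alpha>]) (use \<alpha> in \<open>simp_all add: res_mod_def\<close>)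
qed

end

text \<open>
  Let \<open>\<alpha>\<close> and \<open>\<beta>\<close> be comparison maps between the two resolutions. An element of degree \<open>j\<close> of a free
  module without basis elements of degree \<open>j\<close> lies in $\mathfrak{m} F'$; so if \<open>j\<close> is not a shift of the
  minimal resolution \<open>F'\<close>, then \<open>\<beta> \<circ> \<alpha>\<close> kills every homogeneous cycle of degree \<open>j\<close> modulo $\mathfrak{m} F$,
  and being homotopic to the identity it shows that the cycle is a boundary. Conversely, if \<open>\<beta>\<close> sent
  a basis element \<open>e\<close> of \<open>F'\<close> to a boundary, then \<open>\<alpha> \<circ> \<beta>\<close> would send \<open>e\<close> into $\mathfrak{m} F'$, since all
  boundaries of \<open>F'\<close> lie there, and so \<open>e\<close> itself would lie there.
\<close>

lemma tor_nonzero_iff_shift: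
  fixes M :: "(('n::finite, 'k::field) mpoly, 'm) module"
  assumes "graded_module M G" "graded_free_resolution M G F" "graded_free_resolution M G F'"
    and min: "minimal_resolution F'"
  shows "tor_nonzero F i j \<longleftrightarrow> j \<in> shift F' i ` {..<rk F' i}"
proof -
  interpret A: graded_resolution M G F by unfold_locales fact+
  interpret B: graded_resolution M G F' by unfold_locales fact+
  interpret AB: two_resolutions M G F F' by unfold_locales
  interpret BA: two_resolutions M G F' F by unfold_locales
  obtain \<alpha> where \<alpha>: "\<And>i. \<alpha> i \<in> mod_hom (free_module {..<rk F i}) (free_module {..<rk F' i})"
    "\<And>i j. \<alpha> i ` gfree {..<rk F i} (shift F i) j \<subseteq> gfree {..<rk F' i} (shift F' i) j"
    "\<And>x. keys x \<subseteq> {..<rk F 0} \<Longrightarrow> aug F' (\<alpha> 0 x) = aug F x"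
    "\<And>i x. keys x \<subseteq> {..<rk F (Suc i)} \<Longrightarrow> bd F' i (\<alpha> (Suc i) x) = \<alpha> i (bd F i x)"
    using AB.comparison_map by blast
  obtain \<beta> where \<beta>: "\<And>i. \<beta> i \<in> mod_hom (free_module {..<rk F' i}) (free_module {..<rk F i})"
    "\<And>i j. \<beta> i ` gfree {..<rk F' i} (shift F' i) j \<subseteq> gfree {..<rk F i} (shift F i) j"
    "\<And>x. keys x \<subseteq> {..<rk F' 0} \<Longrightarrow> aug F (\<beta> 0 x) = aug F' x"
    "\<And>i x. keys x \<subseteq> {..<rk F' (Suc i)} \<Longrightarrow> bd F i (\<beta> (Suc i) x) = \<beta> i (bd F' i x)"
    using BA.comparison_map by blast
  note as = free_hom_simps[OF \<alpha>(1)] and bs = free_hom_simps[OF \<beta>(1)]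
    and Abd = free_hom_simps[OF A.bd_hom] and Bbd = free_hom_simps[OF B.bd_hom]
  have minD: "bd F' i v \<in> max_free {..<rk F' i}" if "keys v \<subseteq> {..<rk F' (Suc i)}" for i v
    using min that by (simp add: minimal_resolution_def)
  show ?thesis
  proof
    assume "tor_nonzero F i j"
    then obtain w where w: "w \<in> gfree {..<rk F i} (shift F i) j"
      "\<And>i'. i = Suc i' \<Longrightarrow> bd F i' w \<in> max_free {..<rk F i'}"
      "\<And>u. keys u \<subseteq> {..<rk F (Suc i)} \<Longrightarrow> w - bd F i u \<notin> max_free {..<rk F i}"
      by (auto simp: tor_nonzero_def)
    have kw: "keys w \<subseteq> {..<rk F i}" by (rule gfreeD(1)[OF w(1)])
    show "j \<in> shift F' i ` {..<rk F' i}"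
    proof (rule ccontr)
      assume nj: "j \<notin> shift F' i ` {..<rk F' i}"
      have \<alpha>w: "\<alpha> i w \<in> gfree {..<rk F' i} (shift F' i) j" using \<alpha>(2) w(1) by blast
      have "const_coeff (lookup (\<alpha> i w) l) = 0" for l
      proof (cases "l < rk F' i")
        case True
        then have "j - shift F' i l \<noteq> 0" using nj by auto
        then show ?thesis using const_coeff_homog[OF gfreeD(2)[OF \<alpha>w]] by simp
      next
        case False
        then have "lookup (\<alpha> i w) l = 0" using gfreeD(1)[OF \<alpha>w] by (intro lookup_outside) auto
        then show ?thesis by simp
      qed
      then have "\<alpha> i w \<in> max_free {..<rk F' i}" using gfreeD(1)[OF \<alpha>w] by (simp add: max_free_def)
      then have m: "\<beta> i (\<alpha> i w) \<in> max_free {..<rk F i}" by (intro hom_max_free[OF \<beta>(1)]) simp_all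
      have "\<exists>u. keys u \<subseteq> {..<rk F (Suc i)} \<and> w - \<beta> i (\<alpha> i w) - bd F i u \<in> max_free {..<rk F i}"
        by (rule A.roundtrip_mod_max[where \<beta> = "\<lambda>i x. \<beta> i (\<alpha> i x)", OF mod_hom_comp[OF \<alpha>(1) \<beta>(1)]])
          (simp_all add: \<alpha>(3,4) \<beta>(3,4) as kw w(2))
      then obtain u where u: "keys u \<subseteq> {..<rk F (Suc i)}" "w - \<beta> i (\<alpha> i w) - bd F i u \<in> max_free {..<rk F i}" by blast
      have "w - bd F i u = (w - \<beta> i (\<alpha> i w) - bd F i u) + \<beta> i (\<alpha> i w)" by simp
      then have "w - bd F i u \<in> max_free {..<rk F i}" using max_free_add[OF u(2) m] by simp
      then show False using w(3)[OF u(1)] by simp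
    qed
  next
    assume "j \<in> shift F' i ` {..<rk F' i}"
    then obtain l where l: "l < rk F' i" "j = shift F' i l" by auto
    define e where "e = (single l 1 :: ('n, 'k) fvec)"
    have e: "e \<in> gfree {..<rk F' i} (shift F' i) j" "keys e \<subseteq> {..<rk F' i}"
      using gfree_basis[of l "{..<rk F' i}"] l by (auto simp: e_def)
    have "\<beta> i e \<in> gfree {..<rk F i} (shift F i) j" using \<beta>(2) e(1) by blast
    moreover have "bd F i' (\<beta> i e) \<in> max_free {..<rk F i'}" if "i = Suc i'" for i'
    proof -
      have "bd F i' (\<beta> i e) = \<beta> i' (bd F' i' e)" using \<beta>(4)[of e i'] e(2) that by simp
      also have "\<dots> \<in> max_free {..<rk F i'}"
        using minD[of e i'] e(2) that by (intro hom_max_free[OF \<beta>(1)]) simp_all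
      finally show ?thesis .
    qed
    moreover have "\<beta> i e - bd F i u \<notin> max_free {..<rk F i}" if u: "keys u \<subseteq> {..<rk F (Suc i)}" for u
    proof
      assume "\<beta> i e - bd F i u \<in> max_free {..<rk F i}"
      then have "\<alpha> i (\<beta> i e - bd F i u) \<in> max_free {..<rk F' i}" by (intro hom_max_free[OF \<alpha>(1)]) simp_all
      moreover have "\<alpha> i (\<beta> i e - bd F i u) = \<alpha> i (\<beta> i e) - bd F' i (\<alpha> (Suc i) u)"
        using u e(2) \<alpha>(4)[OF u] by (simp add: as bs Abd)
      moreover have "bd F' i (\<alpha> (Suc i) u) \<in> max_free {..<rk F' i}" using minD as(1)[OF u] by simp
      ultimately have m: "\<alpha> i (\<beta> i e) \<in> max_free {..<rk F' i}"
        using max_free_add[of "\<alpha> i (\<beta> i e) - bd F' i (\<alpha> (Suc i) u)" _ "bd F' i (\<alpha> (Suc i) u)"] by simp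
      have "\<exists>u. keys u \<subseteq> {..<rk F' (Suc i)} \<and> e - \<alpha> i (\<beta> i e) - bd F' i u \<in> max_free {..<rk F' i}"
        by (rule B.roundtrip_mod_max[where \<beta> = "\<lambda>i x. \<alpha> i (\<beta> i x)", OF mod_hom_comp[OF \<beta>(1) \<alpha>(1)]])
          (use e(2) minD in \<open>simp_all add: \<alpha>(3,4) \<beta>(3,4) bs\<close>)
      then obtain u' where u': "keys u' \<subseteq> {..<rk F' (Suc i)}" "e - \<alpha> i (\<beta> i e) - bd F' i u' \<in> max_free {..<rk F' i}" by blast
      have "e = (e - \<alpha> i (\<beta> i e) - bd F' i u') + (\<alpha> i (\<beta> i e) + bd F' i u')" by simp
      then have "e \<in> max_free {..<rk F' i}"
        using max_free_add[OF u'(2) max_free_add[OF m minD[OF u'(1)]]] by simp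
      then show False unfolding e_def by (rule notE[OF basis_not_max_free])
    qed
    ultimately show "tor_nonzero F i j" unfolding tor_nonzero_def by blast
  qed
qed

section \<open>Projective dimension\<close>

text \<open>
  The identity of \<open>F\<close> is homotopic to a map through the given projective resolution, hence to zero in
  degrees above \<open>p\<close>. A basis element there would be a boundary modulo $\mathfrak{m} F$, but all boundaries
  of a minimal resolution lie in $\mathfrak{m} F$.
\<close>

lemma rank_zero_beyond_projective_length:
  fixes M :: "(('n::finite, 'k::field) mpoly, 'm) module"
  assumes "graded_module M G" "graded_free_resolution M G F" and min: "minimal_resolution F"
    and pd: "has_projective_resolution M p" and i: "p < i"
  shows "rk F i = 0"
proof (rule ccontr)
  assume "rk F i \<noteq> 0"
  interpret A: graded_resolution M G F by unfold_locales fact+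
  obtain P :: "nat \<Rightarrow> (('n, 'k) mpoly, ('n, 'k) fvec) module" and \<epsilon> \<delta>
    where P: "\<And>i. projective (P i)" "exact_resolution M P \<epsilon> \<delta>" "\<And>i. i > p \<Longrightarrow> carrier (P i) = {\<zero>\<^bsub>P i\<^esub>}"
    using pd unfolding has_projective_resolution_def by blast
  note ex = exact_resolutionD[OF P(2)]
  have modP: "module base_ring (P i)" for i using P(1) by (simp add: projective_def)
  have "\<forall>i. \<exists>(B :: ('n, 'k) fvec set) \<iota> \<pi>. \<iota> \<in> mod_hom (P i) (free_module B) \<and> \<pi> \<in> mod_hom (free_module B) (P i) \<and>
      (\<forall>x\<in>carrier (P i). \<pi> (\<iota> x) = x)"
    using P(1) unfolding projective_def by blast
  from choice[OF this] obtain B :: "nat \<Rightarrow> ('n, 'k) fvec set" where "\<forall>i. \<exists>\<iota> \<pi>. \<iota> \<in> mod_hom (P i) (free_module (B i)) \<and>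
      \<pi> \<in> mod_hom (free_module (B i)) (P i) \<and> (\<forall>x\<in>carrier (P i). \<pi> (\<iota> x) = x)" by blast
  from choice[OF this] obtain \<iota> where "\<forall>i. \<exists>\<pi>. \<iota> i \<in> mod_hom (P i) (free_module (B i)) \<and>
      \<pi> \<in> mod_hom (free_module (B i)) (P i) \<and> (\<forall>x\<in>carrier (P i). \<pi> (\<iota> i x) = x)" by blast
  from choice[OF this] obtain \<pi> where "\<forall>i. \<iota> i \<in> mod_hom (P i) (free_module (B i)) \<and>
      \<pi> i \<in> mod_hom (free_module (B i)) (P i) \<and> (\<forall>x\<in>carrier (P i). \<pi> i (\<iota> i x) = x)" by blast
  then have proj: "graded_proj (\<lambda>_. UNIV) (P i) (\<lambda>_. carrier (P i)) (B i) (\<lambda>_. 0) (\<iota> i) (\<pi> i)" for i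
    unfolding graded_proj_def by (auto intro!: mod_homD(1)[of "\<pi> i" "free_module (B i)"])
  have Fc: "carrier (res_mod F i) = {v. keys v \<subseteq> {..<rk F i}}" for i by (simp add: res_mod_def)
  obtain \<alpha> where \<alpha>: "\<And>i. \<alpha> i \<in> mod_hom (res_mod F i) (P i)"
    "\<And>x. x \<in> carrier (res_mod F 0) \<Longrightarrow> \<epsilon> (\<alpha> 0 x) = aug F x"
    "\<And>i x. x \<in> carrier (res_mod F (Suc i)) \<Longrightarrow> \<delta> i (\<alpha> (Suc i) x) = \<alpha> i (bd F i x)"
  proof (rule comparison[OF A.modM A.exact P(2) A.proj_ungraded A.mod_res A.ungraded_target[OF modP]])
    show "bd F i ` carrier (res_mod F (Suc i)) \<subseteq> carrier (res_mod F i)" for i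
      using mod_homD(1)[OF exact_resolutionD(2)[OF A.exact]] by blast
    show "\<exists>y\<in>carrier (P 0). \<epsilon> y = aug F x" if "x \<in> carrier (res_mod F 0)" for x
      using mod_homD(1)[OF exact_resolutionD(1)[OF A.exact] that] ex(3) by (metis imageE)
    show "\<exists>z\<in>carrier (P 1). \<delta> 0 z = y" if "y \<in> carrier (P 0)" "\<epsilon> y = \<zero>\<^bsub>M\<^esub>" for y
      using ex(4) that by (metis (mono_tags, lifting) One_nat_def imageE mem_Collect_eq)
    show "\<exists>z\<in>carrier (P (Suc (Suc i))). \<delta> (Suc i) z = y" if "y \<in> carrier (P (Suc i))" "\<delta> i y = \<zero>\<^bsub>P i\<^esub>" for i y
      using ex(5)[of i] that by (metis (mono_tags, lifting) imageE mem_Collect_eq)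
  qed blast
  obtain \<beta> where \<beta>: "\<And>i. \<beta> i \<in> mod_hom (P i) (res_mod F i)"
    "\<And>x. x \<in> carrier (P 0) \<Longrightarrow> aug F (\<beta> 0 x) = \<epsilon> x"
    "\<And>i x. x \<in> carrier (P (Suc i)) \<Longrightarrow> bd F i (\<beta> (Suc i) x) = \<beta> i (\<delta> i x)"
  proof (rule comparison[OF A.modM P(2) A.exact proj modP A.ungraded_target[OF A.mod_res]])
    show "\<delta> i ` carrier (P (Suc i)) \<subseteq> carrier (P i)" for i
      using mod_homD(1)[OF ex(2)] by blast
    show "\<exists>y\<in>carrier (res_mod F 0). aug F y = \<epsilon> x" if "x \<in> carrier (P 0)" for x
      using mod_homD(1)[OF ex(1) that] exact_resolutionD(3)[OF A.exact] by (metis imageE)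
    show "\<exists>z\<in>carrier (res_mod F 1). bd F 0 z = y" if "y \<in> carrier (res_mod F 0)" "aug F y = \<zero>\<^bsub>M\<^esub>" for y
      using A.exact_bd0[of y] that by (auto simp: Fc)
    show "\<exists>z\<in>carrier (res_mod F (Suc (Suc i))). bd F (Suc i) z = y"
      if "y \<in> carrier (res_mod F (Suc i))" "bd F i y = \<zero>\<^bsub>res_mod F i\<^esub>" for i y
      using A.exact_bd[of y i] that by (auto simp: Fc res_mod_def)
  qed blast
  define e where "e = (single 0 1 :: ('n, 'k) fvec)"
  have e: "keys e \<subseteq> {..<rk F i}" using \<open>rk F i \<noteq> 0\<close> by (simp add: e_def)
  have "\<alpha> i e \<in> carrier (P i)" using mod_homD(1)[OF \<alpha>(1)] e by (simp add: Fc)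
  then have "\<alpha> i e = \<zero>\<^bsub>P i\<^esub>" using P(3)[OF i] by simp
  then have zero: "\<beta> i (\<alpha> i e) = 0"
    using mod_hom_zero[OF \<beta>(1) modP A.mod_res] by (simp add: res_mod_def)
  have \<alpha>c: "\<alpha> i x \<in> carrier (P i)" if "keys x \<subseteq> {..<rk F i}" for i x
    using mod_homD(1)[OF \<alpha>(1)] that by (simp add: Fc)
  have minD: "bd F i v \<in> max_free {..<rk F i}" if "keys v \<subseteq> {..<rk F (Suc i)}" for i v
    using min that by (simp add: minimal_resolution_def)
  have "\<exists>u. keys u \<subseteq> {..<rk F (Suc i)} \<and> e - \<beta> i (\<alpha> i e) - bd F i u \<in> max_free {..<rk F i}"
    by (rule A.roundtrip_mod_max[where \<beta> = "\<lambda>i x. \<beta> i (\<alpha> i x)",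
          OF mod_hom_comp[OF \<alpha>(1) \<beta>(1), unfolded res_mod_def]])
      (use e minD in \<open>simp_all add: \<alpha>(2,3) \<beta>(2,3) \<alpha>c Fc\<close>)
  then obtain u where u: "keys u \<subseteq> {..<rk F (Suc i)}" "e - bd F i u \<in> max_free {..<rk F i}"
    using zero by auto
  have "e \<in> max_free {..<rk F i}" using max_free_add[OF u(2) minD[OF u(1)]] by simp
  then show False unfolding e_def by (rule notE[OF basis_not_max_free])
qed

text \<open>
  \<open>projective\<close> wants a free module whose basis consists of elements of the given module; the standard
  basis vectors serve.
\<close>

lemma projective_free: "projective (free_module {..<r} :: ('r::comm_ring_1, nat \<Rightarrow>\<^sub>0 'r) module)"
proof -
  define b where "b = (\<lambda>l::nat. single l (1::'r))"
  have inj: "inj b" by (auto simp: b_def inj_def) (metis lookup_single_eq lookup_single_not_eq one_neq_zero)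
  define B where "B = b ` {..<r}"
  define \<iota> where "\<iota> = (\<lambda>v :: nat \<Rightarrow>\<^sub>0 'r. \<Sum>l<r. single (b l) (lookup v l))"
  define \<pi> where "\<pi> = (\<lambda>w :: (nat \<Rightarrow>\<^sub>0 'r) \<Rightarrow>\<^sub>0 'r. \<Sum>l<r. single l (lookup w (b l)))"
  have "keys (\<iota> v) \<subseteq> B" for v
    unfolding \<iota>_def by (rule keys_sum_subset) (auto simp: B_def)
  then have \<iota>: "\<iota> \<in> mod_hom (free_module {..<r}) (free_module B)"
    by (intro mod_homI) (simp, simp_all add: \<iota>_def lookup_add single_add sum.distrib scale_sum)
  have "keys (\<pi> w) \<subseteq> {..<r}" for w
    unfolding \<pi>_def by (rule keys_sum_subset) auto
  then have \<pi>: "\<pi> \<in> mod_hom (free_module B) (free_module {..<r})"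
    by (intro mod_homI) (simp, simp_all add: \<pi>_def lookup_add single_add sum.distrib scale_sum)
  have "\<pi> (\<iota> v) = v" if "keys v \<subseteq> {..<r}" for v
  proof -
    have "lookup (\<iota> v) (b l) = lookup v l" if "l < r" for l
    proof -
      have "lookup (\<iota> v) (b l) = (\<Sum>l'<r. if l' = l then lookup v l' else 0)"
        unfolding \<iota>_def lookup_sum
        by (rule sum.cong) (auto simp: lookup_single when_def inj_eq[OF inj])
      then show ?thesis using that by simp
    qed
    then have "\<pi> (\<iota> v) = (\<Sum>l<r. lookup v l \<star> single l 1)" by (simp add: \<pi>_def)
    then show ?thesis using free_expand[of "{..<r}" v] that by simp
  qed
  then show ?thesis
    unfolding projective_def
    using module_free[of "{..<r}"] \<iota> \<pi> by (intro conjI exI[of _ B] bexI[of _ \<iota>] bexI[of _ \<pi>]) auto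
qed

text \<open>
  If $F_i = 0$ then $F_{i+1}$ consists of cycles, hence of boundaries, and equals $\mathfrak{m} F_{i+1}$.
\<close>

lemma minimal_rank_zero_mono:
  fixes M :: "(('n::finite, 'k::field) mpoly, 'm) module"
  assumes "graded_module M G" "graded_free_resolution M G F" and min: "minimal_resolution F"
    and "rk F p = 0" "p \<le> i"
  shows "rk F i = 0"
  using assms(5)
proof (induction i rule: dec_induct)
  case (step i)
  interpret A: graded_resolution M G F by unfold_locales fact+
  show ?case
  proof (rule ccontr)
    assume "rk F (Suc i) \<noteq> 0"
    define e where "e = (single 0 1 :: ('n, 'k) fvec)"
    have e: "keys e \<subseteq> {..<rk F (Suc i)}" using \<open>rk F (Suc i) \<noteq> 0\<close> by (simp add: e_def)
    have "bd F i e = 0"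
      using free_hom_simps(1)[OF A.bd_hom e] step.IH by simp
    then obtain y where "keys y \<subseteq> {..<rk F (Suc (Suc i))}" "bd F (Suc i) y = e"
      using A.exact_bd[OF e] by blast
    then have "e \<in> max_free {..<rk F (Suc i)}"
      using min unfolding minimal_resolution_def by metis
    then show False unfolding e_def by (rule notE[OF basis_not_max_free])
  qed
qed (use assms(4) in simp)

lemma projective_length_of_rank_zero:
  fixes M :: "(('n::finite, 'k::field) mpoly, 'm) module"
  assumes "graded_module M G" "graded_free_resolution M G F" "minimal_resolution F"
    and "rk F (Suc q) = 0"
  shows "has_projective_resolution M q"
  unfolding has_projective_resolution_def
proof (intro exI conjI allI impI)
  show "exact_resolution M (res_mod F) (aug F) (bd F)"
    using assms(2) by (simp add: graded_free_resolution_def)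
  show "projective (res_mod F i)" for i unfolding res_mod_def by (rule projective_free)
  fix i assume "q < i"
  then have "rk F i = 0" using minimal_rank_zero_mono[OF assms] by simp
  then show "carrier (res_mod F i) = {\<zero>\<^bsub>res_mod F i\<^esub>}"
    by (auto simp: res_mod_def)
qed

section \<open>The residue field\<close>

lemma ideal_base_ring_iff:
  "ideal I (base_ring :: 'r::comm_ring_1 ring) \<longleftrightarrow>
     0 \<in> I \<and> (\<forall>x\<in>I. \<forall>y\<in>I. x + y \<in> I) \<and> (\<forall>r. \<forall>x\<in>I. r * x \<in> I)"
proof
  assume I: "ideal I (base_ring :: 'r ring)"
  interpret ideal I "base_ring :: 'r ring" by (rule I)
  show "0 \<in> I \<and> (\<forall>x\<in>I. \<forall>y\<in>I. x + y \<in> I) \<and> (\<forall>r. \<forall>x\<in>I. r * x \<in> I)"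
    using additive_subgroup.zero_closed[OF additive_subgroup_axioms]
      additive_subgroup.a_closed[OF additive_subgroup_axioms] I_l_closed by simp
next
  assume I: "0 \<in> I \<and> (\<forall>x\<in>I. \<forall>y\<in>I. x + y \<in> I) \<and> (\<forall>r. \<forall>x\<in>I. r * x \<in> I)"
  have ring: "ring (base_ring :: 'r ring)" by (rule ring_from_type_algebra)
  interpret ring "base_ring :: 'r ring" by (rule ring)
  show "ideal I (base_ring :: 'r ring)"
  proof (rule idealI[OF ring])
    show "subgroup I (add_monoid (base_ring :: 'r ring))"
    proof
      fix x assume x: "x \<in> I"
      have "\<ominus>\<^bsub>base_ring\<^esub> x = - x" by (rule minus_equality) simp_all
      moreover have "- x \<in> I" using I x by (metis mult_minus1)
      ultimately show "inv\<^bsub>add_monoid (base_ring :: 'r ring)\<^esub> x \<in> I" by (simp add: a_inv_def)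
    qed (use I in simp_all)
    show "x \<otimes>\<^bsub>base_ring\<^esub> a \<in> I" if "a \<in> I" for a x using I that by simp
    then show "a \<otimes>\<^bsub>base_ring\<^esub> x \<in> I" if "a \<in> I" for a x using that by (simp add: mult.commute)
  qed
qed

lemma genideal_least:
  "ideal I (base_ring :: 'r::comm_ring_1 ring) \<Longrightarrow> A \<subseteq> I \<Longrightarrow> genideal base_ring A \<subseteq> I"
  by (auto simp: genideal_def)

lemma genideal_facts:
  fixes A :: "'r::comm_ring_1 set"
  shows "ideal (genideal base_ring A) (base_ring :: 'r ring)" "A \<subseteq> genideal base_ring A"
proof -
  interpret ring "base_ring :: 'r ring" by (rule ring_from_type_algebra)
  show "ideal (genideal base_ring A) (base_ring :: 'r ring)" by (rule genideal_ideal) simp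
  show "A \<subseteq> genideal base_ring A" by (rule genideal_self) simp
qed

text \<open>
  Every monomial other than $1$ is a multiple of a variable.
\<close>

lemma irrelevant_ideal_eq: "irrelevant_ideal = {f :: ('n::finite, 'k::field) mpoly. const_coeff f = 0}"
proof
  have "ideal {f :: ('n, 'k) mpoly. const_coeff f = 0} base_ring"
    by (simp add: ideal_base_ring_iff lookup_add const_coeff_mult)
  moreover have "const_coeff (single (single i 1) 1 :: ('n, 'k) mpoly) = 0" for i
  proof -
    have "single i (1::nat) \<noteq> 0" by (metis lookup_single_eq lookup_zero zero_neq_one)
    then show ?thesis by (simp add: lookup_single)
  qed
  ultimately show "irrelevant_ideal \<subseteq> {f :: ('n, 'k) mpoly. const_coeff f = 0}"
    unfolding irrelevant_ideal_def by (intro genideal_least) auto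
  let ?J = "irrelevant_ideal :: ('n, 'k) mpoly set"
  have J: "0 \<in> ?J" "\<And>x y. x \<in> ?J \<Longrightarrow> y \<in> ?J \<Longrightarrow> x + y \<in> ?J" "\<And>r x. x \<in> ?J \<Longrightarrow> r * x \<in> ?J"
    and var: "\<And>i. single (single i 1) 1 \<in> ?J"
    using genideal_facts[of "range (\<lambda>i::'n. single (single i 1) (1 :: 'k))"]
    unfolding ideal_base_ring_iff irrelevant_ideal_def by blast+
  have mono: "single m c \<in> ?J" if m0: "m \<noteq> 0" for m and c :: 'k
  proof -
    obtain i where i: "lookup m i \<noteq> 0" using m0 by (metis lookup_zero poly_mapping_eqI)
    have m: "m = (m - single i 1) + single i 1"
      by (rule poly_mapping_eqI) (use i in \<open>auto simp: lookup_add lookup_minus lookup_single when_def\<close>)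
    have "single m c = single (m - single i 1) c * single (single i 1) 1"
      unfolding mult_single m[symmetric] by simp
    then show ?thesis using J(3)[OF var] by simp
  qed
  have sum: "(\<Sum>m\<in>A. F m) \<in> ?J" if "\<And>m. m \<in> A \<Longrightarrow> F m \<in> ?J" for A :: "('n \<Rightarrow>\<^sub>0 nat) set" and F
    using that by (induction A rule: infinite_finite_induct) (simp_all add: J)
  show "{f :: ('n, 'k) mpoly. const_coeff f = 0} \<subseteq> ?J"
  proof safe
    fix f :: "('n, 'k) mpoly" assume f: "const_coeff f = 0"
    have "f = (\<Sum>m\<in>keys f. single m (lookup f m))"
      using free_expand[of "keys f" f] by simp
    also have "\<dots> \<in> ?J"
      by (rule sum, rule mono) (use f in \<open>auto simp: in_keys_iff\<close>)
    finally show "f \<in> ?J" .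
  qed
qed

lemma regular_module_simps [simp]:
  "carrier regular_module = UNIV" "zero regular_module = 0" "add regular_module = (+)"
  "module.smult regular_module = (*)"
  by (simp_all add: regular_module_def)

abbreviation rcos :: "'r::comm_ring_1 set \<Rightarrow> 'r \<Rightarrow> 'r set" where
  "rcos I f \<equiv> I +>\<^bsub>regular_module\<^esub> f"

lemma rcos_eq: "rcos I f = {g. g - f \<in> I}"
proof -
  have "rcos I f = {h + f |h. h \<in> I}" by (auto simp: a_r_coset_def')
  also have "\<dots> = {g. g - f \<in> I}" by force
  finally show ?thesis .
qed

lemma quot_ring_module_carrier: "carrier (quot_ring_module I) = range (rcos I)"
  by (auto simp: quot_ring_module_def quot_module_def A_RCOSETS_def')

text \<open>
  The element \<open>c\<close> of \<open>k\<close>, as a coset of the irrelevant ideal.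
\<close>

definition const_class :: "'k \<Rightarrow> ('n::finite, 'k::field) mpoly set" where
  "const_class c = {g. const_coeff g = c}"

lemma rcos_irrelevant: "rcos irrelevant_ideal f = const_class (const_coeff f)"
  by (simp add: rcos_eq irrelevant_ideal_eq const_class_def lookup_minus)

lemma const_class_nonempty: "single 0 c \<in> const_class c"
  by (simp add: const_class_def)

lemma const_class_inj [simp]:
  "(const_class c :: ('n::finite, 'k::field) mpoly set) = const_class d \<longleftrightarrow> c = d"
proof
  assume "(const_class c :: ('n, 'k) mpoly set) = const_class d"
  then have "(single 0 c :: ('n, 'k) mpoly) \<in> const_class d" using const_class_nonempty by blast
  then show "c = d" by (simp add: const_class_def)
qed simp

abbreviation residue_field :: "(('n::finite, 'k::field) mpoly, ('n, 'k) mpoly set) module" where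
  "residue_field \<equiv> quot_ring_module irrelevant_ideal"

lemma residue_field_carrier:
  "carrier residue_field = range (const_class :: 'k \<Rightarrow> ('n::finite, 'k::field) mpoly set)"
proof -
  have "(const_class c :: ('n, 'k) mpoly set) = rcos irrelevant_ideal (single 0 c)" for c
    by (simp add: rcos_irrelevant)
  then have "const_class c \<in> range (rcos (irrelevant_ideal :: ('n, 'k) mpoly set))" for c by (metis rangeI)
  then show ?thesis unfolding quot_ring_module_carrier by (auto simp: rcos_irrelevant)
qed

lemma residue_field_add: "const_class c \<oplus>\<^bsub>residue_field\<^esub> const_class d = const_class (c + d)"
proof -
  have "const_class c \<oplus>\<^bsub>residue_field\<^esub> const_class d = {x + y |x y. x \<in> const_class c \<and> y \<in> const_class d}"
    by (auto simp: quot_ring_module_def quot_module_def set_add_def')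
  also have "\<dots> = const_class (c + d)"
  proof (safe)
    fix g assume "g \<in> const_class (c + d)"
    then have "single 0 c \<in> const_class c" "g - single 0 c \<in> const_class d" "g = single 0 c + (g - single 0 c)"
      by (simp_all add: const_class_def lookup_minus)
    then show "\<exists>x y. g = x + y \<and> x \<in> const_class c \<and> y \<in> const_class d" by blast
  qed (simp add: const_class_def lookup_add)
  finally show ?thesis .
qed

lemma residue_field_smult: "r \<odot>\<^bsub>residue_field\<^esub> const_class c = const_class (const_coeff r * c)"
proof -
  have "r \<odot>\<^bsub>residue_field\<^esub> const_class c = (\<Union>x\<in>const_class c. rcos irrelevant_ideal (r * x))"
    by (simp add: quot_ring_module_def quot_module_def)
  also have "\<dots> = const_class (const_coeff r * c)"
  proof -
    have "rcos irrelevant_ideal (r * x) = const_class (const_coeff r * c)" if "x \<in> const_class c" for x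
      using that by (simp add: rcos_irrelevant const_coeff_mult const_class_def)
    then show ?thesis using const_class_nonempty[of c] by blast
  qed
  finally show ?thesis .
qed

lemma residue_field_grading:
  "C \<in> quot_ring_grading irrelevant_ideal b \<longleftrightarrow> (\<exists>c. C = const_class c \<and> (c = 0 \<or> b = 0))"
  unfolding quot_ring_grading_def
proof
  assume "C \<in> rcos irrelevant_ideal ` homog b"
  then show "\<exists>c. C = const_class c \<and> (c = 0 \<or> b = 0)"
    using const_coeff_homog by (auto simp: rcos_irrelevant)
next
  assume "\<exists>c. C = const_class c \<and> (c = 0 \<or> b = 0)"
  then obtain c where c: "C = const_class c" "c = 0 \<or> b = 0" by blast
  then have "single 0 c \<in> homog b" by auto
  then show "C \<in> rcos irrelevant_ideal ` homog b"
    using c(1) by (intro image_eqI[of _ _ "single 0 c"]) (simp_all add: rcos_irrelevant)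
qed

section \<open>Reduction modulo the irrelevant ideal\<close>

text \<open>
  The coordinates of $v \otimes 1$ in $F \otimes k = k^r$.
\<close>

definition const_vec :: "('b \<Rightarrow>\<^sub>0 ('n::finite, 'k::field) mpoly) \<Rightarrow> 'b \<Rightarrow> 'k" where
  "const_vec v = (\<lambda>b. const_coeff (lookup v b))"

lemma const_vec_simps [simp]: "const_vec (v + w) b = const_vec v b + const_vec w b" "const_vec (v - w) b = const_vec v b - const_vec w b"
  "const_vec (r \<star> v) b = const_coeff r * const_vec v b" "const_vec 0 b = 0"
  by (simp_all add: const_vec_def lookup_add lookup_minus const_coeff_mult)

lemma max_free_iff: "v \<in> max_free B \<longleftrightarrow> keys v \<subseteq> B \<and> const_vec v = (\<lambda>_. 0)"
  by (auto simp: max_free_def const_vec_def fun_eq_iff)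

definition const_lift :: "nat \<Rightarrow> (nat \<Rightarrow> 'k) \<Rightarrow> ('n::finite, 'k::field) fvec" where
  "const_lift r u = (\<Sum>l<r. single l (single 0 (u l)))"

definition kvec :: "nat \<Rightarrow> (nat \<Rightarrow> 'k::zero) set" where
  "kvec r = {u. \<forall>l\<ge>r. u l = 0}"

lemma keys_const_lift: "keys (const_lift r u) \<subseteq> {..<r}"
  unfolding const_lift_def by (rule keys_sum_subset) auto

lemma lookup_const_lift: "lookup (const_lift r u) l = (if l < r then single 0 (u l) else 0)"
proof -
  have "lookup (const_lift r u) l = (\<Sum>l'<r. if l' = l then single 0 (u l') else 0)"
    unfolding const_lift_def lookup_sum by (rule sum.cong) (auto simp: lookup_single when_def)
  then show ?thesis by simp
qed

lemma const_vec_lift: "u \<in> kvec r \<Longrightarrow> const_vec (const_lift r u) = u"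
  by (auto simp: const_vec_def lookup_const_lift kvec_def fun_eq_iff)

lemma const_vec_vec: "keys v \<subseteq> {..<r} \<Longrightarrow> const_vec v \<in> kvec r"
  by (auto simp: kvec_def const_vec_def lookup_outside)

text \<open>
  The map $h \otimes k$ in coordinates.
\<close>

definition reduced_map :: "nat \<Rightarrow> (('n::finite, 'k::field) fvec \<Rightarrow> ('n, 'k) fvec) \<Rightarrow> (nat \<Rightarrow> 'k) \<Rightarrow> nat \<Rightarrow> 'k" where
  "reduced_map r h u = (\<lambda>l. \<Sum>i<r. u i * const_vec (h (single i 1)) l)"

lemma const_vec_hom:
  assumes h: "h \<in> mod_hom (free_module {..<r}) (free_module B)" and v: "keys v \<subseteq> {..<r}"
  shows "const_vec (h v) = reduced_map r h (const_vec v)"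
proof
  fix l
  have "const_vec (h v) l = const_vec (\<Sum>b<r. lookup v b \<star> h (single b 1)) l"
    by (subst free_hom_expand[OF h _ v]) simp_all
  also have "\<dots> = reduced_map r h (const_vec v) l"
    by (simp add: reduced_map_def const_vec_def lookup_sum const_coeff_mult)
  finally show "const_vec (h v) l = reduced_map r h (const_vec v) l" .
qed

section \<open>Tensoring a free module with the residue field\<close>

text \<open>
  The ring acts on vectors over \<open>k\<close> through constant terms. All functions \<open>nat \<Rightarrow> 'k\<close> are admitted, so
  that linear extensions have their values in this module for every rank.
\<close>

definition vec_module :: "(('n::finite, 'k::field) mpoly, nat \<Rightarrow> 'k) module" where
  "vec_module = \<lparr>carrier = UNIV, monoid.mult = undefined, one = undefined,
     zero = (\<lambda>_. 0), add = (\<lambda>u w l. u l + w l), module.smult = (\<lambda>r u l. const_coeff r * u l)\<rparr>"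

lemma vec_module_simps [simp]:
  "carrier vec_module = UNIV" "zero vec_module = (\<lambda>_. 0)" "add vec_module = (\<lambda>u w l. u l + w l)"
  "module.smult vec_module = (\<lambda>r u l. const_coeff r * u l)"
  by (simp_all add: vec_module_def)

lemma module_kvec_module: "module base_ring (vec_module :: (('n::finite, 'k::field) mpoly, nat \<Rightarrow> 'k) module)"
proof (rule moduleI)
  show "abelian_group (vec_module :: (('n, 'k) mpoly, nat \<Rightarrow> 'k) module)"
  proof (rule abelian_groupI)
    fix u :: "nat \<Rightarrow> 'k"
    show "\<exists>w\<in>carrier (vec_module :: (('n, 'k) mpoly, nat \<Rightarrow> 'k) module). w \<oplus>\<^bsub>vec_module :: (('n, 'k) mpoly, nat \<Rightarrow> 'k) module\<^esub> u = \<zero>\<^bsub>vec_module :: (('n, 'k) mpoly, nat \<Rightarrow> 'k) module\<^esub>"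
      by (rule bexI[of _ "\<lambda>l. - u l"]) auto
  qed (auto simp: algebra_simps)
  show "cring (base_ring :: ('n, 'k) mpoly ring)" by (rule cring_from_type_algebra)
qed (auto simp: algebra_simps lookup_add const_coeff_mult)

definition class_val :: "('n::finite, 'k::field) mpoly set \<Rightarrow> 'k" where
  "class_val C = (THE c. C = const_class c)"

lemma class_val_const_class [simp]: "class_val (const_class c) = c"
  by (simp add: class_val_def)

lemma finsum_vec_module:
  "finite A \<Longrightarrow> finsum (vec_module :: (('n::finite, 'k::field) mpoly, nat \<Rightarrow> 'k) module) f A = (\<lambda>l. \<Sum>i\<in>A. f i l)"
proof (induction A rule: finite_induct)
  interpret module base_ring "vec_module :: (('n, 'k) mpoly, nat \<Rightarrow> 'k) module" by (rule module_kvec_module)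
  case empty
  show ?case by simp
  case (insert x F)
  then show ?case by simp
qed

type_synonym ('n, 'k) tensor_pre = "('n, 'k) fvec \<times> ('n, 'k) mpoly set"
type_synonym ('n, 'k) pre_tensor = "('n, 'k) tensor_pre \<Rightarrow>\<^sub>0 ('n, 'k) mpoly"

text \<open>
  The bilinear map that sends $x$ and the class of $c$ to $c$ times the coordinates of $x \otimes 1$,
  extended to the free module of which the tensor product is a quotient.
\<close>

definition tensor_coords :: "('n::finite, 'k::field) pre_tensor \<Rightarrow> nat \<Rightarrow> 'k" where
  "tensor_coords = lin_ext (vec_module :: (('n, 'k) mpoly, nat \<Rightarrow> 'k) module) (\<lambda>q l. class_val (snd q) * const_vec (fst q) l)"

lemma tensor_coords_sum:
  fixes v :: "('n::finite, 'k::field) pre_tensor"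
  assumes "finite A" "keys v \<subseteq> A"
  shows "tensor_coords v l = (\<Sum>q\<in>A. const_coeff (lookup v q) * (class_val (snd q) * const_vec (fst q) l))"
  using lin_ext_superset[OF module_kvec_module assms, of "\<lambda>q l. class_val (snd q) * const_vec (fst q) l"]
  by (simp add: tensor_coords_def finsum_vec_module[OF assms(1)])

lemma tensor_coords_simps [simp]:
  fixes v w :: "('n::finite, 'k::field) pre_tensor"
  shows "tensor_coords (v + w) l = tensor_coords v l + tensor_coords w l" "tensor_coords (s \<star> v) l = const_coeff s * tensor_coords v l"
    "tensor_coords (v - w) l = tensor_coords v l - tensor_coords w l" "tensor_coords (0 :: ('n, 'k) pre_tensor) l = 0"
    "tensor_coords (single (x, const_class c) s :: ('n, 'k) pre_tensor) l = const_coeff s * (c * const_vec x l)"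
proof -
  have hom: "tensor_coords \<in> mod_hom (free_module UNIV) (vec_module :: (('n, 'k) mpoly, nat \<Rightarrow> 'k) module)"
    unfolding tensor_coords_def by (rule lin_ext_hom[OF module_kvec_module]) simp
  show add: "tensor_coords (v + w) l = tensor_coords v l + tensor_coords w l" for v w :: "('n, 'k) pre_tensor"
    using mod_homD(2)[OF hom, of v w] by simp
  show "tensor_coords (s \<star> v) l = const_coeff s * tensor_coords v l" using mod_homD(3)[OF hom, of v s] by simp
  show "tensor_coords (v - w) l = tensor_coords v l - tensor_coords w l" using add[of "v - w" w] by simp
  have "tensor_coords (0 :: ('n, 'k) pre_tensor) l = tensor_coords (0 :: ('n, 'k) pre_tensor) l + tensor_coords (0 :: ('n, 'k) pre_tensor) l"
    using add[of 0 0] unfolding add_0_left .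
  then show "tensor_coords (0 :: ('n, 'k) pre_tensor) l = 0" unfolding add_cancel_right_right .
  show "tensor_coords (single (x, const_class c) s :: ('n, 'k) pre_tensor) l = const_coeff s * (c * const_vec x l)"
    by (subst tensor_coords_sum[of "{(x, const_class c)}"]) simp_all
qed

definition pre_basis :: "nat \<Rightarrow> ('n::finite, 'k::field) tensor_pre set" where
  "pre_basis r = {v. keys v \<subseteq> {..<r}} \<times> range const_class"

lemma carrier_pre_basis: "carrier (free_module {..<r}) \<times> carrier residue_field = pre_basis r"
  by (simp add: pre_basis_def residue_field_carrier)

lemma pre_basis_mem [simp]: "(x, const_class c) \<in> pre_basis r \<longleftrightarrow> keys x \<subseteq> {..<r}"
  by (simp add: pre_basis_def)

lemma pre_basisE:
  assumes "q \<in> pre_basis r"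
  obtains x c where "q = (x, const_class c)" "keys x \<subseteq> {..<r}"
  using assms by (auto simp: pre_basis_def)

lemma tensor_coords_kvec:
  assumes "keys v \<subseteq> pre_basis r"
  shows "tensor_coords v \<in> kvec r"
proof -
  have "tensor_coords v l = 0" if "l \<ge> r" for l
  proof -
    have "const_vec (fst q) l = 0" if q: "q \<in> keys v" for q
    proof -
      obtain x c where "q = (x, const_class c)" "keys x \<subseteq> {..<r}" using assms q by (blast elim: pre_basisE)
      then show ?thesis using const_vec_vec \<open>l \<ge> r\<close> by (auto simp: kvec_def)
    qed
    then show ?thesis by (subst tensor_coords_sum[OF finite_keys order_refl]) simp
  qed
  then show ?thesis by (simp add: kvec_def)
qed

definition ktensor_rels :: "nat \<Rightarrow> ('n::finite, 'k::field) pre_tensor set" where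
  "ktensor_rels r = tensor_rels (free_module {..<r}) residue_field"

definition ktensor_rels_gens :: "nat \<Rightarrow> ('n::finite, 'k::field) pre_tensor set" where
  "ktensor_rels_gens r =
    {single (x + x', y) 1 - single (x, y) 1 - single (x', y) 1 | x x' y.
       keys x \<subseteq> {..<r} \<and> keys x' \<subseteq> {..<r} \<and> y \<in> range const_class}
    \<union> {single (x, y \<oplus>\<^bsub>residue_field\<^esub> y') 1 - single (x, y) 1 - single (x, y') 1 | x y y'.
       keys x \<subseteq> {..<r} \<and> y \<in> range const_class \<and> y' \<in> range const_class}
    \<union> {single (s \<star> x, y) 1 - single (x, y) s | s x y. keys x \<subseteq> {..<r} \<and> y \<in> range const_class}
    \<union> {single (x, s \<odot>\<^bsub>residue_field\<^esub> y) 1 - single (x, y) s | s x y.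
       keys x \<subseteq> {..<r} \<and> y \<in> range const_class}"

lemma ktensor_rels_span: "ktensor_rels r = submodule_span (free_module (pre_basis r)) (ktensor_rels_gens r)"
  unfolding ktensor_rels_def tensor_rels_def ktensor_rels_gens_def residue_field_carrier
  by (simp add: pre_basis_def)

lemma ktensor_rels_gens_subset:
  "ktensor_rels_gens r \<subseteq> {v. keys v \<subseteq> pre_basis r \<and> tensor_coords v = (\<lambda>_. 0)}"
proof
  fix v :: "('n::finite, 'k::field) pre_tensor"
  assume "v \<in> ktensor_rels_gens r"
  then consider
    (1) x x' c where "v = single (x + x', const_class c) 1 - single (x, const_class c) 1 - single (x', const_class c) 1"
       "keys x \<subseteq> {..<r}" "keys x' \<subseteq> {..<r}"
  | (2) x c c' where "v = single (x, const_class (c + c')) 1 - single (x, const_class c) 1 - single (x, const_class c') 1"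
       "keys x \<subseteq> {..<r}"
  | (3) s x c where "v = single (s \<star> x, const_class c) 1 - single (x, const_class c) s" "keys x \<subseteq> {..<r}"
  | (4) s x c where "v = single (x, const_class (const_coeff s * c)) 1 - single (x, const_class c) s" "keys x \<subseteq> {..<r}"
    by (auto simp: ktensor_rels_gens_def residue_field_add residue_field_smult)
  then show "v \<in> {v. keys v \<subseteq> pre_basis r \<and> tensor_coords v = (\<lambda>_. 0)}"
  proof cases
    case 1
    show ?thesis unfolding 1(1) using 1(2-) by (simp add: fun_eq_iff keys_subset_intros algebra_simps)
  next
    case 2
    show ?thesis unfolding 2(1) using 2(2-) by (simp add: fun_eq_iff keys_subset_intros algebra_simps)
  next
    case 3
    show ?thesis unfolding 3(1) using 3(2-) by (simp add: fun_eq_iff keys_subset_intros algebra_simps)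
  next
    case 4
    show ?thesis unfolding 4(1) using 4(2-) by (simp add: fun_eq_iff keys_subset_intros algebra_simps)
  qed
qed

lemma submodule_free_iff:
  fixes N :: "('b \<Rightarrow>\<^sub>0 'r::comm_ring_1) set"
  shows "submodule N base_ring (free_module B) \<longleftrightarrow> submod B N"
proof
  interpret module base_ring "free_module B :: ('r, 'b \<Rightarrow>\<^sub>0 'r) module" by (rule module_free)
  assume N: "submodule N base_ring (free_module B)"
  have sub: "N \<subseteq> {v. keys v \<subseteq> B}" using submoduleE(1)[OF N] by simp
  have "0 \<in> N" using submoduleE(2)[OF N] submoduleE(4)[OF N, of 0] by auto
  then show "submod B N" using submoduleE(4,5)[OF N] sub by (auto simp: submod_def)
next
  assume "submod B N"
  then show "submodule N base_ring (free_module B)"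
    by (intro submodule_base_ringI[OF module_free]) (auto simp: submod_def)
qed

lemma ktensor_rels_submod:
  "submod (pre_basis r) (ktensor_rels r :: ('n::finite, 'k::field) pre_tensor set)"
  "ktensor_rels_gens r \<subseteq> (ktensor_rels r :: ('n, 'k) pre_tensor set)"
  "ktensor_rels r \<subseteq> {v :: ('n, 'k) pre_tensor. keys v \<subseteq> pre_basis r \<and> tensor_coords v = (\<lambda>_. 0)}"
proof -
  let ?K = "{v. keys v \<subseteq> pre_basis r \<and> tensor_coords v = (\<lambda>_. 0)} :: ('n, 'k) pre_tensor set"
  have K: "submod (pre_basis r) ?K"
    by (simp add: submod_def keys_subset_intros fun_eq_iff)
  have span: "ktensor_rels r = (\<Inter>{N. submod (pre_basis r) N \<and> ktensor_rels_gens r \<subseteq> N} :: ('n, 'k) pre_tensor set)"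
    unfolding ktensor_rels_span submodule_span_def submodule_free_iff ..
  have mem: "v \<in> ktensor_rels r \<longleftrightarrow> (\<forall>N. submod (pre_basis r) N \<longrightarrow> ktensor_rels_gens r \<subseteq> N \<longrightarrow> v \<in> N)"
    for v :: "('n, 'k) pre_tensor"
    unfolding span by blast
  show sub: "ktensor_rels r \<subseteq> ?K"
  proof
    fix v :: "('n, 'k) pre_tensor" assume "v \<in> ktensor_rels r"
    then show "v \<in> ?K" unfolding mem using K ktensor_rels_gens_subset by blast
  qed
  show "submod (pre_basis r) (ktensor_rels r :: ('n, 'k) pre_tensor set)"
    unfolding submod_def
  proof (intro conjI ballI allI)
    fix v w :: "('n, 'k) pre_tensor" and s
    assume v: "v \<in> ktensor_rels r"
    then show "keys v \<subseteq> pre_basis r" using sub by blast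
    show "s \<star> v \<in> ktensor_rels r" using v unfolding mem by (simp add: submod_def)
    assume w: "w \<in> ktensor_rels r"
    show "v + w \<in> ktensor_rels r" using v w unfolding mem by (simp add: submod_def)
  next
    show "(0 :: ('n, 'k) pre_tensor) \<in> ktensor_rels r" unfolding mem by (simp add: submod_def)
  qed
  show "ktensor_rels_gens r \<subseteq> (ktensor_rels r :: ('n, 'k) pre_tensor set)"
    using mem by blast
qed

text \<open>
  On the generating relations the coordinates vanish by bilinearity. Conversely, the relations allow
  to rewrite any element as $y \otimes 1$ with a single $y$. If its coordinates vanish, $y = \sum_l y_l e_l$
  with $y_l \in \mathfrak{m}$, and $y_l e_l \otimes 1 = e_l \otimes y_l \cdot 1 = e_l \otimes 0 = 0$.
\<close>

lemma ktensor_rels_eq: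
  "ktensor_rels r = {v :: ('n::finite, 'k::field) pre_tensor. keys v \<subseteq> pre_basis r \<and> tensor_coords v = (\<lambda>_. 0)}"
proof
  let ?R = "ktensor_rels r :: ('n, 'k) pre_tensor set"
  let ?one = "const_class 1 :: ('n, 'k) mpoly set"
  have Rs: "submod (pre_basis r) ?R" by (rule ktensor_rels_submod(1))
  then have R: "0 \<in> ?R" "\<And>v w. v \<in> ?R \<Longrightarrow> w \<in> ?R \<Longrightarrow> v + w \<in> ?R" "\<And>s v. v \<in> ?R \<Longrightarrow> s \<star> v \<in> ?R"
    by (simp_all add: submod_def)
  have R_minus: "v - w \<in> ?R" if "v \<in> ?R" "w \<in> ?R" for v w
    using R(2)[OF that(1) submod_uminus[OF Rs that(2)]] by simp
  have g1: "single (x + x', ?one) 1 - single (x, ?one) 1 - single (x', ?one) 1 \<in> ?R"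
    if "keys x \<subseteq> {..<r}" "keys x' \<subseteq> {..<r}" for x x'
    by (rule subsetD[OF ktensor_rels_submod(2)], unfold ktensor_rels_gens_def, rule UnI1, rule UnI1, rule UnI1,
        rule CollectI, intro exI conjI, rule refl) (use that in simp_all)
  have g3: "single (s \<star> x, ?one) 1 - single (x, ?one) s \<in> ?R" if "keys x \<subseteq> {..<r}" for s x
    by (rule subsetD[OF ktensor_rels_submod(2)], unfold ktensor_rels_gens_def, rule UnI1, rule UnI2,
        rule CollectI, intro exI conjI, rule refl) (use that in simp_all)
  have g4: "single (x, const_class (const_coeff s)) 1 - single (x, ?one) s \<in> ?R" if "keys x \<subseteq> {..<r}" for s x
  proof -
    have "single (x, s \<odot>\<^bsub>residue_field\<^esub> ?one) 1 - single (x, ?one) s \<in> ktensor_rels_gens r"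
      unfolding ktensor_rels_gens_def
      by (rule UnI2, rule CollectI, intro exI conjI, rule refl) (use that in simp_all)
    then have "single (x, s \<odot>\<^bsub>residue_field\<^esub> ?one) 1 - single (x, ?one) s \<in> ?R"
      by (rule subsetD[OF ktensor_rels_submod(2)])
    then show ?thesis by (simp add: residue_field_smult)
  qed
  have zero1: "single (0, ?one) 1 \<in> ?R" using g3[of 0 0] by simp
  have norm: "\<exists>y. keys y \<subseteq> {..<r} \<and> single q s - single (y, ?one) 1 \<in> ?R" if q0: "q \<in> pre_basis r" for q s
  proof -
    obtain x c where q: "q = (x, const_class c)" "keys x \<subseteq> {..<r}" using q0 by (rule pre_basisE)
    define a :: "('n, 'k) mpoly" where "a = single 0 c"
    have "s \<star> (single q 1 - single (x, ?one) a) \<in> ?R" using R(3)[OF g4[OF q(2), of a]] q(1) by (simp add: a_def)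
    then have "single q s - single (x, ?one) (s * a) \<in> ?R" by (simp add: scale_distribs)
    from R_minus[OF this g3[OF q(2), of "s * a"]] have "single q s - single ((s * a) \<star> x, ?one) 1 \<in> ?R" by simp
    then show ?thesis using q(2) keys_scale_subset by blast
  qed
  have red: "\<exists>y. keys y \<subseteq> {..<r} \<and> (\<Sum>q\<in>A. single q (f q)) - single (y, ?one) 1 \<in> ?R"
    if "finite A" "A \<subseteq> pre_basis r" for A f
    using that
  proof (induction A)
    case empty
    have "0 - single (0, ?one) 1 \<in> ?R" by (rule R_minus[OF R(1) zero1])
    then show ?case by (intro exI[of _ 0]) simp
  next
    case (insert q A)
    then obtain y where y: "keys y \<subseteq> {..<r}" "(\<Sum>q\<in>A. single q (f q)) - single (y, ?one) 1 \<in> ?R" by auto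
    obtain y' where y': "keys y' \<subseteq> {..<r}" "single q (f q) - single (y', ?one) 1 \<in> ?R"
      using norm insert.prems by blast
    from R_minus[OF R(2)[OF y(2) y'(2)] g1[OF y(1) y'(1)]]
    have "(\<Sum>q\<in>insert q A. single q (f q)) - single (y + y', ?one) 1 \<in> ?R"
      using insert.hyps by (simp add: algebra_simps)
    then show ?case using y(1) y'(1) keys_add_subset by blast
  qed
  have max: "single (\<Sum>l\<in>A. lookup y l \<star> single l 1, ?one) 1 \<in> ?R"
    if "finite A" "A \<subseteq> {..<r}" and y: "\<And>l. const_coeff (lookup y l) = 0" for A y
    using that(1,2)
  proof (induction A)
    case empty
    then show ?case using zero1 by simp
  next
    case (insert l A)
    let ?e = "single l 1 :: ('n, 'k) fvec"
    let ?S = "\<Sum>l\<in>A. lookup y l \<star> single l 1"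
    have e: "keys ?e \<subseteq> {..<r}" using insert.prems by simp
    have kS: "keys ?S \<subseteq> {..<r}"
      by (rule keys_sum_subset, rule keys_scale_subset) (use insert.prems in auto)
    have k0: "single (?e, const_class 0) 1 \<in> ?R" using g4[OF e, of 0] by simp
    have "single (?e, ?one) (lookup y l) \<in> ?R"
      using R_minus[OF k0 g4[OF e, of "lookup y l"]] y by simp
    from R(2)[OF g3[OF e, of "lookup y l"] this] have le: "single (lookup y l \<star> ?e, ?one) 1 \<in> ?R"
      by (simp only: diff_add_cancel)
    have "single (?S, ?one) 1 \<in> ?R" using insert by simp
    from R(2)[OF R(2)[OF g1[OF keys_scale_subset[OF e, of "lookup y l"] kS] this] le]
    have "single (lookup y l \<star> ?e + ?S, ?one) 1 \<in> ?R" by (simp only: diff_add_cancel)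
    then show ?case using insert.hyps by simp
  qed
  show "{v :: ('n, 'k) pre_tensor. keys v \<subseteq> pre_basis r \<and> tensor_coords v = (\<lambda>_. 0)} \<subseteq> ?R"
  proof safe
    fix v :: "('n, 'k) pre_tensor"
    assume v: "keys v \<subseteq> pre_basis r" "tensor_coords v = (\<lambda>_. 0)"
    have v_eq: "(\<Sum>q\<in>keys v. single q (lookup v q)) = v" using free_expand[of "keys v" v] by simp
    obtain y where "keys y \<subseteq> {..<r}" "(\<Sum>q\<in>keys v. single q (lookup v q)) - single (y, ?one) 1 \<in> ?R"
      using red[OF finite_keys v(1), of "lookup v"] by blast
    then have y: "keys y \<subseteq> {..<r}" "v - single (y, ?one) 1 \<in> ?R" by (simp_all add: v_eq)
    have "tensor_coords (v - single (y, ?one) 1) = (\<lambda>_. 0)" using y(2) ktensor_rels_submod(3) by blast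
    then have "const_vec y l = 0" for l using v(2) by (simp add: fun_eq_iff)
    then have "single (\<Sum>l<r. lookup y l \<star> single l 1, ?one) 1 \<in> ?R"
      by (intro max) (simp_all add: const_vec_def)
    then have "single (y, ?one) 1 \<in> ?R"
      unfolding free_expand[OF finite_lessThan y(1), symmetric] .
    from R(2)[OF y(2) this] show "v \<in> ?R" by (simp only: diff_add_cancel)
  qed
qed (rule ktensor_rels_submod(3))

text \<open>
  The element of $F \otimes k$ with coordinates \<open>u\<close>, as a coset of the relations.
\<close>

definition tensor_class :: "nat \<Rightarrow> (nat \<Rightarrow> 'k) \<Rightarrow> ('n::finite, 'k::field) pre_tensor set" where
  "tensor_class r u = {w. keys w \<subseteq> pre_basis r \<and> tensor_coords w = u}"

lemma ktensor_rels_coset: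
  fixes v :: "('n::finite, 'k::field) pre_tensor"
  assumes "keys v \<subseteq> pre_basis r"
  shows "a_r_coset (free_module B) (ktensor_rels r) v = tensor_class r (tensor_coords v)"
proof
  show "a_r_coset (free_module B) (ktensor_rels r) v \<subseteq> tensor_class r (tensor_coords v)"
  proof
    fix w assume "w \<in> a_r_coset (free_module B) (ktensor_rels r) v"
    then obtain x where "x \<in> ktensor_rels r" "w = x + v" by (auto simp: a_r_coset_def')
    then show "w \<in> tensor_class r (tensor_coords v)"
      using assms by (simp add: ktensor_rels_eq tensor_class_def fun_eq_iff keys_add_subset)
  qed
  show "tensor_class r (tensor_coords v) \<subseteq> a_r_coset (free_module B) (ktensor_rels r) v"
  proof
    fix w :: "('n, 'k) pre_tensor" assume "w \<in> tensor_class r (tensor_coords v)"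
    then have "w - v \<in> ktensor_rels r" using assms by (simp add: tensor_class_def ktensor_rels_eq keys_minus_subset fun_eq_iff)
    moreover have "w = (w - v) + v" by simp
    ultimately show "w \<in> a_r_coset (free_module B) (ktensor_rels r) v" unfolding a_r_coset_def' by force
  qed
qed

lemma tensor_class_witness:
  assumes "u \<in> kvec r"
  shows "single (const_lift r u, const_class 1) 1 \<in> (tensor_class r u :: ('n::finite, 'k::field) pre_tensor set)"
  using assms keys_const_lift by (auto simp: tensor_class_def const_vec_lift fun_eq_iff)

lemma tensor_class_inj [simp]:
  assumes "u \<in> kvec r" "u' \<in> kvec r"
  shows "(tensor_class r u :: ('n::finite, 'k::field) pre_tensor set) = tensor_class r u' \<longleftrightarrow> u = u'"
proof
  assume "(tensor_class r u :: ('n, 'k) pre_tensor set) = tensor_class r u'"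
  then have "(single (const_lift r u, const_class 1) 1 :: ('n, 'k) pre_tensor) \<in> tensor_class r u'"
    using tensor_class_witness[OF assms(1)] by blast
  then show "u = u'" using assms(1) by (simp add: tensor_class_def const_vec_lift fun_eq_iff)
qed simp

lemma kvec_add: "u \<in> kvec r \<Longrightarrow> w \<in> kvec r \<Longrightarrow> (\<lambda>l. u l + w l) \<in> kvec r" for u :: "nat \<Rightarrow> 'k::field"
  by (simp add: kvec_def)

lemma kvec_uminus: "u \<in> kvec r \<Longrightarrow> (\<lambda>l. - u l) \<in> kvec r" for u :: "nat \<Rightarrow> 'k::field"
  by (simp add: kvec_def)

lemma kvec_zero: "(\<lambda>_. 0) \<in> kvec r"
  by (simp add: kvec_def)

abbreviation ktensor ::
  "nat \<Rightarrow> (('n::finite, 'k::field) mpoly, ('n, 'k) pre_tensor set) module" where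
  "ktensor r \<equiv> tensor (free_module {..<r}) residue_field"

lemma ktensor_eq:
  "(ktensor r :: (('n::finite, 'k::field) mpoly, _) module) = quot_module (free_module (pre_basis r)) (ktensor_rels r)"
  by (simp only: tensor_def carrier_pre_basis ktensor_rels_def)

lemma ktensor_carrier: "carrier (ktensor r :: (('n::finite, 'k::field) mpoly, _) module) = tensor_class r ` kvec r"
proof -
  have "carrier (ktensor r :: (('n, 'k) mpoly, _) module) =
      (\<lambda>v. a_r_coset (free_module (pre_basis r)) (ktensor_rels r) v) ` {v. keys v \<subseteq> pre_basis r}"
    unfolding ktensor_eq quot_module_def by (auto simp: A_RCOSETS_def')
  also have "\<dots> = (\<lambda>v :: ('n, 'k) pre_tensor. tensor_class r (tensor_coords v)) ` {v. keys v \<subseteq> pre_basis r}"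
    by (rule image_cong) (simp_all add: ktensor_rels_coset)
  also have "\<dots> = tensor_class r ` kvec r"
  proof (intro equalityI subsetI)
    fix C :: "('n, 'k) pre_tensor set" assume "C \<in> tensor_class r ` kvec r"
    then obtain u where u: "u \<in> kvec r" "C = tensor_class r u" by blast
    have "single (const_lift r u, const_class 1) 1 \<in> C" unfolding u(2) by (rule tensor_class_witness[OF u(1)])
    then have "keys (single (const_lift r u, const_class 1) 1 :: ('n, 'k) pre_tensor) \<subseteq> pre_basis r"
       "tensor_coords (single (const_lift r u, const_class 1) 1 :: ('n, 'k) pre_tensor) = u"
      unfolding u(2) tensor_class_def by blast+
    then show "C \<in> (\<lambda>v :: ('n, 'k) pre_tensor. tensor_class r (tensor_coords v)) ` {v. keys v \<subseteq> pre_basis r}"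
      by (intro image_eqI[of _ _ "single (const_lift r u, const_class 1) 1"]) (simp_all add: u(2))
  qed (auto intro: tensor_coords_kvec)
  finally show ?thesis .
qed

lemma ktensor_zero: "\<zero>\<^bsub>ktensor r :: (('n::finite, 'k::field) mpoly, _) module\<^esub> = tensor_class r (\<lambda>_. 0)"
  by (simp add: ktensor_eq quot_module_def ktensor_rels_eq tensor_class_def)

lemma ktensor_add:
  assumes "u \<in> kvec r" "w \<in> kvec r"
  shows "tensor_class r u \<oplus>\<^bsub>ktensor r :: (('n::finite, 'k::field) mpoly, _) module\<^esub> tensor_class r w = tensor_class r (\<lambda>l. u l + w l)"
proof -
  let ?x = "single (const_lift r u, const_class 1) 1 :: ('n, 'k) pre_tensor"
  have x: "?x \<in> tensor_class r u" by (rule tensor_class_witness[OF assms(1)])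
  have "tensor_class r u \<oplus>\<^bsub>ktensor r :: (('n, 'k) mpoly, _) module\<^esub> tensor_class r w = {x + y |x y. x \<in> tensor_class r u \<and> y \<in> tensor_class r w}"
    unfolding ktensor_eq quot_module_def by (auto simp: set_add_def')
  also have "\<dots> = tensor_class r (\<lambda>l. u l + w l)"
  proof (intro equalityI subsetI)
    fix z :: "('n, 'k) pre_tensor"
    assume "z \<in> {x + y |x y. x \<in> tensor_class r u \<and> y \<in> tensor_class r w}"
    then obtain x y where "z = x + y" "x \<in> tensor_class r u" "y \<in> tensor_class r w" by blast
    then show "z \<in> tensor_class r (\<lambda>l. u l + w l)" by (auto simp: tensor_class_def fun_eq_iff keys_add_subset simp del: subsetI)
  next
    fix z :: "('n, 'k) pre_tensor"
    assume "z \<in> tensor_class r (\<lambda>l. u l + w l)"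
    then have "z - ?x \<in> tensor_class r w" using x by (simp add: tensor_class_def keys_minus_subset fun_eq_iff)
    moreover have "z = ?x + (z - ?x)" by simp
    ultimately show "z \<in> {x + y |x y. x \<in> tensor_class r u \<and> y \<in> tensor_class r w}" using x by blast
  qed
  finally show ?thesis .
qed

lemma ktensor_inv:
  assumes "u \<in> kvec r"
  shows "inv\<^bsub>add_monoid (ktensor r :: (('n::finite, 'k::field) mpoly, _) module)\<^esub> (tensor_class r u) = tensor_class r (\<lambda>l. - u l)"
  unfolding m_inv_def
proof (rule the_equality)
  show "tensor_class r (\<lambda>l. - u l) \<in> carrier (add_monoid (ktensor r :: (('n, 'k) mpoly, _) module)) \<and>
    tensor_class r u \<otimes>\<^bsub>add_monoid (ktensor r)\<^esub> tensor_class r (\<lambda>l. - u l) = \<one>\<^bsub>add_monoid (ktensor r)\<^esub> \<and>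
    tensor_class r (\<lambda>l. - u l) \<otimes>\<^bsub>add_monoid (ktensor r)\<^esub> tensor_class r u = \<one>\<^bsub>add_monoid (ktensor r)\<^esub>"
    using assms by (simp add: ktensor_carrier ktensor_zero ktensor_add kvec_uminus)
  fix C :: "('n, 'k) pre_tensor set"
  assume C: "C \<in> carrier (add_monoid (ktensor r)) \<and>
    tensor_class r u \<otimes>\<^bsub>add_monoid (ktensor r)\<^esub> C = \<one>\<^bsub>add_monoid (ktensor r)\<^esub> \<and>
    C \<otimes>\<^bsub>add_monoid (ktensor r)\<^esub> tensor_class r u = \<one>\<^bsub>add_monoid (ktensor r)\<^esub>"
  then obtain w where w: "w \<in> kvec r" "C = tensor_class r w" by (auto simp: ktensor_carrier)
  have "(tensor_class r (\<lambda>l. u l + w l) :: ('n, 'k) pre_tensor set) = tensor_class r (\<lambda>_. 0)"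
    using C w(2) by (simp add: ktensor_zero ktensor_add[OF assms w(1)])
  then have "(\<lambda>l. u l + w l) = (\<lambda>_. 0)"
    by (simp only: tensor_class_inj[OF kvec_add[OF assms w(1)] kvec_zero])
  then have "w = (\<lambda>l. - u l)" by (auto simp: fun_eq_iff add_eq_0_iff)
  then show "C = tensor_class r (\<lambda>l. - u l)" using w(2) by simp
qed

lemma pure_tensor_eq:
  fixes x :: "('n::finite, 'k::field) fvec"
  assumes "keys x \<subseteq> {..<r}"
  shows "pure_tensor (free_module {..<r}) residue_field x (const_class c) = tensor_class r (\<lambda>l. c * const_vec x l)"
proof -
  let ?v = "single (x, const_class c) 1 :: ('n, 'k) pre_tensor"
  have "pure_tensor (free_module {..<r}) residue_field x (const_class c) = tensor_class r (tensor_coords ?v)"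
    unfolding pure_tensor_def ktensor_rels_def[symmetric] carrier_pre_basis
    by (rule ktensor_rels_coset) (use assms in simp)
  also have "tensor_coords ?v = (\<lambda>l. c * const_vec x l)" by (simp add: fun_eq_iff)
  finally show ?thesis .
qed

lemma reduced_map_vec:
  assumes "h \<in> mod_hom (free_module {..<r'}) (free_module {..<r})"
  shows "reduced_map r' h u \<in> kvec r"
proof -
  have "const_vec (h (single i 1)) l = 0" if "i < r'" "l \<ge> r" for i l
  proof -
    have "keys (h (single i 1)) \<subseteq> {..<r}" by (rule free_hom_simps(1)[OF assms]) (use that in simp)
    then show ?thesis using const_vec_vec that(2) by (auto simp: kvec_def)
  qed
  then show ?thesis by (simp add: kvec_def reduced_map_def)
qed

lemma tensor_map_eq:
  fixes h :: "('n::finite, 'k::field) fvec \<Rightarrow> ('n, 'k) fvec"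
  assumes h: "h \<in> mod_hom (free_module {..<r'}) (free_module {..<r})" and u: "u \<in> kvec r'"
  shows "tensor_map (free_module {..<r}) residue_field h (tensor_class r' u) = tensor_class r (reduced_map r' h u)"
proof -
  define S where "S = (\<lambda>v :: ('n, 'k) pre_tensor.
    (\<Sum>q\<in>keys v. single (h (fst q), snd q) (lookup v q)))"
  have S: "a_r_coset (free_module (pre_basis r)) (ktensor_rels r) (S v) = tensor_class r (reduced_map r' h u)" if "v \<in> tensor_class r' u" for v
  proof -
    have v: "keys v \<subseteq> pre_basis r'" "tensor_coords v = u" using that by (simp_all add: tensor_class_def)
    have q: "keys (single (h (fst q), snd q) s :: ('n, 'k) pre_tensor) \<subseteq> pre_basis r \<and>
        tensor_coords (single (h (fst q), snd q) s :: ('n, 'k) pre_tensor) l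
          = const_coeff s * (class_val (snd q) * (\<Sum>i<r'. const_vec (fst q) i * const_vec (h (single i 1)) l))"
      if q': "q \<in> keys v" for q s l
    proof -
      have "q \<in> pre_basis r'" using v(1) q' by blast
      then obtain x c where q: "q = (x, const_class c)" "keys x \<subseteq> {..<r'}" by (rule pre_basisE)
      have "const_vec (h x) l = (\<Sum>i<r'. const_vec x i * const_vec (h (single i 1)) l)"
        unfolding const_vec_hom[OF h q(2)] reduced_map_def ..
      then show ?thesis using q free_hom_simps(1)[OF h q(2)] by simp
    qed
    have kS: "keys (S v) \<subseteq> pre_basis r" unfolding S_def by (rule keys_sum_subset) (use q in blast)
    have sum: "tensor_coords (\<Sum>q\<in>A. f q) l = (\<Sum>q\<in>A. tensor_coords (f q) l)" if "finite A" for A l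
      and f :: "('n, 'k) tensor_pre \<Rightarrow> ('n, 'k) pre_tensor"
      using that by (induction A) simp_all
    have "tensor_coords (S v) l = reduced_map r' h u l" for l
    proof -
      have "tensor_coords (S v) l = (\<Sum>q\<in>keys v. const_coeff (lookup v q) * (class_val (snd q) * (\<Sum>i<r'. const_vec (fst q) i * const_vec (h (single i 1)) l)))"
        unfolding S_def sum[OF finite_keys] by (rule sum.cong) (use q in auto)
      also have "\<dots> = (\<Sum>q\<in>keys v. \<Sum>i<r'. const_coeff (lookup v q) * (class_val (snd q) * const_vec (fst q) i) * const_vec (h (single i 1)) l)"
        by (simp add: sum_distrib_left mult.assoc)
      also have "\<dots> = (\<Sum>i<r'. \<Sum>q\<in>keys v. const_coeff (lookup v q) * (class_val (snd q) * const_vec (fst q) i) * const_vec (h (single i 1)) l)"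
        by (rule sum.swap)
      also have "\<dots> = (\<Sum>i<r'. tensor_coords v i * const_vec (h (single i 1)) l)"
        by (simp add: tensor_coords_sum[OF finite_keys order_refl] sum_distrib_right)
      finally show ?thesis by (simp add: reduced_map_def v(2))
    qed
    then have "tensor_coords (S v) = reduced_map r' h u" by blast
    then show ?thesis using ktensor_rels_coset[OF kS] by simp
  qed
  have "tensor_map (free_module {..<r}) residue_field h (tensor_class r' u) =
      (\<Union>v\<in>tensor_class r' u. a_r_coset (free_module (pre_basis r)) (ktensor_rels r) (S v))"
    unfolding tensor_map_def ktensor_rels_def[symmetric] carrier_pre_basis S_def ..
  also have "\<dots> = (\<Union>v\<in>(tensor_class r' u :: ('n, 'k) pre_tensor set). tensor_class r (reduced_map r' h u))" using S by simp
  also have "\<dots> = tensor_class r (reduced_map r' h u)" using tensor_class_witness[OF u] by blast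
  finally show ?thesis .
qed

text \<open>
  The residue field lives in degree \<open>0\<close>, so $x \otimes c$ with $c \neq 0$ has the degree of $x$.
\<close>

lemma tensor_grading_eq:
  "tensor_grading (free_module {..<r}) (gfree {..<r} a) (residue_field :: (('n::finite, 'k::field) mpoly, _) module)
      (quot_ring_grading irrelevant_ideal) j = tensor_class r ` {u \<in> kvec r. \<forall>l. u l \<noteq> 0 \<longrightarrow> a l = j}"
  (is "?L = tensor_class r ` ?V")
proof (intro equalityI subsetI)
  have V: "\<And>u w. u \<in> ?V \<Longrightarrow> w \<in> ?V \<Longrightarrow> (\<lambda>l. u l + w l) \<in> ?V" "\<And>u. u \<in> ?V \<Longrightarrow> (\<lambda>l. - u l) \<in> ?V"
    by (auto simp: kvec_def) (metis add.right_neutral)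
  fix C assume "C \<in> ?L"
  then show "C \<in> tensor_class r ` ?V"
    unfolding tensor_grading_def
  proof (induction C rule: generate.induct)
    case one
    show ?case by (rule image_eqI[of _ _ "\<lambda>_. 0"]) (simp_all add: ktensor_zero kvec_zero)
  next
    have gen: "h \<in> tensor_class r ` ?V" if hgen: "h \<in> {pure_tensor (free_module {..<r}) residue_field x y |x y i b.
        x \<in> gfree {..<r} a i \<and> y \<in> quot_ring_grading irrelevant_ideal b \<and> i + b = j}"
      for h :: "('n, 'k) pre_tensor set"
    proof -
      obtain x c i b where h: "h = pure_tensor (free_module {..<r}) residue_field x (const_class c)"
        "x \<in> gfree {..<r} a i" "c = 0 \<or> b = 0" "i + b = j"
        using hgen unfolding residue_field_grading by blast
      have h': "h = tensor_class r (\<lambda>l. c * const_vec x l)" using h(1) pure_tensor_eq[OF gfreeD(1)[OF h(2)]] by simp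
      have "(\<lambda>l. c * const_vec x l) \<in> ?V"
      proof safe
        show "(\<lambda>l. c * const_vec x l) \<in> kvec r" using const_vec_vec[OF gfreeD(1)[OF h(2)]] by (simp add: kvec_def)
        fix l assume "c * const_vec x l \<noteq> 0"
        then have "i = j" "const_coeff (lookup x l) \<noteq> 0" using h(3,4) by (auto simp: const_vec_def)
        then show "a l = j" using const_coeff_homog[OF gfreeD(2)[OF h(2), of l]] by force
      qed
      then show ?thesis using h' by blast
    qed
    {
      case (incl h)
      then show ?case by (rule gen)
    next
      case (inv h)
      then obtain u where u: "u \<in> ?V" "h = tensor_class r u" using gen by blast
      then have "inv\<^bsub>add_monoid (ktensor r)\<^esub> h = tensor_class r (\<lambda>l. - u l)" using ktensor_inv by auto
      then show ?case using V(2)[OF u(1)] by blast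
    }
  next
    case (eng h1 h2)
    then obtain u w where uw: "u \<in> ?V" "w \<in> ?V" "h1 = tensor_class r u" "h2 = tensor_class r w" by blast
    then have "h1 \<otimes>\<^bsub>add_monoid (ktensor r)\<^esub> h2 = tensor_class r (\<lambda>l. u l + w l)" by (simp add: ktensor_add)
    then show ?case using V(1)[OF uw(1,2)] by blast
  qed
next
  fix C :: "('n, 'k) pre_tensor set" assume "C \<in> tensor_class r ` ?V"
  then obtain u where u: "u \<in> kvec r" "\<And>l. u l \<noteq> 0 \<Longrightarrow> a l = j" "C = tensor_class r u" by blast
  have gr: "(const_lift r u :: ('n, 'k) fvec) \<in> gfree {..<r} a j"
    unfolding gfree_def mem_Collect_eq
  proof (intro conjI ballI)
    show "keys (const_lift r u) \<subseteq> {..<r}" by (rule keys_const_lift)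
    fix l assume "l \<in> {..<r}"
    then have "lookup (const_lift r u :: ('n, 'k) fvec) l = single 0 (u l)" by (simp add: lookup_const_lift)
    then show "lookup (const_lift r u :: ('n, 'k) fvec) l \<in> homog (j - a l)"
      using u(2)[of l] by (cases "u l = 0") simp_all
  qed
  have "C = pure_tensor (free_module {..<r}) residue_field (const_lift r u) (const_class 1)"
    by (simp add: pure_tensor_eq[OF keys_const_lift] const_vec_lift u)
  moreover have "(const_class 1 :: ('n, 'k) mpoly set) \<in> quot_ring_grading irrelevant_ideal 0"
    unfolding residue_field_grading by blast
  ultimately show "C \<in> ?L"
    unfolding tensor_grading_def using gr by (intro generate.incl CollectI exI conjI) auto
qed

section \<open>The degrees of Tor\<close>

text \<open>
  In coordinates, the cycles, boundaries and homogeneous elements of $F \otimes k$ are subspaces \<open>Cy\<close>,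
  \<open>Bd\<close> and \<open>?V\<close> of $k^r$, and the component of Tor vanishes iff all homogeneous cycles are boundaries.
  The maps \<open>const_vec\<close> and \<open>const_lift\<close> translate between these vectors and elements of \<open>F\<close> modulo
  $\mathfrak{m} F$.
\<close>

lemma homology_grading_nonzero_iff:
  fixes M :: "(('n::finite, 'k::field) mpoly, 'm) module"
  assumes "graded_module M G" "graded_free_resolution M G F"
  shows "homology_grading F i j \<noteq> {\<zero>\<^bsub>homology_module F i\<^esub>} \<longleftrightarrow> tor_nonzero F i j"
proof -
  interpret A: graded_resolution M G F by unfold_locales fact+
  let ?T = "\<lambda>i. tensor_class (rk F i) :: (nat \<Rightarrow> 'k) \<Rightarrow> ('n, 'k) pre_tensor set"
  let ?d = "\<lambda>i. reduced_map (rk F (Suc i)) (bd F i)"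
  let ?cos = "\<lambda>u. a_r_coset ((res_tensor F i)\<lparr>carrier := cycles F i\<rparr>) (boundaries F i) (?T i u)"
  have rt: "res_tensor F i = ktensor (rk F i)" for i by (simp add: res_tensor_def res_mod_def)
  have bd: "res_tensor_bd F i (?T (Suc i) u) = ?T i (?d i u)" if "u \<in> kvec (rk F (Suc i))" for i u
    unfolding res_tensor_bd_def res_mod_def by (rule tensor_map_eq[OF A.bd_hom that])
  have dv: "?d i u \<in> kvec (rk F i)" for i u by (rule reduced_map_vec[OF A.bd_hom])
  have dadd: "?d i (\<lambda>l. u l + w l) = (\<lambda>l. ?d i u l + ?d i w l)" for i u w
    by (simp add: reduced_map_def fun_eq_iff distrib_right sum.distrib)
  have dminus: "?d i (\<lambda>l. u l - w l) = (\<lambda>l. ?d i u l - ?d i w l)" for i u w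
    by (simp add: reduced_map_def fun_eq_iff left_diff_distrib sum_subtractf)
  have d0: "?d i (\<lambda>_. 0) = (\<lambda>_. 0)" for i by (simp add: reduced_map_def)
  define Bd where "Bd = (\<lambda>i. ?d i ` kvec (rk F (Suc i)))"
  have bdry: "boundaries F i = ?T i ` Bd i" for i
    unfolding boundaries_def rt ktensor_carrier Bd_def image_image by (rule image_cong) (simp_all add: bd)
  define Cy where "Cy = (\<lambda>i. {u \<in> kvec (rk F i). \<forall>i'. i = Suc i' \<longrightarrow> ?d i' u = (\<lambda>_. 0)})"
  have cyc: "cycles F i = ?T i ` Cy i" for i
  proof (cases i)
    case 0
    then show ?thesis by (simp add: cycles_def rt ktensor_carrier Cy_def)
  next
    case (Suc i')
    have "cycles F i = {C \<in> ?T i ` kvec (rk F i). res_tensor_bd F i' C = ?T i' (\<lambda>_. 0)}"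
      unfolding Suc cycles_def nat.case a_kernel_eq rt ktensor_carrier ktensor_zero ..
    also have "\<dots> = ?T i ` Cy i"
      using Suc bd dv by (auto simp: Cy_def tensor_class_inj[OF dv kvec_zero])
    finally show ?thesis .
  qed
  have gr: "tensor_grading (res_mod F i) (res_grading F i) residue_field (quot_ring_grading irrelevant_ideal) j =
      ?T i ` {u \<in> kvec (rk F i). \<forall>l. u l \<noteq> 0 \<longrightarrow> shift F i l = j}" (is "_ = _ ` ?V")
    unfolding res_mod_def res_grading_eq[abs_def] by (rule tensor_grading_eq)
  have coset: "?cos u
      = ?T i ` {w. \<exists>b\<in>Bd i. w = (\<lambda>l. b l + u l)}" if "u \<in> kvec (rk F i)" for u
  proof -
    have "?cos u
      = (\<lambda>b. ?T i b \<oplus>\<^bsub>ktensor (rk F i)\<^esub> ?T i u) ` Bd i"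
      unfolding a_r_coset_def' bdry rt by auto
    also have "\<dots> = (\<lambda>b. ?T i (\<lambda>l. b l + u l)) ` Bd i"
      by (rule image_cong[OF refl], rule ktensor_add[OF _ that]) (use dv in \<open>auto simp: Bd_def\<close>)
    finally show ?thesis by blast
  qed
  have Bdv: "Bd i \<subseteq> kvec (rk F i)" using dv by (auto simp: Bd_def)
  have coset_eq: "?cos u = boundaries F i
      \<longleftrightarrow> u \<in> Bd i" if u: "u \<in> kvec (rk F i)" for u
  proof
    assume eq: "?cos u = boundaries F i"
    have "(\<lambda>_. 0) \<in> Bd i" unfolding Bd_def by (rule image_eqI[of _ _ "\<lambda>_. 0"]) (simp_all add: d0 kvec_zero)
    then have "?T i u \<in> ?T i ` {w. \<exists>b\<in>Bd i. w = (\<lambda>l. b l + u l)}" by force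
    then have "?T i u \<in> boundaries F i" using eq coset[OF u] by simp
    then obtain b where b: "b \<in> Bd i" "?T i u = ?T i b" unfolding bdry by blast
    then show "u \<in> Bd i" using tensor_class_inj[OF u, of b] Bdv by blast
  next
    assume "u \<in> Bd i"
    then obtain x where x: "x \<in> kvec (rk F (Suc i))" "u = ?d i x" by (auto simp: Bd_def)
    have "{w. \<exists>b\<in>Bd i. w = (\<lambda>l. b l + u l)} = Bd i"
    proof (intro equalityI subsetI)
      fix w assume "w \<in> {w. \<exists>b\<in>Bd i. w = (\<lambda>l. b l + u l)}"
      then obtain y where "y \<in> kvec (rk F (Suc i))" "w = (\<lambda>l. ?d i y l + ?d i x l)" using x by (auto simp: Bd_def)
      then show "w \<in> Bd i" unfolding Bd_def dadd[symmetric] using kvec_add[OF _ x(1)] by blast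
    next
      fix w assume "w \<in> Bd i"
      then obtain y where y: "y \<in> kvec (rk F (Suc i))" "w = ?d i y" by (auto simp: Bd_def)
      have "(\<lambda>l. y l - x l) \<in> kvec (rk F (Suc i))" using x(1) y(1) by (simp add: kvec_def)
      moreover have "w = (\<lambda>l. ?d i (\<lambda>l. y l - x l) l + u l)" by (simp add: dminus x(2) y(2))
      ultimately show "w \<in> {w. \<exists>b\<in>Bd i. w = (\<lambda>l. b l + u l)}" by (auto simp: Bd_def)
    qed
    then have "?T i ` {w. \<exists>b\<in>Bd i. w = (\<lambda>l. b l + u l)} = boundaries F i" by (simp only: bdry)
    then show "?cos u = boundaries F i"
      by (rule trans[OF coset[OF u]])
  qed
  have zero: "\<zero>\<^bsub>homology_module F i\<^esub> = boundaries F i" by (simp add: homology_module_def quot_module_def)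
  let ?W = "{u \<in> Cy i. \<forall>l. u l \<noteq> 0 \<longrightarrow> shift F i l = j}"
  have inter: "?T i ` Cy i \<inter> ?T i ` ?V = ?T i ` ?W"
  proof (intro equalityI subsetI)
    fix C assume "C \<in> ?T i ` Cy i \<inter> ?T i ` ?V"
    then obtain u w where "C = ?T i u" "u \<in> Cy i" "C = ?T i w" "w \<in> ?V" by blast
    moreover from this have "u = w" using tensor_class_inj[of u "rk F i" w] by (auto simp: Cy_def)
    ultimately show "C \<in> ?T i ` ?W" by blast
  next
    fix C assume "C \<in> ?T i ` ?W"
    then show "C \<in> ?T i ` Cy i \<inter> ?T i ` ?V" by (auto simp: Cy_def)
  qed
  have hg: "homology_grading F i j =
      (\<lambda>u. ?cos u) ` ?W"
    unfolding homology_grading_def gr cyc[of i] inter image_image by (simp add: cyc)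
  have W0: "(\<lambda>_. 0) \<in> ?W" by (simp add: Cy_def kvec_zero d0)
  have Wv: "u \<in> kvec (rk F i)" if "u \<in> ?W" for u using that by (simp add: Cy_def)
  have "homology_grading F i j \<noteq> {\<zero>\<^bsub>homology_module F i\<^esub>} \<longleftrightarrow> (\<exists>u\<in>?W. u \<notin> Bd i)"
  proof
    assume ne: "homology_grading F i j \<noteq> {\<zero>\<^bsub>homology_module F i\<^esub>}"
    show "\<exists>u\<in>?W. u \<notin> Bd i"
    proof (rule ccontr)
      assume "\<not> ?thesis"
      then have "\<And>u. u \<in> ?W \<Longrightarrow> ?cos u = boundaries F i"
        using coset_eq Wv by blast
      then have "homology_grading F i j = {boundaries F i}" unfolding hg using W0 by auto
      then show False using ne zero by simp
    qed
  next
    assume "\<exists>u\<in>?W. u \<notin> Bd i"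
    then obtain u where u: "u \<in> ?W" "u \<notin> Bd i" by blast
    then have "?cos u \<noteq> boundaries F i"
      using coset_eq[OF Wv[OF u(1)]] by blast
    then show "homology_grading F i j \<noteq> {\<zero>\<^bsub>homology_module F i\<^esub>}" unfolding hg zero using u(1) by blast
  qed
  also have "\<dots> \<longleftrightarrow> tor_nonzero F i j"
  proof
    assume "\<exists>u\<in>?W. u \<notin> Bd i"
    then obtain u where u: "u \<in> ?W" "u \<notin> Bd i" by blast
    let ?w = "const_lift (rk F i) u :: ('n, 'k) fvec"
    have cw: "const_vec ?w = u" by (rule const_vec_lift[OF Wv[OF u(1)]])
    have kw: "keys ?w \<subseteq> {..<rk F i}" by (rule keys_const_lift)
    have "?w \<in> gfree {..<rk F i} (shift F i) j"
      unfolding gfree_def mem_Collect_eq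
    proof (intro conjI ballI)
      fix l assume "l \<in> {..<rk F i}"
      then have "lookup ?w l = single 0 (u l)" by (simp add: lookup_const_lift)
      then show "lookup ?w l \<in> homog (j - shift F i l)"
        using u(1) by (cases "u l = 0") simp_all
    qed (rule kw)
    moreover have "bd F i' ?w \<in> max_free {..<rk F i'}" if "i = Suc i'" for i'
      using that u(1) kw const_vec_hom[OF A.bd_hom, of ?w i'] free_hom_simps(1)[OF A.bd_hom, of ?w i'] cw
      by (simp add: max_free_iff Cy_def)
    moreover have "?w - bd F i x \<notin> max_free {..<rk F i}" if x: "keys x \<subseteq> {..<rk F (Suc i)}" for x
    proof
      assume "?w - bd F i x \<in> max_free {..<rk F i}"
      then have "u = ?d i (const_vec x)"
        unfolding max_free_iff using cw const_vec_hom[OF A.bd_hom x] by (simp add: fun_eq_iff)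
      then show False using u(2) const_vec_vec[OF x] by (auto simp: Bd_def)
    qed
    ultimately show "tor_nonzero F i j" unfolding tor_nonzero_def by blast
  next
    assume "tor_nonzero F i j"
    then obtain w where w: "w \<in> gfree {..<rk F i} (shift F i) j"
      "\<And>i'. i = Suc i' \<Longrightarrow> bd F i' w \<in> max_free {..<rk F i'}"
      "\<And>u. keys u \<subseteq> {..<rk F (Suc i)} \<Longrightarrow> w - bd F i u \<notin> max_free {..<rk F i}"
      by (auto simp: tor_nonzero_def)
    have kw: "keys w \<subseteq> {..<rk F i}" by (rule gfreeD(1)[OF w(1)])
    have "const_vec w \<in> ?W"
    proof -
      have "?d i' (const_vec w) = (\<lambda>_. 0)" if "i = Suc i'" for i'
        using w(2)[OF that] const_vec_hom[OF A.bd_hom, of w i'] kw that by (simp add: max_free_iff)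
      moreover have "shift F i l = j" if "const_vec w l \<noteq> 0" for l
        using that const_coeff_homog[OF gfreeD(2)[OF w(1), of l]] by (force simp: const_vec_def)
      ultimately show ?thesis using const_vec_vec[OF kw] by (simp add: Cy_def)
    qed
    moreover have "const_vec w \<notin> Bd i"
    proof
      assume "const_vec w \<in> Bd i"
      then obtain x where x: "x \<in> kvec (rk F (Suc i))" "const_vec w = ?d i x" by (auto simp: Bd_def)
      let ?x = "const_lift (rk F (Suc i)) x :: ('n, 'k) fvec"
      have "const_vec (bd F i ?x) = ?d i x" using const_vec_hom[OF A.bd_hom keys_const_lift] const_vec_lift[OF x(1)] by metis
      then have "w - bd F i ?x \<in> max_free {..<rk F i}"
        using kw free_hom_simps(1)[OF A.bd_hom keys_const_lift] x(2)
        by (simp add: max_free_iff keys_minus_subset fun_eq_iff)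
      then show False using w(3)[OF keys_const_lift] by blast
    qed
    ultimately show "\<exists>u\<in>?W. u \<notin> Bd i" by blast
  qed
  finally show ?thesis .
qed

section \<open>Shifts from a minimal resolution\<close>

lemma shift_sets:
  fixes M :: "(('n::finite, 'k::field) mpoly, 'm) module"
  assumes "graded_module M G" "graded_free_resolution M G F" "minimal_resolution F"
  shows "max_shift i M G = Max (shift F i ` {..<rk F i})"
    "min_shift i M G = Min (shift F i ` {..<rk F i})"
proof -
  have "graded_free_resolution M G (chosen_resolution M G)"
    unfolding chosen_resolution_def by (rule someI[of _ F]) (rule assms(2))
  then have "Tor_component i M G j \<noteq> {\<zero>\<^bsub>Tor_module i M G\<^esub>} \<longleftrightarrow> j \<in> shift F i ` {..<rk F i}" for j
    unfolding Tor_component_def Tor_module_def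
    by (simp only: homology_grading_nonzero_iff[OF assms(1)] tor_nonzero_iff_shift[OF assms(1) _ assms(2,3)])
  then have "{j. Tor_component i M G j \<noteq> {\<zero>\<^bsub>Tor_module i M G\<^esub>}} = shift F i ` {..<rk F i}" by blast
  then show "max_shift i M G = Max (shift F i ` {..<rk F i})"
    "min_shift i M G = Min (shift F i ` {..<rk F i})"
    by (simp_all only: max_shift_def min_shift_def)
qed

lemma proj_dimD:
  assumes "proj_dim M = enat p"
  shows "has_projective_resolution M p" "q < p \<Longrightarrow> \<not> has_projective_resolution M q"
proof -
  let ?A = "enat ` {p. has_projective_resolution M p}"
  have inf: "Inf ?A = enat p" using assms by (simp add: proj_dim_def)
  have ne: "?A \<noteq> {}"
  proof
    assume "?A = {}"
    then have "Inf ?A = \<infinity>" by (simp add: Inf_enat_def)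
    then show False using inf by simp
  qed
  have "Inf ?A \<in> ?A" unfolding Inf_enat_def using ne by (auto intro: LeastI)
  then show "has_projective_resolution M p" unfolding inf by auto
  show "\<not> has_projective_resolution M q" if "q < p"
  proof
    assume "has_projective_resolution M q"
    then have "Inf ?A \<le> enat q" by (intro Inf_lower) simp
    then show False using inf that by simp
  qed
qed

section \<open>Annihilators and the last two steps of a minimal resolution\<close>

text \<open>
  A nonzero constant acts invertibly, so it annihilates only the zero module.
\<close>

lemma annihilator_degree_pos:
  fixes M :: "(('n::finite, 'k::field) mpoly, 'm) module"
  assumes M: "module base_ring M" and "carrier M \<noteq> {\<zero>\<^bsub>M\<^esub>}"
    and f: "f \<in> annihilator M" "f \<noteq> 0" "f \<in> homog j"
  shows "0 < j"
proof (rule ccontr)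
  assume "\<not> 0 < j"
  then have "j = 0" using homog_neg_eq_0[OF f(3)] f(2) by force
  interpret module base_ring M by (rule M)
  define c where "c = const_coeff f"
  have fc: "f = single 0 c" using homog_zero_eq_const f(3) \<open>j = 0\<close> by (simp add: c_def)
  then have "c \<noteq> 0" using f(2) by auto
  then have one: "single 0 (1 / c) * f = 1" by (simp add: fc mult_single)
  have "x = \<zero>\<^bsub>M\<^esub>" if x: "x \<in> carrier M" for x
  proof -
    have "x = (single 0 (1 / c) * f) \<odot>\<^bsub>M\<^esub> x" using one smult_one[OF x] by simp
    also have "\<dots> = single 0 (1 / c) \<odot>\<^bsub>M\<^esub> (f \<odot>\<^bsub>M\<^esub> x)" using smult_assoc1[of "single 0 (1 / c)" f x] x by simp
    also have "\<dots> = \<zero>\<^bsub>M\<^esub>" using f(1) x smult_r_null[of "single 0 (1 / c)"] by (simp add: annihilator_def)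
    finally show ?thesis .
  qed
  then show False using assms(2) M.zero_closed by blast
qed

context graded_resolution
begin

text \<open>
  This is where the inequality comes from: at the last step the null-homotopy of multiplication by
  \<open>f\<close> reads $f e = h(\partial e)$, and the coefficients of $\partial e$ are homogeneous.
\<close>

lemma annihilator_last_step:
  assumes f: "f \<in> annihilator M" "f \<noteq> 0" "f \<in> homog d"
    and last: "rk F (Suc (Suc q)) = 0" and m: "m < rk F (Suc q)"
  shows "\<exists>l<rk F q. shift F (Suc q) m \<le> shift F q l + d"
proof (rule ccontr)
  assume neg: "\<not> ?thesis"
  note bds = free_hom_simps[OF bd_hom]
  define \<gamma> where "\<gamma> = (\<lambda>(i::nat) (x :: ('n, 'k) fvec). f \<star> x)"
  have comm: "f \<star> r \<star> x = r \<star> f \<star> x" for r and x :: "('n, 'k) fvec"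
    by (simp add: mult.commute flip: scale_distribs(3))
  have hom: "\<gamma> i \<in> mod_hom (free_module {..<rk F i}) (free_module {..<rk F i})" for i
    by (rule mod_homI) (simp_all add: \<gamma>_def scale_distribs(1) keys_scale_subset comm)
  have chain: "bd F i (\<gamma> (Suc i) x) = \<gamma> i (bd F i x)" if "keys x \<subseteq> {..<rk F (Suc i)}" for i x
    using that by (simp add: \<gamma>_def bds)
  have aug: "aug F (\<gamma> 0 x) = \<zero>\<^bsub>M\<^esub>" if "keys x \<subseteq> {..<rk F 0}" for x
    using mod_homD(3)[OF aug_hom, of x f] mod_homD(1)[OF aug_hom, of x] that f(1)
    by (simp add: \<gamma>_def annihilator_def)
  obtain h where h: "\<And>i. h i \<in> mod_hom (free_module {..<rk F i}) (free_module {..<rk F (Suc i)})"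
    "\<And>x. keys x \<subseteq> {..<rk F 0} \<Longrightarrow> \<gamma> 0 x = bd F 0 (h 0 x)"
    "\<And>i x. keys x \<subseteq> {..<rk F (Suc i)} \<Longrightarrow> \<gamma> (Suc i) x = bd F (Suc i) (h (Suc i) x) + h i (bd F i x)"
    using homotopy[OF hom chain aug] by blast
  let ?e = "single m 1 :: ('n, 'k) fvec"
  have e: "keys ?e \<subseteq> {..<rk F (Suc q)}" using m by simp
  have "h (Suc q) ?e = 0" using free_hom_simps(1)[OF h(1) e] last by simp
  then have "f \<star> ?e = h q (bd F q ?e)" using h(3)[OF e] bds(5) by (simp add: \<gamma>_def)
  also have "\<dots> = (\<Sum>l<rk F q. lookup (bd F q ?e) l \<star> h q (single l 1))"
    by (rule free_hom_expand[OF h(1)]) (use bds(1)[OF e] in simp_all)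
  \<comment> \<open>comparison of the coefficients at \<open>m\<close>\<close>
  finally have "lookup (f \<star> ?e) m = (\<Sum>l<rk F q. lookup (bd F q ?e) l * lookup (h q (single l 1)) m)"
    by (simp add: lookup_sum)
  then have sum: "f = (\<Sum>l<rk F q. lookup (bd F q ?e) l * lookup (h q (single l 1)) m)" by simp
  have "?e \<in> gfree {..<rk F (Suc q)} (shift F (Suc q)) (shift F (Suc q) m)" by (rule gfree_basis) (use m in simp)
  then have be: "bd F q ?e \<in> gfree {..<rk F q} (shift F q) (shift F (Suc q) m)" using bd_graded by blast
  have "\<exists>u. lookup f u \<noteq> 0" using f(2) by (metis lookup_zero poly_mapping_eqI)
  then obtain u where u: "lookup f u \<noteq> 0" ..
  then have du: "mdeg u = d" using f(3) by (simp add: homog_iff)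
  have "lookup f u = (\<Sum>l<rk F q. lookup (lookup (bd F q ?e) l * lookup (h q (single l 1)) m) u)"
    by (subst sum) (simp add: lookup_sum)
  also have "\<dots> = 0"
  proof (rule sum.neutral, rule ballI, rule ccontr)
    fix l assume l: "l \<in> {..<rk F q}" and "lookup (lookup (bd F q ?e) l * lookup (h q (single l 1)) m) u \<noteq> 0"
    then obtain a b where ab: "u = a + b" "a \<in> keys (lookup (bd F q ?e) l)"
      using Poly_Mapping.keys_mult[of "lookup (bd F q ?e) l" "lookup (h q (single l 1)) m"]
      by (auto simp: in_keys_iff)
    then have "mdeg a = shift F (Suc q) m - shift F q l"
      using gfreeD(2)[OF be, of l] by (simp add: homog_iff in_keys_iff)
    then have "shift F (Suc q) m - shift F q l \<le> d" using du ab(1) mdeg_add[of a b] mdeg_nonneg[of b] by simp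
    then show False using neg l by auto
  qed
  finally show False using u by simp
qed

lemma rank_0_pos:
  assumes "carrier M \<noteq> {\<zero>\<^bsub>M\<^esub>}"
  shows "rk F 0 \<noteq> 0"
proof
  assume "rk F 0 = 0"
  then have "carrier (res_mod F 0) = {0}" by (auto simp: res_mod_def)
  then have "carrier M = {aug F 0}" using exact_resolutionD(3)[OF exact] by simp
  moreover have "aug F 0 = \<zero>\<^bsub>M\<^esub>" using mod_hom_zero[OF aug_hom module_free modM] by simp
  ultimately show False using assms by simp
qed

text \<open>
  Otherwise \<open>M\<close> would be free on the basis of $F_0$, and \<open>f\<close> would not annihilate a basis element.
\<close>

lemma annihilator_not_projective:
  assumes "carrier M \<noteq> {\<zero>\<^bsub>M\<^esub>}" "f \<in> annihilator M" "f \<noteq> 0"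
  shows "rk F (Suc 0) \<noteq> 0"
proof
  assume r1: "rk F (Suc 0) = 0"
  let ?e = "single 0 f :: ('n, 'k) fvec"
  have e: "keys (single 0 (1 :: ('n, 'k) mpoly)) \<subseteq> {..<rk F 0}" "keys ?e \<subseteq> {..<rk F 0}"
    using rank_0_pos[OF assms(1)] by (simp_all del: single_one)
  have "aug F (f \<star> single 0 1) = \<zero>\<^bsub>M\<^esub>"
    using mod_homD(3)[OF aug_hom, of "single 0 1" f] mod_homD(1)[OF aug_hom, of "single 0 1"] e(1) assms(2)
    by (simp add: annihilator_def del: single_one)
  then have "aug F ?e = \<zero>\<^bsub>M\<^esub>" by (simp del: single_one)
  then obtain y where "keys y \<subseteq> {..<rk F (Suc 0)}" "bd F 0 y = ?e" using exact_bd0[OF e(2)] by blast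
  then have "?e = 0" using r1 free_hom_simps(5)[OF bd_hom, of 0] by simp
  then have "lookup ?e 0 = 0" by simp
  then show False using assms(3) by simp
qed

end

lemma annihilator_shift_bound:
  fixes M :: "(('n::finite, 'k::field) mpoly, 'm) module"
  assumes hM: "graded_module M G" "fin_gen M" "carrier M \<noteq> {\<zero>\<^bsub>M\<^esub>}" and pd: "proj_dim M = enat p"
    and f: "f \<in> annihilator M" "f \<noteq> 0" "f \<in> homog d"
  shows "max_shift p M G \<le> max_shift (p - 1) M G + d"
proof -
  obtain F where res: "graded_free_resolution M G F" "minimal_resolution F"
    using ex_minimal_resolution[OF hM(1,2)] by blast
  interpret graded_resolution M G F by unfold_locales (rule hM(1), rule res(1))
  have zero: "rk F (Suc p) = 0"
    by (rule rank_zero_beyond_projective_length[OF hM(1) res proj_dimD(1)[OF pd]]) simp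
  \<comment> \<open>\<open>p - 1\<close> is a truncated subtraction, so \<open>p = 0\<close> has to be excluded\<close>
  have "p \<noteq> 0" using zero annihilator_not_projective[OF hM(3) f(1,2)] by (cases p) auto
  then obtain q where q: "p = Suc q" using not0_implies_Suc by blast
  \<comment> \<open>the maximum of the shifts of $F_p$ is taken over a nonempty set\<close>
  have "rk F p \<noteq> 0"
    using projective_length_of_rank_zero[OF hM(1) res, of q] proj_dimD(2)[OF pd, of q] q by auto
  then have ne: "shift F p ` {..<rk F p} \<noteq> {}" by auto
  have "Max (shift F p ` {..<rk F p}) \<le> Max (shift F q ` {..<rk F q}) + d"
  proof (rule Max.boundedI)
    fix j assume "j \<in> shift F p ` {..<rk F p}"
    then obtain m where m: "m < rk F p" "j = shift F p m" by auto
    then obtain l where l: "l < rk F q" "j \<le> shift F q l + d"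
      using annihilator_last_step[OF f, of q m] zero q by auto
    then have "shift F q l \<le> Max (shift F q ` {..<rk F q})" by (intro Max_ge) auto
    then show "j \<le> Max (shift F q ` {..<rk F q}) + d" using l(2) by simp
  qed (use ne in auto)
  then show ?thesis using q by (simp add: shift_sets[OF hM(1) res])
qed

section \<open>Quotients by homogeneous ideals\<close>

lemma hcomp_mult_homog:
  fixes f :: "('n::finite, 'k::field) mpoly"
  assumes "r \<in> homog i"
  shows "hcomp j (r * f) = r * hcomp (j - i) f"
proof -
  define J where "J = insert (j - i) (mdeg ` keys f)"
  have "hcomp j (r * f) = hcomp j (\<Sum>k\<in>J. r * hcomp k f)"
    using sum_hcomp[of J f] by (simp add: J_def subset_insertI flip: sum_distrib_left)
  also have "\<dots> = (\<Sum>k\<in>J. hcomp j (r * hcomp k f))"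
    by (induction J rule: infinite_finite_induct) (simp_all add: hcomp_add)
  also have "\<dots> = (\<Sum>k\<in>J. if k = j - i then r * hcomp k f else 0)"
    by (rule sum.cong[OF refl]) (use hcomp_of_homog[OF homog_mult[OF assms hcomp_homog]] in auto)
  also have "\<dots> = r * hcomp (j - i) f" by (simp add: J_def)
  finally show ?thesis .
qed

lemma hcomp_sum: "hcomp j (\<Sum>i\<in>A. f i) = (\<Sum>i\<in>A. hcomp j (f i))"
  by (induction A rule: infinite_finite_induct) (simp_all add: hcomp_add)

text \<open>
  The polynomials all of whose components lie in \<open>I\<close> form an ideal that contains the homogeneous
  generators of \<open>I\<close>.
\<close>

lemma homogeneous_ideal_facts:
  fixes I :: "('n::finite, 'k::field) mpoly set"
  assumes "homogeneous_ideal I"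
  shows "ideal I base_ring" "f \<in> I \<Longrightarrow> hcomp j f \<in> I"
proof -
  obtain A where A: "A \<subseteq> (\<Union>j. homog j)" "I = genideal base_ring A"
    using assms by (auto simp: homogeneous_ideal_def)
  show I: "ideal I base_ring" unfolding A(2) by (rule genideal_facts)
  then have I': "0 \<in> I" "\<And>x y. x \<in> I \<Longrightarrow> y \<in> I \<Longrightarrow> x + y \<in> I" "\<And>r x. x \<in> I \<Longrightarrow> r * x \<in> I"
    by (auto simp: ideal_base_ring_iff)
  have sumI: "(\<Sum>i\<in>B. F i) \<in> I" if "\<And>i. i \<in> B \<Longrightarrow> F i \<in> I" for B :: "int set" and F
    using that by (induction B rule: infinite_finite_induct) (simp_all add: I')
  let ?K = "{f. \<forall>j. hcomp j f \<in> I}"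
  have "ideal ?K base_ring"
    unfolding ideal_base_ring_iff
  proof (intro conjI ballI allI)
    fix r x assume x: "x \<in> ?K"
    have "hcomp j (r * x) \<in> I" for j
    proof -
      have "r * x = (\<Sum>i\<in>mdeg ` keys r. hcomp i r * x)"
        using sum_hcomp[of "mdeg ` keys r" r] by (simp flip: sum_distrib_right)
      then have "hcomp j (r * x) = (\<Sum>i\<in>mdeg ` keys r. hcomp i r * hcomp (j - i) x)"
        by (simp add: hcomp_sum hcomp_mult_homog[OF hcomp_homog])
      also have "\<dots> \<in> I" by (rule sumI, rule I'(3)) (use x in simp)
      finally show ?thesis .
    qed
    then show "r * x \<in> ?K" by simp
  qed (auto simp: hcomp_add I')
  moreover have "A \<subseteq> ?K"
  proof safe
    fix a j assume a: "a \<in> A"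
    then obtain i where "a \<in> homog i" using A(1) by blast
    then show "hcomp j a \<in> I"
      using genideal_facts(2)[of A] a A(2) I'(1) by (auto simp: hcomp_of_homog)
  qed
  ultimately have "I \<subseteq> ?K" unfolding A(2) by (rule genideal_least)
  then show "f \<in> I \<Longrightarrow> hcomp j f \<in> I" by blast
qed

locale ring_quotient =
  fixes I :: "('n::finite, 'k::field) mpoly set"
  assumes hom_ideal: "homogeneous_ideal I"
begin

abbreviation Q where "Q \<equiv> quot_ring_module I"

lemma ideal_closed: "0 \<in> I" "x \<in> I \<Longrightarrow> y \<in> I \<Longrightarrow> x + y \<in> I" "x \<in> I \<Longrightarrow> r * x \<in> I" "x \<in> I \<Longrightarrow> - x \<in> I"
   "x \<in> I \<Longrightarrow> y \<in> I \<Longrightarrow> x - y \<in> I"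
proof -
  have I: "0 \<in> I" "\<And>x y. x \<in> I \<Longrightarrow> y \<in> I \<Longrightarrow> x + y \<in> I" "\<And>r x. x \<in> I \<Longrightarrow> r * x \<in> I"
    using homogeneous_ideal_facts(1)[OF hom_ideal] by (auto simp: ideal_base_ring_iff)
  show "0 \<in> I" "x \<in> I \<Longrightarrow> y \<in> I \<Longrightarrow> x + y \<in> I" "x \<in> I \<Longrightarrow> r * x \<in> I" by (rule I; assumption)+
  have neg: "- x \<in> I" if "x \<in> I" for x using I(3)[OF that, of "- 1"] by simp
  show "x \<in> I \<Longrightarrow> - x \<in> I" by (rule neg)
  show "x \<in> I \<Longrightarrow> y \<in> I \<Longrightarrow> x - y \<in> I" using I(2)[of x "- y"] neg[of y] by simp
qed

lemma rcos_eq_iff: "rcos I f = rcos I g \<longleftrightarrow> f - g \<in> I"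
proof
  assume "rcos I f = rcos I g"
  moreover have "f \<in> rcos I f" using ideal_closed(1) by (simp add: rcos_eq)
  ultimately have "f \<in> rcos I g" by simp
  then show "f - g \<in> I" by (simp add: rcos_eq)
next
  assume fg: "f - g \<in> I"
  have "h - f \<in> I \<longleftrightarrow> h - g \<in> I" for h
    using ideal_closed(2)[OF _ fg, of "h - f"] ideal_closed(5)[OF _ fg, of "h - g"] by (auto simp: algebra_simps)
  then show "rcos I f = rcos I g" by (simp add: rcos_eq)
qed

lemma Q_carrier: "carrier Q = range (rcos I)"
  by (rule quot_ring_module_carrier)

lemma Q_zero: "\<zero>\<^bsub>Q\<^esub> = rcos I 0"
  by (simp add: quot_ring_module_def quot_module_def rcos_eq)

lemma Q_add: "rcos I f \<oplus>\<^bsub>Q\<^esub> rcos I g = rcos I (f + g)"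
proof -
  have "rcos I f \<oplus>\<^bsub>Q\<^esub> rcos I g = {x + y |x y. x \<in> rcos I f \<and> y \<in> rcos I g}"
    by (auto simp: quot_ring_module_def quot_module_def set_add_def')
  also have "\<dots> = rcos I (f + g)"
  proof (intro equalityI subsetI)
    fix z assume "z \<in> {x + y |x y. x \<in> rcos I f \<and> y \<in> rcos I g}"
    then obtain x y where "z = x + y" "x - f \<in> I" "y - g \<in> I" by (auto simp: rcos_eq)
    then show "z \<in> rcos I (f + g)" using ideal_closed(2)[of "x - f" "y - g"] by (simp add: rcos_eq algebra_simps)
  next
    fix z assume "z \<in> rcos I (f + g)"
    then have "z - f \<in> rcos I g" "f \<in> rcos I f" "z = f + (z - f)"
      using ideal_closed(1) by (simp_all add: rcos_eq algebra_simps)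
    then show "z \<in> {x + y |x y. x \<in> rcos I f \<and> y \<in> rcos I g}" by blast
  qed
  finally show ?thesis .
qed

lemma Q_smult: "r \<odot>\<^bsub>Q\<^esub> rcos I f = rcos I (r * f)"
proof -
  have "rcos I (r * x) = rcos I (r * f)" if "x \<in> rcos I f" for x
    using that ideal_closed(3)[of "x - f" r] by (simp add: rcos_eq_iff rcos_eq[of I f] algebra_simps)
  moreover have "f \<in> rcos I f" using ideal_closed(1) by (simp add: rcos_eq)
  moreover have "r \<odot>\<^bsub>Q\<^esub> rcos I f = (\<Union>x\<in>rcos I f. rcos I (r * x))"
    by (simp add: quot_ring_module_def quot_module_def)
  ultimately show ?thesis by blast
qed

lemma module_Q: "module base_ring Q"
proof (rule moduleI)
  show "cring (base_ring :: ('n, 'k) mpoly ring)" by (rule cring_from_type_algebra)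
  show "abelian_group Q"
  proof (rule abelian_groupI)
    fix x assume "x \<in> carrier Q"
    then obtain f where "x = rcos I f" by (auto simp: Q_carrier)
    then show "\<exists>y\<in>carrier Q. y \<oplus>\<^bsub>Q\<^esub> x = \<zero>\<^bsub>Q\<^esub>"
      by (intro bexI[of _ "rcos I (- f)"]) (simp_all add: Q_carrier Q_add Q_zero)
  qed (auto simp: Q_carrier Q_add Q_zero algebra_simps)
qed (auto simp: Q_carrier Q_add Q_smult algebra_simps)

lemma finsum_Q: "finite A \<Longrightarrow> finsum Q (\<lambda>i. rcos I (g i)) A = rcos I (\<Sum>i\<in>A. g i)"
proof (induction A rule: finite_induct)
  interpret module base_ring Q by (rule module_Q)
  case empty
  show ?case by (simp add: Q_zero)
  case (insert x F)
  then show ?case by (simp add: Q_carrier Q_add)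
qed

text \<open>
  The components of the class of \<open>f\<close> are the classes of the components of \<open>f\<close>. They are unique because
  \<open>I\<close> contains the components of its elements.
\<close>

lemma graded_module_Q: "graded_module Q (quot_ring_grading I)"
proof -
  interpret module base_ring Q by (rule module_Q)
  have G: "quot_ring_grading I j = rcos I ` homog j" for j by (simp add: quot_ring_grading_def)
  have sub: "subgroup (rcos I ` homog j) (add_monoid Q)" for j
  proof
    fix x assume "x \<in> rcos I ` homog j"
    then obtain f where f: "f \<in> homog j" "x = rcos I f" by blast
    have "\<ominus>\<^bsub>Q\<^esub> x = rcos I (- f)"
      by (rule M.minus_equality) (simp_all add: f(2) Q_carrier Q_add Q_zero)
    then show "inv\<^bsub>add_monoid Q\<^esub> x \<in> rcos I ` homog j" using homog_uminus[OF f(1)] by (simp add: a_inv_def)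
  qed (auto simp: Q_carrier Q_add Q_zero homog_add)
  have uniq: "\<exists>!c. (\<forall>j. c j \<in> rcos I ` homog j) \<and> finite {j. c j \<noteq> \<zero>\<^bsub>Q\<^esub>} \<and>
      x = (\<Oplus>\<^bsub>Q\<^esub>j\<in>{j. c j \<noteq> \<zero>\<^bsub>Q\<^esub>}. c j)" if xQ: "x \<in> carrier Q" for x
  proof -
    obtain f where x: "x = rcos I f" using xQ by (auto simp: Q_carrier)
    let ?J = "mdeg ` keys f"
    let ?c = "\<lambda>j. rcos I (hcomp j f)"
    show ?thesis
    proof (rule ex1I[of _ ?c], intro conjI)
      show "\<forall>j. ?c j \<in> rcos I ` homog j" by simp
      have sub: "{j. ?c j \<noteq> \<zero>\<^bsub>Q\<^esub>} \<subseteq> ?J" 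
      proof
        fix j assume "j \<in> {j. ?c j \<noteq> \<zero>\<^bsub>Q\<^esub>}"
        then have "hcomp j f \<noteq> 0" by (auto simp: Q_zero)
        then show "j \<in> ?J" by (rule hcomp_neq_0)
      qed
      then show fin: "finite {j. ?c j \<noteq> \<zero>\<^bsub>Q\<^esub>}" by (rule finite_subset) simp
      have "(\<Oplus>\<^bsub>Q\<^esub>j\<in>{j. ?c j \<noteq> \<zero>\<^bsub>Q\<^esub>}. ?c j) = (\<Oplus>\<^bsub>Q\<^esub>j\<in>?J. ?c j)"
        by (rule M.add.finprod_mono_neutral_cong_left) (use sub in \<open>auto simp: Q_carrier\<close>)
      also have "\<dots> = x" using sum_hcomp[of ?J f] by (simp add: finsum_Q x)
      finally show "x = (\<Oplus>\<^bsub>Q\<^esub>j\<in>{j. ?c j \<noteq> \<zero>\<^bsub>Q\<^esub>}. ?c j)" ..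
      fix c assume c: "(\<forall>j. c j \<in> rcos I ` homog j) \<and> finite {j. c j \<noteq> \<zero>\<^bsub>Q\<^esub>} \<and>
        x = (\<Oplus>\<^bsub>Q\<^esub>j\<in>{j. c j \<noteq> \<zero>\<^bsub>Q\<^esub>}. c j)"
      let ?S = "{j. c j \<noteq> \<zero>\<^bsub>Q\<^esub>}"
      have "\<forall>j. \<exists>g. g \<in> homog j \<and> c j = rcos I g" using c by blast
      from choice[OF this] obtain g where g: "\<forall>j. g j \<in> homog j \<and> c j = rcos I (g j)" by (rule exE)
      have "x = (\<Oplus>\<^bsub>Q\<^esub>j\<in>?S. rcos I (g j))" using c g by simp
      then have "rcos I f = rcos I (\<Sum>j\<in>?S. g j)" using finsum_Q[of ?S g] c x by simp
      then have "f - (\<Sum>j\<in>?S. g j) \<in> I" by (simp only: rcos_eq_iff)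
      then have "hcomp i (f - (\<Sum>j\<in>?S. g j)) \<in> I" for i by (rule homogeneous_ideal_facts(2)[OF hom_ideal])
      moreover have "hcomp i (f - (\<Sum>j\<in>?S. g j)) = hcomp i f - (if i \<in> ?S then g i else 0)" for i
      proof -
        have "hcomp i (\<Sum>j\<in>?S. g j) = (\<Sum>j\<in>?S. if i = j then g j else 0)"
          unfolding hcomp_sum by (rule sum.cong[OF refl]) (use g hcomp_of_homog in blast)
        also have "\<dots> = (if i \<in> ?S then g i else 0)" using c by simp
        finally have s: "hcomp i (\<Sum>j\<in>?S. g j) = (if i \<in> ?S then g i else 0)" .
        have "hcomp i f = hcomp i (f - (\<Sum>j\<in>?S. g j)) + hcomp i (\<Sum>j\<in>?S. g j)"
          by (simp flip: hcomp_add)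
        then show ?thesis using s by simp
      qed
      ultimately have "rcos I (hcomp i f) = rcos I (if i \<in> ?S then g i else 0)" for i by (simp only: rcos_eq_iff)
      moreover have "rcos I (if i \<in> ?S then g i else 0) = c i" for i
        using g by (cases "i \<in> ?S") (simp_all add: Q_zero)
      ultimately show "c = ?c" by (intro ext) simp
    qed
  qed
  show ?thesis
    unfolding graded_module_def G
    using module_Q sub uniq by (auto simp: Q_smult homog_mult)
qed

lemma fin_gen_Q: "fin_gen Q"
proof -
  interpret module base_ring Q by (rule module_Q)
  have "submodule_span Q {rcos I 1} = carrier Q"
  proof
    show "submodule_span Q {rcos I 1} \<subseteq> carrier Q"
      using carrier_is_submodule by (auto simp: submodule_span_def Q_carrier)
    show "carrier Q \<subseteq> submodule_span Q {rcos I 1}"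
      unfolding submodule_span_def
    proof (rule Inter_greatest, safe)
      fix N x assume N: "submodule N base_ring Q" "{rcos I 1} \<subseteq> N" and "x \<in> carrier Q"
      then obtain f where "x = f \<odot>\<^bsub>Q\<^esub> rcos I 1" by (auto simp: Q_carrier Q_smult)
      then show "x \<in> N" using submoduleE(4)[OF N(1), of f "rcos I 1"] N(2) by simp
    qed
  qed
  then show ?thesis unfolding fin_gen_def by (intro exI[of _ "{rcos I 1}"]) (simp add: Q_carrier)
qed

lemma annihilator_Q: "f \<in> I \<Longrightarrow> f \<in> annihilator Q"
  using ideal_closed(3)[of f] by (auto simp: annihilator_def Q_carrier Q_smult Q_zero rcos_eq_iff mult.commute)

definition quot_aug :: "('n, 'k) fvec \<Rightarrow> ('n, 'k) mpoly set" where
  "quot_aug v = rcos I (lookup v 0)"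

lemma quot_aug_eq_zero: "quot_aug v = \<zero>\<^bsub>Q\<^esub> \<longleftrightarrow> lookup v 0 \<in> I"
  by (simp add: quot_aug_def Q_zero rcos_eq_iff)

context
  assumes proper: "I \<noteq> UNIV"
begin

lemma one_notin: "1 \<notin> I"
proof
  assume "1 \<in> I"
  then have "r \<in> I" for r using ideal_closed(3)[of 1 r] by simp
  then show False using proper by blast
qed

lemma nonzero_Q: "carrier Q \<noteq> {\<zero>\<^bsub>Q\<^esub>}"
proof
  assume "carrier Q = {\<zero>\<^bsub>Q\<^esub>}"
  then have "rcos I 1 = rcos I 0" by (auto simp: Q_carrier Q_zero)
  then show False using one_notin by (simp add: rcos_eq_iff)
qed

text \<open>
  A nonzero constant term would be a homogeneous component of an element of \<open>I\<close>, hence a unit in \<open>I\<close>.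
\<close>

lemma const_coeff_zero:
  assumes "f \<in> I"
  shows "const_coeff f = 0"
proof (rule ccontr)
  assume c: "const_coeff f \<noteq> 0"
  have "hcomp 0 f = single 0 (const_coeff f)"
    using homog_zero_eq_const[of "hcomp 0 f"] by (simp add: const_coeff_hcomp)
  then have "single 0 (1 / const_coeff f) * single 0 (const_coeff f) \<in> I"
    using ideal_closed(3)[OF homogeneous_ideal_facts(2)[OF hom_ideal assms, of 0]] by simp
  then show False using c one_notin by (simp add: mult_single)
qed

lemma minimal_cover_Q: "minimal_cover Q (quot_ring_grading I) 1 (\<lambda>_. 0) quot_aug"
  unfolding minimal_cover_def
proof (intro conjI allI)
  show "quot_aug \<in> mod_hom (free_module {..<1}) Q"
    by (rule mod_homI) (auto simp: quot_aug_def Q_carrier Q_add Q_smult lookup_add)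
  show "quot_aug ` {v. keys v \<subseteq> {..<1}} = carrier Q"
  proof (intro equalityI subsetI)
    fix x assume "x \<in> carrier Q"
    then obtain f where "x = rcos I f" by (auto simp: Q_carrier)
    then show "x \<in> quot_aug ` {v. keys v \<subseteq> {..<1}}"
      by (intro image_eqI[of _ _ "single 0 f"]) (simp_all add: quot_aug_def)
  qed (auto simp: quot_aug_def Q_carrier)
  show "quot_aug ` gfree {..<1} (\<lambda>_. 0) j \<subseteq> quot_ring_grading I j" for j
    by (auto simp: quot_aug_def quot_ring_grading_def gfree_def)
  show "{v. keys v \<subseteq> {..<1} \<and> quot_aug v = \<zero>\<^bsub>Q\<^esub>} \<subseteq> max_free {..<1}"
  proof safe
    fix v assume v: "keys v \<subseteq> {..<1}" "quot_aug v = \<zero>\<^bsub>Q\<^esub>"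
    have "const_coeff (lookup v b) = 0" for b
      using v const_coeff_zero[of "lookup v 0"] lookup_outside[OF v(1), of b]
      by (cases "b = 0") (simp_all add: quot_aug_eq_zero)
    then show "v \<in> max_free {..<1}" using v(1) by (simp add: max_free_def)
  qed
qed

text \<open>
  A minimal resolution that starts with the projection $S \to S/I$ sends the basis elements of $F_1$ to
  elements of \<open>I\<close> of the same degrees. These are nonzero, since by minimality no basis element is a
  cycle: cycles are boundaries and lie in $\mathfrak{m} F_1$.
\<close>

lemma min_shift_witness:
  assumes nz: "I \<noteq> {0}"
  shows "\<exists>f\<in>I. f \<noteq> 0 \<and> f \<in> homog (min_shift 1 Q (quot_ring_grading I))"
proof -
  obtain F where F: "graded_free_resolution Q (quot_ring_grading I) F" "minimal_resolution F" "rk F 0 = 1"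
      "shift F 0 = (\<lambda>_. 0)" "aug F = quot_aug"
    using minimal_resolution_from_cover[OF graded_module_Q minimal_cover_Q] by blast
  interpret R: graded_resolution Q "quot_ring_grading I" F by unfold_locales (rule graded_module_Q, rule F(1))
  \<comment> \<open>the minimum defining $t_1$ is taken over a nonempty set: otherwise $S/I$ would be free and $I = 0$\<close>
  have "rk F 1 \<noteq> 0"
  proof
    assume r: "rk F 1 = 0"
    obtain f where f: "f \<in> I" "f \<noteq> 0" using nz ideal_closed(1) by blast
    have k: "keys (single 0 f :: ('n, 'k) fvec) \<subseteq> {..<rk F 0}" using F(3) by simp
    have "aug F (single 0 f) = \<zero>\<^bsub>Q\<^esub>" using f(1) by (simp add: F(5) quot_aug_eq_zero)
    then obtain y where "keys y \<subseteq> {..<rk F (Suc 0)}" "bd F 0 y = single 0 f"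
      using R.exact_bd0[OF k] by blast
    then have "single (0::nat) f = 0" using r free_hom_simps(5)[OF R.bd_hom, of 0] by simp
    then have "lookup (single (0::nat) f) 0 = 0" by simp
    then show False using f(2) by simp
  qed
  then have "shift F 1 ` {..<rk F 1} \<noteq> {}" by auto
  then have "min_shift 1 Q (quot_ring_grading I) \<in> shift F 1 ` {..<rk F 1}"
    unfolding shift_sets[OF graded_module_Q F(1,2)] by (intro Min_in) auto
  then obtain l where l: "l < rk F 1" "min_shift 1 Q (quot_ring_grading I) = shift F 1 l" by auto
  let ?e = "single l 1 :: ('n, 'k) fvec"
  have e: "keys ?e \<subseteq> {..<rk F (Suc 0)}" using l(1) by simp
  have ke: "keys (bd F 0 ?e) \<subseteq> {..<rk F 0}" by (rule free_hom_simps(1)[OF R.bd_hom e])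
  define f where "f = lookup (bd F 0 ?e) 0"
  have "?e \<in> gfree {..<rk F (Suc 0)} (shift F (Suc 0)) (shift F (Suc 0) l)" by (rule gfree_basis) (use l in simp)
  then have "bd F 0 ?e \<in> gfree {..<rk F 0} (shift F 0) (shift F (Suc 0) l)" using R.bd_graded by blast
  then have "f \<in> homog (shift F 1 l)" using gfreeD(2)[of "bd F 0 ?e" _ "shift F 0" _ 0] F(4) by (auto simp: f_def)
  moreover have "f \<in> I"
  proof -
    have "aug F (bd F 0 ?e) = \<zero>\<^bsub>Q\<^esub>" using R.exact_bd0[OF ke] e by blast
    then show ?thesis by (simp add: F(5) quot_aug_eq_zero f_def)
  qed
  moreover have "f \<noteq> 0"
  proof
    assume "f = 0"
    then have "lookup (bd F 0 ?e) b = 0" for b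
      using lookup_outside[OF ke, of b] F(3) by (cases "b = 0") (simp_all add: f_def)
    then have "bd F 0 ?e = 0" by (intro poly_mapping_eqI) simp
    then obtain y where "keys y \<subseteq> {..<rk F (Suc (Suc 0))}" "bd F (Suc 0) y = ?e" using R.exact_bd[OF e] by blast
    then have "?e \<in> max_free {..<rk F (Suc 0)}" using F(2) unfolding minimal_resolution_def by metis
    then show False by (rule notE[OF basis_not_max_free])
  qed
  ultimately show ?thesis using l(2) by auto
qed

end

end

lemma genideal_single: "genideal base_ring {f} = range (\<lambda>r. r * f)" for f :: "'r::comm_ring_1"
proof
  have "ideal (range (\<lambda>r. r * f)) (base_ring :: 'r ring)"
    unfolding ideal_base_ring_iff
  proof (intro conjI ballI allI)
    show "0 \<in> range (\<lambda>r. r * f)" by (rule range_eqI[of _ _ 0]) simp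
    fix x y assume "x \<in> range (\<lambda>r. r * f)" "y \<in> range (\<lambda>r. r * f)"
    then obtain a b where "x = a * f" "y = b * f" by blast
    then show "x + y \<in> range (\<lambda>r. r * f)" by (intro range_eqI[of _ _ "a + b"]) (simp add: distrib_right)
  next
    fix r x assume "x \<in> range (\<lambda>r. r * f)"
    then obtain a where "x = a * f" by blast
    then show "r * x \<in> range (\<lambda>r. r * f)" by (intro range_eqI[of _ _ "r * a"]) (simp add: mult.assoc)
  qed
  moreover have "f \<in> range (\<lambda>r. r * f)" by (rule range_eqI[of _ _ 1]) simp
  ultimately show "genideal base_ring {f} \<subseteq> range (\<lambda>r. r * f)" by (intro genideal_least) auto
  show "range (\<lambda>r. r * f) \<subseteq> genideal base_ring {f}"
    using genideal_facts[of "{f}"] unfolding ideal_base_ring_iff by auto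
qed

text \<open>
  The complex $0 \to S(-d) \to S$ with multiplication by \<open>f\<close> is a minimal resolution of $S/(f)$: it is
  exact because $S$ has no zero divisors, and minimal because \<open>f\<close> has no constant term.
\<close>

lemma max_shift_principal:
  fixes f :: "('n::finite, 'k::field) mpoly"
  assumes f: "f \<noteq> 0" "f \<in> homog d" and d: "0 < d"
  shows "max_shift 1 (quot_ring_module (genideal base_ring {f})) (quot_ring_grading (genideal base_ring {f})) = d"
proof -
  let ?I = "genideal base_ring {f}"
  note I_eq = genideal_single[of f]
  have cf: "const_coeff f = 0" using const_coeff_homog[OF f(2)] d by simp
  have "homogeneous_ideal ?I" unfolding homogeneous_ideal_def using f(2) by (intro exI[of _ "{f}"]) auto
  then interpret ring_quotient ?I by unfold_locales
  have "1 \<notin> ?I"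
  proof
    assume "1 \<in> ?I"
    then obtain r where r: "1 = r * f" unfolding I_eq by blast
    have "const_coeff (1 :: ('n, 'k) mpoly) = 0" unfolding r const_coeff_mult cf by simp
    then show False by simp
  qed
  then have proper: "?I \<noteq> UNIV" by blast
  note cover = minimal_cover_Q[OF proper]
  define F :: "(('n, 'k) mpoly, ('n, 'k) mpoly set) free_resolution" where
    "F = \<lparr>rk = (\<lambda>i. if i \<le> 1 then 1 else 0), shift = (\<lambda>i _. if i = 0 then 0 else d), aug = quot_aug,
      bd = (\<lambda>i v. if i = 0 then single 0 (f * lookup v 0) else 0)\<rparr>"
  have k1: "keys v \<subseteq> {..<Suc 0} \<Longrightarrow> v = single 0 (lookup v 0)" for v :: "('n, 'k) fvec"
    by (rule poly_mapping_eqI) (auto simp: lookup_single when_def lookup_outside)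
  have F0: "graded_free_resolution Q (quot_ring_grading ?I) F"
    unfolding graded_free_resolution_def exact_resolution_def
  proof (intro conjI allI)
    show "aug F \<in> mod_hom (res_mod F 0) Q" "aug F ` carrier (res_mod F 0) = carrier Q"
      using cover by (simp_all add: F_def res_mod_def minimal_cover_def)
    show "bd F i \<in> mod_hom (res_mod F (Suc i)) (res_mod F i)" for i
      by (rule mod_homI) (simp_all add: F_def res_mod_def lookup_add single_add algebra_simps)
    show "bd F 0 ` carrier (res_mod F (Suc 0)) = a_kernel (res_mod F 0) Q (aug F)"
    proof (intro equalityI subsetI)
      fix v assume "v \<in> bd F 0 ` carrier (res_mod F (Suc 0))"
      then obtain g where "v = single 0 (f * g)" by (auto simp: F_def res_mod_def)
      moreover have "f * g \<in> ?I" unfolding I_eq by (rule range_eqI[of _ _ g]) (rule mult.commute)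
      ultimately show "v \<in> a_kernel (res_mod F 0) Q (aug F)"
        by (simp add: a_kernel_eq F_def res_mod_def quot_aug_eq_zero)
    next
      fix v assume "v \<in> a_kernel (res_mod F 0) Q (aug F)"
      then have v: "keys v \<subseteq> {..<Suc 0}" "lookup v 0 \<in> ?I"
        by (auto simp: a_kernel_eq F_def res_mod_def quot_aug_eq_zero)
      then obtain r where r: "lookup v 0 = r * f" unfolding I_eq by blast
      then have "v = bd F 0 (single 0 r)" using k1[OF v(1)] by (simp add: F_def mult.commute)
      then show "v \<in> bd F 0 ` carrier (res_mod F (Suc 0))"
        by (rule image_eqI) (simp add: F_def res_mod_def)
    qed
    show "bd F (Suc i) ` carrier (res_mod F (Suc (Suc i))) = a_kernel (res_mod F (Suc i)) (res_mod F i) (bd F i)" for i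
    proof -
      have "v = 0" if v: "v \<in> a_kernel (res_mod F (Suc i)) (res_mod F i) (bd F i)" for v
      proof (cases i)
        case 0
        then have v': "keys v \<subseteq> {..<Suc 0}" "single (0::nat) (f * lookup v 0) = 0"
          using v by (auto simp: a_kernel_eq F_def res_mod_def)
        have "f * lookup v 0 = 0" using v'(2) by (metis lookup_single_eq lookup_zero)
        then have "lookup v 0 = 0" using mpoly_no_zero_divisors[OF f(1)] by blast
        then show ?thesis using k1[OF v'(1)] by simp
      next
        case (Suc j)
        then show ?thesis using v by (auto simp: a_kernel_eq F_def res_mod_def)
      qed
      moreover have "0 \<in> a_kernel (res_mod F (Suc i)) (res_mod F i) (bd F i)"
        by (simp add: a_kernel_eq F_def res_mod_def)
      ultimately have "a_kernel (res_mod F (Suc i)) (res_mod F i) (bd F i) = {0}" by blast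
      moreover have "bd F (Suc i) ` carrier (res_mod F (Suc (Suc i))) = {0}"
        by (auto simp: F_def res_mod_def)
      ultimately show ?thesis by simp
    qed
    show "aug F ` res_grading F 0 j \<subseteq> quot_ring_grading ?I j" for j
      using cover by (simp add: F_def res_grading_eq minimal_cover_def)
    show "bd F i ` res_grading F (Suc i) j \<subseteq> res_grading F i j" for i j
    proof (cases "i = 0")
      case True
      show ?thesis
      proof
        fix w assume "w \<in> bd F i ` res_grading F (Suc i) j"
        then obtain v where v: "v \<in> gfree {..<Suc 0} (\<lambda>_. d) j" "w = single 0 (f * lookup v 0)"
          using True by (auto simp: res_grading_eq F_def)
        have "f * lookup v 0 \<in> homog (d + (j - d))" by (rule homog_mult[OF f(2) gfreeD(2)[OF v(1)]])
        then have "w \<in> gfree {..<Suc 0} (\<lambda>_. 0) j"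
          unfolding v(2) using gfree_single[of 0 "{..<Suc 0}" "f * lookup v 0" j "\<lambda>_. 0"] by simp
        then show "w \<in> res_grading F i j" using True by (simp add: res_grading_eq F_def)
      qed
    next
      case False
      then show ?thesis by (auto simp: res_grading_eq F_def)
    qed
  qed
  have "minimal_resolution F"
    by (simp add: minimal_resolution_def F_def max_free_def lookup_single when_def const_coeff_mult cf)
  then show ?thesis
    using shift_sets(1)[OF graded_module_Q F0, of 1] by (simp add: F_def lessThan_Suc)
qed

theorem theorem3p1:
  shows
  "(\<forall>(M :: (('n::finite, 'k::field) mpoly, 'm) module) (G :: int \<Rightarrow> 'm set)
      (p :: nat) (f :: ('n, 'k) mpoly) (d :: nat).
      graded_module M G \<and> fin_gen M \<and> carrier M \<noteq> {\<zero>\<^bsub>M\<^esub>} \<and> proj_dim M = enat p \<and>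
      f \<in> annihilator M \<and> f \<noteq> 0 \<and> f \<in> homog (int d)
      \<longrightarrow> max_shift p M G \<le> max_shift (p - 1) M G + int d \<and>
          max_shift (p - 1) M G + int d =
            max_shift (p - 1) M G
              + max_shift 1 (quot_ring_module (genideal base_ring {f}))
                            (quot_ring_grading (genideal base_ring {f})))
   \<and>
   (\<forall>(I :: ('n, 'k) mpoly set) (p :: nat).
      ideal I (base_ring :: ('n, 'k) mpoly ring) \<and> homogeneous_ideal I \<and> I \<noteq> {0} \<and> I \<noteq> UNIV \<and>
      proj_dim (quot_ring_module I) = enat p
      \<longrightarrow> max_shift p (quot_ring_module I) (quot_ring_grading I)
            \<le> max_shift (p - 1) (quot_ring_module I) (quot_ring_grading I)
               + min_shift 1 (quot_ring_module I) (quot_ring_grading I))"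
proof (intro conjI allI impI; (elim conjE)?)
  fix M :: "(('n, 'k) mpoly, 'm) module" and G p d and f :: "('n, 'k) mpoly"
  assume M: "graded_module M G" "fin_gen M" "carrier M \<noteq> {\<zero>\<^bsub>M\<^esub>}" "proj_dim M = enat p"
    and f: "f \<in> annihilator M" "f \<noteq> 0" "f \<in> homog (int d)"
  show "max_shift p M G \<le> max_shift (p - 1) M G + int d"
    by (rule annihilator_shift_bound[OF M f])
  have "0 < int d" by (rule annihilator_degree_pos[OF graded_moduleD(1)[OF M(1)] M(3) f])
  then show "max_shift (p - 1) M G + int d = max_shift (p - 1) M G
      + max_shift 1 (quot_ring_module (genideal base_ring {f})) (quot_ring_grading (genideal base_ring {f}))"
    by (simp only: max_shift_principal[OF f(2,3)])
next
  fix I :: "('n, 'k) mpoly set" and p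
  assume hI: "homogeneous_ideal I" "I \<noteq> {0}" "I \<noteq> UNIV" and pd: "proj_dim (quot_ring_module I) = enat p"
  interpret ring_quotient I by unfold_locales (rule hI(1))
  obtain f where f: "f \<in> I" "f \<noteq> 0" "f \<in> homog (min_shift 1 Q (quot_ring_grading I))"
    using min_shift_witness[OF hI(3,2)] by blast
  show "max_shift p Q (quot_ring_grading I) \<le> max_shift (p - 1) Q (quot_ring_grading I) + min_shift 1 Q (quot_ring_grading I)"
    by (rule annihilator_shift_bound[OF graded_module_Q fin_gen_Q nonzero_Q[OF hI(3)] pd annihilator_Q[OF f(1)] f(2,3)])
qed

end
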